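(* For every integer $n\geq 2$ there exists a bounded convex domain $\Omega\subset\mathbb C^n$ with $C^2$-smooth boundary which is not strongly pseudoconvex, but for which $$\lim_{z\rightarrow b\Omega}S_\Omega(z)=1,$$ where $S_\Omega$ denotes the squeezing function of $\Omega$ and $b\Omega$ denotes the boundary of $\Omega$.
   Context: $\mathbb B^n$ denotes the open unit ball in $\mathbb C^n$ and $B_r(0)$ the open ball of radius $r$ centred at the origin in $\mathbb C^n$. A domain is a nonempty connected open set. An embedding $f:\Omega\to\mathbb B^n$ of a domain $\Omega\subset\mathbb C^n$ means an injective holomorphic map. Squeezing function: let $\Omega\subset\mathbb C^n$ be a bounded domain and $z\in\Omega$. For an embedding $f_z:\Omega\to\mathbb B^n$ with $f_z(z)=0$ set $$S_{\Omega,f_z}(z):=\sup\{r>0: B_r(0)\subset f_z(\Omega)\},$$ and then $S_\Omega(z):=\sup_{f_z}S_{\Omega,f_z}(z)$, the supremum being over all such embeddings $f_z$. The statement $\lim_{z\to b\Omega}S_\Omega(z)=1$ means: for every $\epsilon>0$ there is $\delta>0$ such that $|S_\Omega(z)-1|<\epsilon$ for all $z\in\Omega$ with $\mathrm{dist}(z,b\Omega)<\delta$. A bounded domain with $C^2$-smooth boundary is strongly (equivalently, strictly) pseudoconvex if at every boundary point the Levi form of a $C^2$ defining function (negative inside the domain, with nonvanishing gradient on the boundary) is positive definite on the complex tangent space to the boundary at that point. *)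

theory Defs
  imports "HOL-Analysis.Analysis"
begin

definition bounded_domain :: "(complex ^ 'n) set \<Rightarrow> bool" where
  "bounded_domain \<Omega> \<longleftrightarrow> open \<Omega> \<and> connected \<Omega> \<and> \<Omega> \<noteq> {} \<and> bounded \<Omega>"


subsection \<open>Holomorphic embeddings and the squeezing function\<close>

definition holomorphic_map_on :: "(complex ^ 'n \<Rightarrow> complex ^ 'm) \<Rightarrow> (complex ^ 'n) set \<Rightarrow> bool" where
  "holomorphic_map_on f \<Omega> \<longleftrightarrow>
     (\<forall>z\<in>\<Omega>. \<exists>D. (f has_derivative D) (at z) \<and> (\<forall>c v. D (c *s v) = c *s D v))"

definition ball_embedding :: "(complex ^ 'n) set \<Rightarrow> (complex ^ 'n \<Rightarrow> complex ^ 'n) \<Rightarrow> bool" where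
  "ball_embedding \<Omega> f \<longleftrightarrow> holomorphic_map_on f \<Omega> \<and> inj_on f \<Omega> \<and> f ` \<Omega> \<subseteq> ball 0 1"

definition squeezing_of :: "(complex ^ 'n) set \<Rightarrow> (complex ^ 'n \<Rightarrow> complex ^ 'n) \<Rightarrow> real" where
  "squeezing_of \<Omega> f = Sup {r. r > 0 \<and> ball 0 r \<subseteq> f ` \<Omega>}"

text \<open>
  For a bounded domain \<open>\<Omega>\<close> and \<open>z \<in> \<Omega>\<close> both suprema are over nonempty sets that are bounded
  above by 1: an affine map embeds \<open>\<Omega>\<close> into the ball, and an injective holomorphic map
  between equidimensional spaces is open. So the real-valued \<open>Sup\<close> is the usual supremum.
\<close>
definition squeezing_function :: "(complex ^ 'n) set \<Rightarrow> complex ^ 'n \<Rightarrow> real" where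
  "squeezing_function \<Omega> z = (SUP f\<in>{f. ball_embedding \<Omega> f \<and> f z = 0}. squeezing_of \<Omega> f)"


subsection \<open>Domains with twice continuously differentiable boundary\<close>

definition C2_on :: "'a::real_normed_vector set \<Rightarrow> ('a \<Rightarrow> real) \<Rightarrow> bool" where
  "C2_on U \<rho> \<longleftrightarrow>
     (\<exists>(\<rho>' :: 'a \<Rightarrow> 'a \<Rightarrow>\<^sub>L real) (\<rho>'' :: 'a \<Rightarrow> 'a \<Rightarrow>\<^sub>L 'a \<Rightarrow>\<^sub>L real).
        (\<forall>x\<in>U. (\<rho> has_derivative blinfun_apply (\<rho>' x)) (at x)) \<and>
        (\<forall>x\<in>U. (\<rho>' has_derivative blinfun_apply (\<rho>'' x)) (at x)) \<and>
        continuous_on U \<rho>'')"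

text \<open>
  Defining functions are local, defined near a given boundary point; a global defining
  function is the special case where \<open>U\<close> contains the whole boundary. Values of \<open>\<rho>\<close> outside
  \<open>U\<close> are irrelevant.
\<close>
definition C2_defining_function ::
    "(complex ^ 'n) set \<Rightarrow> (complex ^ 'n) set \<Rightarrow> (complex ^ 'n \<Rightarrow> real) \<Rightarrow> bool" where
  "C2_defining_function \<Omega> U \<rho> \<longleftrightarrow>
     open U \<and> C2_on U \<rho> \<and>
     \<Omega> \<inter> U = {z\<in>U. \<rho> z < 0} \<and>
     frontier \<Omega> \<inter> U = {z\<in>U. \<rho> z = 0} \<and>
     (\<forall>z \<in> frontier \<Omega> \<inter> U. frechet_derivative \<rho> (at z) \<noteq> (\<lambda>_. 0))"

definition C2_boundary :: "(complex ^ 'n) set \<Rightarrow> bool" where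
  "C2_boundary \<Omega> \<longleftrightarrow> (\<forall>p \<in> frontier \<Omega>. \<exists>U \<rho>. p \<in> U \<and> C2_defining_function \<Omega> U \<rho>)"


subsection \<open>Levi form and strong pseudoconvexity\<close>

text \<open>
  The Wirtinger derivatives \<open>\<partial>g/\<partial>z\<^sub>j = (\<partial>g/\<partial>x\<^sub>j - \<i> \<partial>g/\<partial>y\<^sub>j) / 2\<close> and its conjugate
  counterpart, where \<open>z\<^sub>j = x\<^sub>j + \<i> y\<^sub>j\<close>; the real coordinate directions of \<open>x\<^sub>j\<close> and \<open>y\<^sub>j\<close> are
  \<open>axis j 1\<close> and \<open>axis j \<i>\<close>.
\<close>
definition wirtinger :: "'n \<Rightarrow> (complex ^ 'n \<Rightarrow> complex) \<Rightarrow> complex ^ 'n \<Rightarrow> complex" where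
  "wirtinger j g z =
     (frechet_derivative g (at z) (axis j 1) - \<i> * frechet_derivative g (at z) (axis j \<i>)) / 2"

definition wirtinger_bar :: "'n \<Rightarrow> (complex ^ 'n \<Rightarrow> complex) \<Rightarrow> complex ^ 'n \<Rightarrow> complex" where
  "wirtinger_bar j g z =
     (frechet_derivative g (at z) (axis j 1) + \<i> * frechet_derivative g (at z) (axis j \<i>)) / 2"

text \<open>
  The sum is real for twice continuously differentiable \<open>\<rho>\<close>, because its coefficient
  matrix is then Hermitian; \<open>Re\<close> only changes the type.
\<close>
definition levi_form :: "(complex ^ 'n \<Rightarrow> real) \<Rightarrow> complex ^ 'n \<Rightarrow> complex ^ 'n \<Rightarrow> real" where
  "levi_form \<rho> p v =
     Re (\<Sum>j\<in>UNIV. \<Sum>k\<in>UNIV.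
           wirtinger j (wirtinger_bar k (\<lambda>z. of_real (\<rho> z))) p * (v $ j) * cnj (v $ k))"

definition complex_tangent_space :: "(complex ^ 'n \<Rightarrow> real) \<Rightarrow> complex ^ 'n \<Rightarrow> (complex ^ 'n) set" where
  "complex_tangent_space \<rho> p =
     {v. (\<Sum>j\<in>UNIV. wirtinger j (\<lambda>z. of_real (\<rho> z)) p * (v $ j)) = 0}"

text \<open>
  Positive definiteness does not depend on the choice of the local defining function, so
  ``some'' and ``every'' defining function at \<open>p\<close> give the same notion.
\<close>
definition strongly_pseudoconvex :: "(complex ^ 'n) set \<Rightarrow> bool" where
  "strongly_pseudoconvex \<Omega> \<longleftrightarrow>
     (\<forall>p \<in> frontier \<Omega>. \<exists>U \<rho>. p \<in> U \<and> C2_defining_function \<Omega> U \<rho> \<and>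
        (\<forall>v \<in> complex_tangent_space \<rho> p. v \<noteq> 0 \<longrightarrow> levi_form \<rho> p v > 0))"

end

theory Submission
  imports Defs "HOL-Real_Asymp.Real_Asymp"
begin

text \<open>
  Write points of \<open>\<complex>\<^sup>n\<close> as \<open>(w, z)\<close> with \<open>w \<in> \<complex>\<close> and consider \<open>\<Omega> = {|w|\<^sup>2 + \<Theta>(|z|\<^sup>2) < 4}\<close>, where \<open>\<Theta>\<close> is
  convex, \<open>\<Theta>(s) = s\<close> for \<open>s \<ge> 1\<close>, and \<open>\<Theta>'(s) = 1 / (1 + ln\<^sup>2 s)\<close> for \<open>0 < s \<le> 1\<close>. The slope \<open>\<Theta>'\<close> vanishes
  at 0, so \<open>\<Omega>\<close> is not strongly pseudoconvex along \<open>z = 0\<close>, but it varies so slowly that at every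
  scale \<open>\<Omega>\<close> looks like an ellipsoid there. Near a boundary point with \<open>|z|\<close> small, or with \<open>|z| > 1\<close>,
  the ellipsoid obtained from a tangent of \<open>\<Theta>\<close> contains \<open>\<Omega>\<close> and agrees with it to leading order,
  and an automorphism of the ball does the rest.

  Over a boundary point \<open>(b, a)\<close> with \<open>|a|\<close> in a compact part of \<open>(0, \<infinity>)\<close>, put \<open>h = z - a\<close>, \<open>g = \<langle>h, a\<rangle>\<close> and
  \<open>W = 1 - (w/b) exp (m g)\<close> for suitable \<open>m\<close>. Then \<open>\<Omega>\<close> becomes \<open>2 Re W > |W|\<^sup>2 + V(h)\<close>, where \<open>V(h) \<ge> c |h|\<^sup>2\<close>
  globally and \<open>V(h) = m |h|\<^sup>2 + \<gamma> |g|\<^sup>2 + \<gamma> Re (g\<^sup>2) + o(|h|\<^sup>2)\<close>. The shear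
  \<open>(W, h) \<mapsto> (W - \<gamma> (\<sigma> g)\<^sup>2 / 2, \<sigma> h)\<close> with \<open>\<sigma> = (1 + W/r)\<^bsup>-\<mu>/2\<^esup>\<close> is injective, removes the term \<open>Re (g\<^sup>2)\<close>
  near the boundary point, where \<open>\<sigma> \<approx> 1\<close>, and is harmless far away, where \<open>\<sigma>\<close> is small. It maps
  \<open>\<Omega>\<close> into a Siegel domain, biholomorphic to the ball, that is osculated by the image.
\<close>

section \<open>The Hermitian inner product\<close>

text \<open>The slope must vanish at 0 without a power law: for \<Theta>' = s^\<alpha> with \<alpha>
  > 0, rescaling towards z = 0 reproduces an egg-shaped domain instead of a ball. With ln^2 one has
  s \<Theta>''(s) / \<Theta>'(s) --> 0, so \<Theta>' is asymptotically constant on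
  [\<mu> s, \<Lambda> s]. It follows that s \<Theta>''(s) --> 0, which makes \<Theta>(|z|^2) of
  class C^2 at z = 0 although \<Theta>'' blows up; and as ln^2 has a double zero at 1, the slope
  joins the constant 1 with continuous derivative.

  The obstacle sits at a fixed distance from z = 0: where \<Theta>'' > 0, it contributes a multiple
  of (Re g)^2, of the same order as |h|^2, and no tangent ellipsoid osculates. As 2 (Re g)^2 = |g|^2
  + Re (g^2), the Hermitian half is absorbed by a linear map and the pluriharmonic half by a
  quadratic shear. Undamped, that shear cannot be controlled away from the boundary point, where
  only V \<ge> c |h|^2 is known and c may be far smaller than \<gamma> |a|^2. Hence the factor
  \<sigma>.\<close>

definition hin :: "complex ^ 'n \<Rightarrow> complex ^ 'n \<Rightarrow> complex" where
  "hin x y = (\<Sum>i\<in>UNIV. x $ i * cnj (y $ i))"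

lemma hin_add_left: "hin (x + y) z = hin x z + hin y z"
  by (simp add: hin_def algebra_simps sum.distrib)

lemma hin_diff_left: "hin (x - y) z = hin x z - hin y z"
  by (simp add: hin_def algebra_simps sum_subtractf)

lemma hin_diff_right: "hin x (y - z) = hin x y - hin x z"
  by (simp add: hin_def algebra_simps sum_subtractf)

lemma hin_scale_left [simp]: "hin (c *s x) y = c * hin x y"
  by (simp add: hin_def sum_distrib_left mult_ac)

lemma hin_scale_right [simp]: "hin x (c *s y) = cnj c * hin x y"
  by (simp add: hin_def sum_distrib_left mult_ac)

lemma hin_zero_left [simp]: "hin 0 x = 0" and hin_zero_right [simp]: "hin x 0 = 0"
  by (simp_all add: hin_def)

lemma hin_sym: "hin x y = cnj (hin y x)"
  by (simp add: hin_def mult.commute)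

lemma Re_hin: "Re (hin x y) = x \<bullet> y"
  by (simp add: hin_def inner_vec_def inner_complex_def)

lemma hin_self: "hin x x = complex_of_real ((norm x)\<^sup>2)"
proof (rule complex_eqI)
  show "Re (hin x x) = Re (complex_of_real ((norm x)\<^sup>2))"
    by (simp add: Re_hin dot_square_norm)
  show "Im (hin x x) = Im (complex_of_real ((norm x)\<^sup>2))"
    by (simp add: hin_def)
qed

lemma norm_cscale [simp]: "norm (c *s x :: complex ^ 'n) = cmod c * norm x"
proof -
  have "complex_of_real ((norm (c *s x))\<^sup>2) = c * cnj c * hin x x"
    unfolding hin_self[symmetric] by simp
  also have "\<dots> = complex_of_real ((cmod c * norm x)\<^sup>2)"
    by (simp add: hin_self complex_norm_square[symmetric] power_mult_distrib)
  finally have "(norm (c *s x))\<^sup>2 = (cmod c * norm x)\<^sup>2"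
    using of_real_eq_iff by blast
  then show ?thesis
    by (simp add: power2_eq_iff_nonneg)
qed

text \<open>A unimodular factor turns \<open>hin x y\<close> into its modulus, which is then a real
  inner product, so the real Cauchy-Schwarz inequality applies.\<close>

lemma norm_hin_le: "cmod (hin x y) \<le> norm x * norm y"
proof (cases "hin x y = 0")
  case False
  define c where "c = cnj (hin x y) / cmod (hin x y)"
  have nc: "cmod c = 1"
    using False by (simp add: c_def norm_divide)
  have "c * hin x y = complex_of_real (cmod (hin x y))"
    using False complex_norm_square[of "hin x y"] by (simp add: c_def power2_eq_square field_simps)
  then have "cmod (hin x y) = Re (hin (c *s x) y)"
    by simp
  also have "\<dots> \<le> norm (c *s x) * norm y"
    unfolding Re_hin by (rule norm_cauchy_schwarz)
  finally show ?thesis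
    using nc by simp
qed simp

lemma norm_add_square: "(norm (x + y))\<^sup>2 = (norm x)\<^sup>2 + 2 * Re (hin x y) + (norm y)\<^sup>2"
  for x y :: "complex ^ 'n"
  by (simp add: Re_hin power2_norm_eq_inner inner_add_left inner_add_right inner_commute)

lemma norm_diff_square: "(norm (x - y))\<^sup>2 = (norm x)\<^sup>2 - 2 * Re (hin x y) + (norm y)\<^sup>2"
  for x y :: "complex ^ 'n"
  by (simp add: Re_hin power2_norm_eq_inner inner_diff_left inner_diff_right inner_commute)

lemma scaleR_eq_cscale: "r *\<^sub>R x = complex_of_real r *s x" for x :: "complex ^ 'n"
  by (simp add: vec_eq_iff scaleR_conv_of_real[where 'a=complex])


section \<open>Projection along a coordinate axis\<close>

text \<open>Coordinate \<open>i\<close> plays the role of w and \<open>prj i x\<close> that of z.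
  Keeping z as a vector of the full space with entry 0 at \<open>i\<close> avoids a second index
  type for dimension n - 1.\<close>

definition prj :: "'n \<Rightarrow> complex ^ 'n \<Rightarrow> complex ^ 'n" where
  "prj i x = x - axis i (x $ i)"

lemma prj_nth: "prj i x $ j = (if j = i then 0 else x $ j)"
  by (auto simp: prj_def axis_def)

lemma prj_nth_same [simp]: "prj i x $ i = 0"
  by (simp add: prj_nth)

lemma axis_prj: "axis i (x $ i) + prj i x = x"
  by (simp add: prj_def)

lemma prj_add: "prj i (x + y) = prj i x + prj i y"
  and prj_diff: "prj i (x - y) = prj i x - prj i y"
  and prj_scaleR: "prj i (r *\<^sub>R x) = r *\<^sub>R prj i x"
  by (simp_all add: vec_eq_iff prj_nth)

lemma prj_axis [simp]: "prj i (axis i c) = 0"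
  by (auto simp add: vec_eq_iff prj_nth axis_def)

lemma prj_id: "x $ i = 0 \<Longrightarrow> prj i x = x"
  by (auto simp add: vec_eq_iff prj_nth)

lemma prj_eqI: "x $ i = y $ i \<Longrightarrow> prj i x = prj i y \<Longrightarrow> x = y"
  by (metis axis_prj)

lemma hin_axis_left: "hin (axis i c) y = c * cnj (y $ i)"
proof -
  have "hin (axis i c) y = (\<Sum>j\<in>UNIV. if j = i then c * cnj (y $ i) else 0)"
    unfolding hin_def by (rule sum.cong) (auto simp: axis_def)
  then show ?thesis by simp
qed

lemma hin_axis_right: "hin y (axis i c) = y $ i * cnj c"
  using hin_sym[of y "axis i c"] by (simp add: hin_axis_left)

lemma hin_split: "hin x y = x $ i * cnj (y $ i) + hin (prj i x) (prj i y)"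
  by (simp add: prj_def hin_diff_left hin_diff_right hin_axis_left hin_axis_right)

lemma norm_split: "(norm x)\<^sup>2 = (cmod (x $ i))\<^sup>2 + (norm (prj i x))\<^sup>2" for x :: "complex ^ 'n"
proof -
  have "complex_of_real ((norm x)\<^sup>2) = of_real ((cmod (x $ i))\<^sup>2 + (norm (prj i x))\<^sup>2)"
    using hin_split[of x x i] by (simp add: hin_self complex_mult_cnj cmod_power2 flip: of_real_power)
  then show ?thesis
    using of_real_eq_iff by blast
qed

lemma norm_prj_le: "norm (prj i x) \<le> norm x" for x :: "complex ^ 'n"
  using norm_split[of x i] by (smt (verit) norm_ge_zero power2_le_imp_le zero_le_power2)

lemma norm_axis_add:
  assumes "y $ i = 0"
  shows "(norm (axis i c + y))\<^sup>2 = (cmod c)\<^sup>2 + (norm y)\<^sup>2"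
  using norm_split[of "axis i c + y" i] assms by (simp add: prj_add prj_id)

lemma bounded_linear_prj: "bounded_linear (prj i :: complex ^ 'n \<Rightarrow> complex ^ 'n)"
  by (rule bounded_linear_intro[where K=1]) (auto simp: prj_add prj_scaleR norm_prj_le)


section \<open>Complex differentiability\<close>

definition cdiff :: "(complex ^ 'n \<Rightarrow> complex) \<Rightarrow> complex ^ 'n \<Rightarrow> bool" where
  "cdiff f z \<longleftrightarrow> (\<exists>D. (f has_derivative D) (at z) \<and> (\<forall>c v. D (c *s v) = c * D v))"

definition vdiff :: "(complex ^ 'n \<Rightarrow> complex ^ 'm) \<Rightarrow> complex ^ 'n \<Rightarrow> bool" where
  "vdiff f z \<longleftrightarrow> (\<exists>D. (f has_derivative D) (at z) \<and> (\<forall>c v. D (c *s v) = c *s D v))"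

lemma holomorphic_map_on_iff: "holomorphic_map_on f S \<longleftrightarrow> (\<forall>z\<in>S. vdiff f z)"
  by (simp add: holomorphic_map_on_def vdiff_def)

lemma cdiff_const [intro]: "cdiff (\<lambda>_. c) z"
  unfolding cdiff_def by (rule exI[of _ "\<lambda>_. 0"]) auto

lemma cdiff_if: "cdiff f z \<Longrightarrow> cdiff g z \<Longrightarrow> cdiff (\<lambda>x. if P then f x else g x) z"
  by (cases P) auto

lemma cdiff_nth [intro]: "cdiff (\<lambda>x. x $ i) z"
  unfolding cdiff_def
  by (rule exI[of _ "\<lambda>x. x $ i"]) (auto intro: bounded_linear_imp_has_derivative bounded_linear_vec_nth)

lemma cdiff_add [intro]: "cdiff f z \<Longrightarrow> cdiff g z \<Longrightarrow> cdiff (\<lambda>x. f x + g x) z"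
  unfolding cdiff_def
proof (elim exE conjE)
  fix D E assume *: "(f has_derivative D) (at z)" "(g has_derivative E) (at z)"
    "\<forall>c v. D (c *s v) = c * D v" "\<forall>c v. E (c *s v) = c * E v"
  show "\<exists>D. ((\<lambda>x. f x + g x) has_derivative D) (at z) \<and> (\<forall>c v. D (c *s v) = c * D v)"
    by (rule exI[of _ "\<lambda>v. D v + E v"]) (use * in \<open>auto intro: has_derivative_add simp: algebra_simps\<close>)
qed

lemma cdiff_mult [intro]: "cdiff f z \<Longrightarrow> cdiff g z \<Longrightarrow> cdiff (\<lambda>x. f x * g x) z"
  unfolding cdiff_def
proof (elim exE conjE)
  fix D E assume *: "(f has_derivative D) (at z)" "(g has_derivative E) (at z)"
    "\<forall>c v. D (c *s v) = c * D v" "\<forall>c v. E (c *s v) = c * E v"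
  show "\<exists>D. ((\<lambda>x. f x * g x) has_derivative D) (at z) \<and> (\<forall>c v. D (c *s v) = c * D v)"
    using * has_derivative_mult[OF *(1,2)]
    by (intro exI[of _ "\<lambda>v. f z * E v + D v * g z"]) (auto simp: algebra_simps)
qed

lemma cdiff_compose:
  assumes "cdiff f z" "(h has_field_derivative h') (at (f z))"
  shows "cdiff (\<lambda>x. h (f x)) z"
proof -
  from assms(1) obtain D where D: "(f has_derivative D) (at z)" "\<forall>c v. D (c *s v) = c * D v"
    unfolding cdiff_def by blast
  have "((\<lambda>x. h (f x)) has_derivative (\<lambda>v. h' * D v)) (at z)"
    using has_derivative_compose[OF D(1), of h "\<lambda>v. h' * v"] assms(2)
    by (simp add: has_field_derivative_def)
  then show ?thesis
    unfolding cdiff_def using D(2) by (intro exI[of _ "\<lambda>v. h' * D v"]) (auto simp: algebra_simps)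
qed

lemma cdiff_uminus [intro]: "cdiff f z \<Longrightarrow> cdiff (\<lambda>x. - f x) z"
  using cdiff_mult[OF cdiff_const[of "-1"], of f z] by simp

lemma cdiff_diff [intro]: "cdiff f z \<Longrightarrow> cdiff g z \<Longrightarrow> cdiff (\<lambda>x. f x - g x) z"
  using cdiff_add[OF _ cdiff_uminus, of f z g] by simp

lemma cdiff_divide [intro]: "cdiff f z \<Longrightarrow> cdiff g z \<Longrightarrow> g z \<noteq> 0 \<Longrightarrow> cdiff (\<lambda>x. f x / g x) z"
  unfolding divide_inverse
  by (intro cdiff_mult cdiff_compose[of g z inverse]) (auto intro: DERIV_inverse)

lemma cdiff_exp [intro]: "cdiff f z \<Longrightarrow> cdiff (\<lambda>x. exp (f x)) z"
  by (rule cdiff_compose) (auto intro: DERIV_exp)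

lemma cdiff_power2 [intro]: "cdiff f z \<Longrightarrow> cdiff (\<lambda>x. (f x)\<^sup>2) z"
  unfolding power2_eq_square by auto

lemma cdiff_powr [intro]:
  assumes "cdiff f z" "f z \<notin> \<real>\<^sub>\<le>\<^sub>0"
  shows "cdiff (\<lambda>x. f x powr s) z"
  by (rule cdiff_compose[OF assms(1) has_field_derivative_powr[OF assms(2)]])

lemma vdiff_iff_cdiff: "vdiff f z \<longleftrightarrow> (\<forall>i. cdiff (\<lambda>x. f x $ i) z)"
proof
  assume "vdiff f z"
  then obtain D where D: "(f has_derivative D) (at z)" "\<forall>c v. D (c *s v) = c *s D v"
    unfolding vdiff_def by blast
  show "\<forall>i. cdiff (\<lambda>x. f x $ i) z"
    unfolding cdiff_def
  proof
    fix i
    show "\<exists>D. ((\<lambda>x. f x $ i) has_derivative D) (at z) \<and> (\<forall>c v. D (c *s v) = c * D v)"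
      using bounded_linear.has_derivative[OF bounded_linear_vec_nth D(1), of i] D(2)
      by (intro exI[of _ "\<lambda>v. D v $ i"]) auto
  qed
next
  assume "\<forall>i. cdiff (\<lambda>x. f x $ i) z"
  then have "\<exists>D. \<forall>i. ((\<lambda>x. f x $ i) has_derivative D i) (at z) \<and> (\<forall>c v. D i (c *s v) = c * D i v)"
    unfolding cdiff_def by (intro choice) auto
  then obtain D where D: "\<And>i. ((\<lambda>x. f x $ i) has_derivative D i) (at z)"
    "\<And>i c v. D i (c *s v) = c * D i v" by blast
  have "((\<lambda>x. \<chi> i. f x $ i) has_derivative (\<lambda>v. \<chi> i. D i v)) (at z)"
    by (subst has_derivative_componentwise_within)
      (auto simp: Basis_vec_def inner_axis intro: bounded_linear.has_derivative[OF bounded_linear_inner_left] D(1))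
  then show "vdiff f z"
    unfolding vdiff_def using D(2)
    by (intro exI[of _ "\<lambda>v. \<chi> i. D i v"]) (auto simp: vec_eq_iff)
qed

lemma vdiff_id [intro]: "vdiff (\<lambda>x. x) z"
  and vdiff_const [intro]: "vdiff (\<lambda>x. c) z"
  by (auto simp: vdiff_iff_cdiff)

lemma vdiff_add [intro]: "vdiff f z \<Longrightarrow> vdiff g z \<Longrightarrow> vdiff (\<lambda>x. f x + g x) z"
  and vdiff_diff [intro]: "vdiff f z \<Longrightarrow> vdiff g z \<Longrightarrow> vdiff (\<lambda>x. f x - g x) z"
  and vdiff_cscale [intro]: "cdiff k z \<Longrightarrow> vdiff f z \<Longrightarrow> vdiff (\<lambda>x. k x *s f x) z"
  by (auto simp: vdiff_iff_cdiff)

lemma vdiff_prj [intro]: "vdiff f z \<Longrightarrow> vdiff (\<lambda>x. prj i (f x)) z"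
  by (auto simp: vdiff_iff_cdiff prj_nth intro: cdiff_if)

lemma vdiff_axis [intro]: "cdiff k z \<Longrightarrow> vdiff (\<lambda>x. axis i (k x)) z"
  by (auto simp: vdiff_iff_cdiff axis_def intro: cdiff_if)

lemma cdiff_hin [intro]:
  assumes "vdiff f z"
  shows "cdiff (\<lambda>x. hin (f x) a) z"
proof -
  from assms obtain D where D: "(f has_derivative D) (at z)" "\<forall>c v. D (c *s v) = c *s D v"
    unfolding vdiff_def by blast
  have "bounded_linear (\<lambda>x. hin x a)"
    by (rule bounded_linear_intro[where K="norm a"])
      (auto simp: hin_add_left scaleR_eq_cscale norm_hin_le scaleR_conv_of_real)
  from bounded_linear.has_derivative[OF this D(1)] show ?thesis
    unfolding cdiff_def using D(2) by (intro exI[of _ "\<lambda>v. hin (D v) a"]) auto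
qed

lemma vdiff_compose:
  assumes "vdiff f z" "vdiff g (f z)"
  shows "vdiff (\<lambda>x. g (f x)) z"
proof -
  from assms obtain D E where "(f has_derivative D) (at z)" "\<forall>c v. D (c *s v) = c *s D v"
    "(g has_derivative E) (at (f z))" "\<forall>c v. E (c *s v) = c *s E v"
    unfolding vdiff_def by blast
  then show ?thesis
    unfolding vdiff_def using has_derivative_compose[of f D z UNIV g E]
    by (intro exI[of _ "\<lambda>v. E (D v)"]) auto
qed


section \<open>Automorphisms of the ball\<close>

text \<open>The involutive automorphism exchanging 0 and \<open>a\<close>. The usual numerator a -
  Px - s (x - Px), with P the orthogonal projection onto the line of \<open>a\<close>, takes this
  form because (1 - s) / |a|^2 = 1 / (1 + s); so a = 0 is not exceptional.\<close>

definition ball_aut :: "complex ^ 'n \<Rightarrow> complex ^ 'n \<Rightarrow> complex ^ 'n" where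
  "ball_aut a x = (let s = sqrt (1 - (norm a)\<^sup>2) in
     (1 / (1 - hin x a)) *s (a - complex_of_real s *s x - (hin x a / (1 + complex_of_real s)) *s a))"

lemma hin_ne_1:
  assumes "norm a < 1" "norm x < 1"
  shows "hin x a \<noteq> 1"
proof -
  have "cmod (hin x a) < 1"
    using norm_hin_le[of x a] assms
    by (meson mult_le_one norm_ge_zero less_imp_le mult_less_cancel_left2 not_le order_le_less_trans mult_left_le_one_le)
  then show ?thesis by auto
qed

lemma norm_ball_aut:
  assumes "norm a < 1" "norm x < 1"
  shows "1 - (norm (ball_aut a x))\<^sup>2 = (1 - (norm a)\<^sup>2) * (1 - (norm x)\<^sup>2) / (cmod (1 - hin x a))\<^sup>2"
proof -
  define s where "s = sqrt (1 - (norm a)\<^sup>2)"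
  define \<alpha> where "\<alpha> = hin x a"
  have a2: "(norm a)\<^sup>2 < 1" using assms by (simp add: power_less_one_iff abs_square_less_1)
  have s2: "s\<^sup>2 = 1 - (norm a)\<^sup>2" and s0: "s \<ge> 0" unfolding s_def using a2 by auto
  have \<alpha>: "\<alpha> \<noteq> 1" unfolding \<alpha>_def by (rule hin_ne_1[OF assms])
  define u where "u = 1 - \<alpha> / (1 + complex_of_real s)"
  define c where "c = 1 / (1 + s)"
  have c: "c * (1 + s) = 1" unfolding c_def using s0 by simp
  have u: "u = 1 - of_real c * \<alpha>" unfolding u_def c_def by simp
  define N where "N = u *s a - complex_of_real s *s x"
  have "(norm N)\<^sup>2 = (cmod u)\<^sup>2 * (norm a)\<^sup>2 - 2 * Re (u * (of_real s * hin a x)) + s\<^sup>2 * (norm x)\<^sup>2"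
    unfolding N_def norm_diff_square by (simp add: power_mult_distrib mult_ac)
  also have "hin a x = cnj \<alpha>" unfolding \<alpha>_def by (rule hin_sym)
  finally have "(norm N)\<^sup>2 = (cmod u)\<^sup>2 * (norm a)\<^sup>2 - 2 * Re (u * (of_real s * cnj \<alpha>)) + s\<^sup>2 * (norm x)\<^sup>2" .
  then have N: "(norm N)\<^sup>2 = ((1 - c * Re \<alpha>)\<^sup>2 + (c * Im \<alpha>)\<^sup>2) * (1 - s\<^sup>2)
      - 2 * s * (Re \<alpha> - c * ((Re \<alpha>)\<^sup>2 + (Im \<alpha>)\<^sup>2)) + s\<^sup>2 * (norm x)\<^sup>2"
    unfolding u cmod_power2 s2 by (simp add: algebra_simps power2_eq_square)
  have D: "(cmod (1 - \<alpha>))\<^sup>2 = (1 - Re \<alpha>)\<^sup>2 + (Im \<alpha>)\<^sup>2"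
    by (simp add: cmod_power2)
  \<comment> \<open>The claim has become a polynomial identity modulo c (1 + s) = 1, in which |x|^2
    is a free variable \<open>k\<close>.\<close>
  have "(1 - Re \<alpha>)\<^sup>2 + (Im \<alpha>)\<^sup>2 - (((1 - c * Re \<alpha>)\<^sup>2 + (c * Im \<alpha>)\<^sup>2) * (1 - s\<^sup>2)
      - 2 * s * (Re \<alpha> - c * ((Re \<alpha>)\<^sup>2 + (Im \<alpha>)\<^sup>2)) + s\<^sup>2 * k) = s\<^sup>2 * (1 - k)" for k
    using c by algebra
  then have key: "(cmod (1 - \<alpha>))\<^sup>2 - (norm N)\<^sup>2 = s\<^sup>2 * (1 - (norm x)\<^sup>2)"
    unfolding N D by blast
  have "ball_aut a x = (1 / (1 - \<alpha>)) *s N"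
    unfolding ball_aut_def Let_def s_def[symmetric] \<alpha>_def[symmetric] N_def u_def
    by (simp add: vec_eq_iff algebra_simps)
  then have "(norm (ball_aut a x))\<^sup>2 = (norm N)\<^sup>2 / (cmod (1 - \<alpha>))\<^sup>2"
    by (simp add: norm_divide power_divide)
  then have "1 - (norm (ball_aut a x))\<^sup>2 = ((cmod (1 - \<alpha>))\<^sup>2 - (norm N)\<^sup>2) / (cmod (1 - \<alpha>))\<^sup>2"
    using \<alpha> by (simp add: field_simps)
  then show ?thesis
    unfolding key[unfolded s2 \<alpha>_def] \<alpha>_def .
qed

lemma ball_aut_in_ball:
  assumes "norm a < 1" "norm x < 1"
  shows "norm (ball_aut a x) < 1"
proof -
  have "(norm a)\<^sup>2 < 1" "(norm x)\<^sup>2 < 1" 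
    using assms by (simp_all add: power_less_one_iff abs_square_less_1)
  moreover have "cmod (1 - hin x a) > 0"
    using hin_ne_1[OF assms] by simp
  ultimately have "1 - (norm (ball_aut a x))\<^sup>2 > 0"
    unfolding norm_ball_aut[OF assms] by simp
  then show ?thesis by (simp add: abs_square_less_1)
qed

lemma ball_aut_involution:
  assumes "norm a < 1" "norm x < 1"
  shows "ball_aut a (ball_aut a x) = x"
proof -
  define s where "s = sqrt (1 - (norm a)\<^sup>2)"
  define \<alpha> where "\<alpha> = hin x a"
  define N where "N = (norm a)\<^sup>2"
  have a2: "N < 1" unfolding N_def using assms by (simp add: power_less_one_iff abs_square_less_1)
  have s2: "N = 1 - s\<^sup>2" and s0: "s > 0" unfolding s_def N_def[symmetric] using a2 by auto
  have \<alpha>: "\<alpha> \<noteq> 1" unfolding \<alpha>_def by (rule hin_ne_1[OF assms])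
  define S where "S = complex_of_real s"
  have S: "S \<noteq> 0" "1 + S \<noteq> 0" unfolding S_def using s0 by (auto simp: complex_eq_iff)
  define c where "c = 1 / (1 + S)"
  have c: "c * (1 + S) = 1" unfolding c_def using S by simp
  define y where "y = ball_aut a x"
  have y: "y = (1 / (1 - \<alpha>)) *s (a - S *s x - (c * \<alpha>) *s a)"
    unfolding y_def ball_aut_def Let_def s_def[symmetric] \<alpha>_def[symmetric] c_def S_def
    by simp
  have haa: "hin a a = 1 - S\<^sup>2"
    unfolding hin_self N_def[symmetric] s2 S_def by simp
  have "hin y a = (1 / (1 - \<alpha>)) * ((1 - S\<^sup>2) - S * \<alpha> - c * \<alpha> * (1 - S\<^sup>2))"
    unfolding y by (simp add: hin_diff_left haa \<alpha>_def[symmetric] diff_divide_distrib)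
  also have "(1 - S\<^sup>2) - S * \<alpha> - c * \<alpha> * (1 - S\<^sup>2) = (1 - S\<^sup>2) - \<alpha>"
    using c by algebra
  finally have hy: "hin y a = ((1 - S\<^sup>2) - \<alpha>) / (1 - \<alpha>)" by simp
  have 1: "1 - hin y a = S\<^sup>2 / (1 - \<alpha>)"
    unfolding hy using \<alpha> by (simp add: field_simps)
  have y': "y $ i = (a $ i - S * x $ i - c * \<alpha> * a $ i) / (1 - \<alpha>)" for i
    unfolding y by (simp add: diff_divide_distrib)
  \<comment> \<open>Collects the numerator of the double image so that the defect carries the factor
    1 - d (1 + S), which vanishes for d = \<open>c\<close>.\<close>
  have alg: "p * (1 - t) - S * (p - S * q - d * t * p) - d * ((1 - S\<^sup>2) - t) * p
      = S\<^sup>2 * q + p * (1 - S - t) * (1 - d * (1 + S))" for p q t d :: complex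
    by (simp add: algebra_simps power2_eq_square)
  have bay: "ball_aut a y = (1 / (1 - hin y a)) *s (a - S *s y - (c * hin y a) *s a)"
    unfolding ball_aut_def Let_def s_def[symmetric] c_def S_def by simp
  have "ball_aut a y $ i = x $ i" for i
  proof -
    have "ball_aut a y $ i = (1 - \<alpha>) / S\<^sup>2 * (a $ i - S * y $ i - c * hin y a * a $ i)"
      unfolding bay 1 by (simp add: algebra_simps diff_divide_distrib add_divide_distrib)
    also have "\<dots> = ((1 - \<alpha>) * (a $ i - S * y $ i - c * hin y a * a $ i)) / S\<^sup>2"
      by simp
    also have "(1 - \<alpha>) * (a $ i - S * y $ i - c * hin y a * a $ i)
        = a $ i * (1 - \<alpha>) - S * ((1 - \<alpha>) * y $ i) - c * ((1 - \<alpha>) * hin y a) * a $ i"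
      by (simp add: algebra_simps)
    also have "(1 - \<alpha>) * y $ i = a $ i - S * x $ i - c * \<alpha> * a $ i"
      unfolding y' using \<alpha> by simp
    also have "(1 - \<alpha>) * hin y a = (1 - S\<^sup>2) - \<alpha>"
      unfolding hy using \<alpha> by simp
    also have "(a $ i * (1 - \<alpha>) - S * (a $ i - S * x $ i - c * \<alpha> * a $ i) - c * ((1 - S\<^sup>2) - \<alpha>) * a $ i) / S\<^sup>2
        = (S\<^sup>2 * x $ i + a $ i * (1 - S - \<alpha>) * (1 - c * (1 + S))) / S\<^sup>2"
      by (rule arg_cong[where f="\<lambda>t. t / S\<^sup>2"]) (rule alg)
    also have "\<dots> = x $ i"
      using S(1) c by simp
    finally show ?thesis .
  qed
  then show ?thesis unfolding y_def by (simp add: vec_eq_iff)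
qed

lemma ball_aut_self:
  assumes "norm a < 1"
  shows "ball_aut a a = 0"
proof -
  define s where "s = sqrt (1 - (norm a)\<^sup>2)"
  have a2: "(norm a)\<^sup>2 < 1" using assms by (simp add: power_less_one_iff abs_square_less_1)
  have s2: "s\<^sup>2 = 1 - (norm a)\<^sup>2" and s0: "s \<ge> 0" unfolding s_def using a2 by auto
  have "hin a a = (1 - of_real s) * (1 + of_real s)"
  proof -
    have "complex_of_real ((norm a)\<^sup>2) = of_real ((1 - s) * (1 + s))"
      by (rule arg_cong[where f=of_real]) (use s2 in \<open>simp add: algebra_simps power2_eq_square\<close>)
    then show ?thesis by (simp add: hin_self)
  qed
  moreover have "1 + complex_of_real s \<noteq> 0" using s0 by (auto simp: complex_eq_iff)
  ultimately have k: "hin a a / (1 + of_real s) = 1 - of_real s"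
    by simp
  have 0: "a - complex_of_real s *s a - (1 - of_real s) *s a = 0"
    by (simp add: vec_eq_iff algebra_simps)
  then show ?thesis
    unfolding ball_aut_def Let_def s_def[symmetric] k 0 by simp
qed

lemma vdiff_ball_aut:
  assumes "vdiff f z" "norm a < 1" "norm (f z) < 1"
  shows "vdiff (\<lambda>x. ball_aut a (f x)) z"
proof -
  have "(norm a)\<^sup>2 < 1"
    using assms(2) by (simp add: abs_square_less_1)
  then have "1 + complex_of_real (sqrt (1 - (norm a)\<^sup>2)) \<noteq> 0"
    by (smt (verit) Re_complex_of_real one_complex.sel(1) plus_complex.sel(1) real_sqrt_gt_zero zero_complex.sel(1))
  then show ?thesis
    unfolding ball_aut_def Let_def
    using assms hin_ne_1[OF assms(2,3)] by (intro vdiff_cscale vdiff_diff cdiff_divide cdiff_diff cdiff_hin) auto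
qed


section \<open>Bounds for the squeezing function\<close>

text \<open>By invariance of domain the image is open, so it contains a ball about 0 and the set of
  admissible radii is nonempty; it is bounded by 1 because the image lies in the unit ball.\<close>

lemma squeezing_of_bounds:
  assumes "open \<Omega>" "z \<in> \<Omega>" "ball_embedding \<Omega> f" "f z = 0"
  shows squeezing_of_le_1: "squeezing_of \<Omega> f \<le> 1"
    and squeezing_of_ge: "\<And>r. r > 0 \<Longrightarrow> ball 0 r \<subseteq> f ` \<Omega> \<Longrightarrow> r \<le> squeezing_of \<Omega> f"
proof -
  let ?R = "{r. r > 0 \<and> ball 0 r \<subseteq> f ` \<Omega>}"
  have le1: "r \<le> 1" if "r \<in> ?R" for r
  proof -
    have "ball 0 r \<subseteq> ball (0::complex^'a) 1"
      using that assms(3) unfolding ball_embedding_def by blast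
    then show ?thesis
      using that by (simp add: ball_subset_ball_iff)
  qed
  have "f differentiable_on \<Omega>"
    using assms(3) unfolding ball_embedding_def holomorphic_map_on_def
    by (meson differentiable_at_withinI differentiable_def differentiable_on_def)
  then have "open (f ` \<Omega>)"
    using assms(1,3) invariance_of_domain differentiable_imp_continuous_on
    unfolding ball_embedding_def by blast
  moreover have "0 \<in> f ` \<Omega>"
    using assms(2,4) by force
  ultimately have "?R \<noteq> {}"
    using open_contains_ball by blast
  then show "squeezing_of \<Omega> f \<le> 1"
    unfolding squeezing_of_def by (rule cSup_least) (rule le1)
  show "r \<le> squeezing_of \<Omega> f" if "r > 0" "ball 0 r \<subseteq> f ` \<Omega>" for r
    unfolding squeezing_of_def using that le1 by (intro cSup_upper) (auto simp: bdd_above_def)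
qed

lemma squeezing_function_bounds:
  assumes "open \<Omega>" "z \<in> \<Omega>" "ball_embedding \<Omega> f" "f z = 0" "r > 0" "ball 0 r \<subseteq> f ` \<Omega>"
  shows "r \<le> squeezing_function \<Omega> z" "squeezing_function \<Omega> z \<le> 1"
proof -
  let ?F = "{f. ball_embedding \<Omega> f \<and> f z = 0}"
  have le1: "squeezing_of \<Omega> g \<le> 1" if "g \<in> ?F" for g
    using that squeezing_of_le_1[OF assms(1,2)] by blast
  have "f \<in> ?F"
    using assms by simp
  then show "squeezing_function \<Omega> z \<le> 1"
    unfolding squeezing_function_def using le1 by (intro cSUP_least) auto
  have "r \<le> squeezing_of \<Omega> f"
    using squeezing_of_ge[OF assms(1-4)] assms(5,6) by blast
  also have "\<dots> \<le> squeezing_function \<Omega> z"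
    unfolding squeezing_function_def using \<open>f \<in> ?F\<close> le1
    by (intro cSUP_upper) (auto simp: bdd_above_def)
  finally show "r \<le> squeezing_function \<Omega> z" .
qed


section \<open>The profile function\<close>

definition kap :: "real \<Rightarrow> real" where
  "kap s = (if s \<le> 0 then 0 else if s \<le> 1 then 1 / (1 + (ln s)\<^sup>2) else 1)"

definition kap' :: "real \<Rightarrow> real" where
  "kap' s = (if s \<le> 0 then 0 else if s \<le> 1 then - 2 * ln s / (s * (1 + (ln s)\<^sup>2)\<^sup>2) else 0)"

lemma one_plus_ln_pos: "1 + (ln s)\<^sup>2 > (0::real)"
  by (smt (verit) zero_le_power2)

lemma kap_nonneg: "kap s \<ge> 0" and kap_le_1: "kap s \<le> 1"
  using one_plus_ln_pos[of s] by (auto simp: kap_def)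

lemma kap_pos: "s > 0 \<Longrightarrow> kap s > 0"
  using one_plus_ln_pos[of s] by (auto simp: kap_def)

lemma kap_eq_1: "s \<ge> 1 \<Longrightarrow> kap s = 1"
  by (cases "s = 1") (auto simp: kap_def)

lemma kap'_nonneg: "kap' s \<ge> 0"
  using one_plus_ln_pos[of s]
  by (auto simp: kap'_def ln_le_zero_iff intro!: divide_nonpos_pos mult_nonneg_nonpos)

lemma has_derivative_kap:
  assumes "s > 0"
  shows "(kap has_real_derivative kap' s) (at s)"
proof -
  let ?f = "\<lambda>s::real. 1 / (1 + (ln s)\<^sup>2)" and ?f' = "\<lambda>s::real. - 2 * ln s / (s * (1 + (ln s)\<^sup>2)\<^sup>2)"
  have f: "(?f has_real_derivative ?f' s) (at s within A)" if "s > 0" for s A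
    using that one_plus_ln_pos[of s]
    by (auto intro!: derivative_eq_intros simp: field_simps power2_eq_square)
  show ?thesis
  proof -
    \<comment> \<open>The two formulas are glued as derivatives on closed half-lines; at the common
      point 1 both give 0 because ln 1 = 0.\<close>
    have "((\<lambda>s. if s \<in> {..1} then ?f s else 1) has_vector_derivative 
        (if s \<in> {..1} then ?f' s else 0)) (at s within ({..1} \<union> {1..}))"
    proof (rule has_vector_derivative_If_within_closures)
      show "s \<in> {..1} \<union> closure {..1} \<inter> closure {1..} \<Longrightarrow>
        (?f has_vector_derivative ?f' s) (at s within {..1} \<union> closure {..1} \<inter> closure {1..})"
        using f assms by (simp add: has_real_derivative_iff_has_vector_derivative)
      show "s \<in> {1..} \<union> closure {..1} \<inter> closure {1..} \<Longrightarrow>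
        ((\<lambda>_. 1) has_vector_derivative 0) (at s within {1..} \<union> closure {..1} \<inter> closure {1..})"
        by (auto intro: derivative_eq_intros)
    qed (auto)
    moreover have "{..1} \<union> {1::real..} = UNIV" by auto
    ultimately have "((\<lambda>s. if s \<in> {..1} then ?f s else 1) has_real_derivative 
        (if s \<in> {..1} then ?f' s else 0)) (at s)"
      by (simp add: has_real_derivative_iff_has_vector_derivative)
    moreover have "(if s \<in> {..1} then ?f' s else 0) = kap' s"
      using assms by (simp add: kap'_def)
    ultimately have "((\<lambda>s. if s \<in> {..1} then ?f s else 1) has_real_derivative kap' s) (at s)"
      by simp
    then show ?thesis
      by (rule has_field_derivative_transform_within_open[where S="{0<..}"]) (use assms in \<open>auto simp: kap_def\<close>)
  qed
qed

lemma mono_kap: "mono kap"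
proof (rule monoI)
  fix x y :: real assume xy: "x \<le> y"
  show "kap x \<le> kap y"
  proof (cases "x \<le> 0")
    case True
    then show ?thesis using kap_nonneg[of y] by (simp add: kap_def)
  next
    case False
    then show ?thesis
      using DERIV_nonneg_imp_nondecreasing[OF xy, of kap]
      by (meson has_derivative_kap kap'_nonneg less_le_trans not_le)
  qed
qed

lemma kap_tendsto_0: "(kap \<longlongrightarrow> 0) (at 0)"
proof -
  have "((\<lambda>s::real. 1 / (1 + (ln s)\<^sup>2)) \<longlongrightarrow> 0) (at_right 0)"
    by real_asymp
  then have "(kap \<longlongrightarrow> 0) (at_right 0)"
    by (rule Lim_transform_eventually)
      (auto simp: eventually_at_right_field kap_def intro!: exI[of _ 1])
  moreover have "(kap \<longlongrightarrow> 0) (at_left 0)"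
    by (rule Lim_transform_eventually[OF tendsto_const])
      (auto simp: eventually_at_left_field kap_def intro!: exI[of _ "-1"])
  ultimately show ?thesis
    by (simp add: filterlim_split_at_real)
qed

lemma continuous_kap: "continuous_on UNIV kap"
proof -
  have "isCont kap s" for s
  proof (cases s "0::real" rule: linorder_cases)
    case less
    have "eventually (\<lambda>x. kap x = 0) (nhds s)"
      using less by (auto simp: eventually_nhds kap_def intro!: exI[of _ "{..<0}"])
    then show ?thesis
      by (simp add: isCont_cong)
  next
    case equal
    then show ?thesis
      using kap_tendsto_0 by (simp add: isCont_def kap_def)
  next
    case greater
    then show ?thesis
      using has_derivative_kap DERIV_isCont by blast
  qed
  then show ?thesis
    by (simp add: continuous_at_imp_continuous_on)
qed

lemma continuous_kap': "continuous_on {0<..} kap'"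
proof -
  have "continuous_on {0<..} (\<lambda>s::real. - 2 * ln (min s 1) / (s * (1 + (ln (min s 1))\<^sup>2)\<^sup>2))"
    by (intro continuous_intros) (auto simp: less_imp_neq[OF one_plus_ln_pos, symmetric])
  then show ?thesis
    by (rule continuous_on_eq) (auto simp: kap'_def min_def)
qed

text \<open>With L = ln s, (L + 1)^2 \<ge> 0 gives -2 L \<le> 1 + L^2 \<le> (1 + L^2)^2. This yields
  a bound on \<open>kap'\<close> that is uniform away from 0.\<close>

lemma kap'_mult_le: "s > 0 \<Longrightarrow> s * kap' s \<le> 1"
proof (cases "s \<le> 1")
  case True
  assume s: "s > 0"
  let ?L = "ln s"
  have "0 \<le> (?L + 1)\<^sup>2" by simp
  then have "- 2 * ?L \<le> 1 + ?L\<^sup>2" by (simp add: power2_eq_square algebra_simps)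
  also have "\<dots> \<le> (1 + ?L\<^sup>2)\<^sup>2"
    by (rule self_le_power) auto
  finally show ?thesis
    using s True one_plus_ln_pos[of s] by (simp add: kap'_def field_simps)
qed (auto simp: kap'_def)

text \<open>Starting the integral at -1 makes 0 an interior point, where a two-sided derivative
  exists; \<open>kap\<close> vanishes on [-1, 0]. The additive constant is fixed by
  \<open>Tht 1\<close> = 1.\<close>

definition Tht :: "real \<Rightarrow> real" where
  "Tht s = 1 - integral {-1..1} kap + integral {-1..s} kap"

lemma has_derivative_Tht:
  assumes "s > -1"
  shows "(Tht has_real_derivative kap s) (at s)"
proof -
  have "((\<lambda>u. integral {-1..u} kap) has_real_derivative kap s) (at s within {-1..s+1})"
    using assms by (intro integral_has_real_derivative continuous_on_subset[OF continuous_kap]) auto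
  then have "((\<lambda>u. integral {-1..u} kap) has_real_derivative kap s) (at s)"
    using assms by (subst (asm) at_within_interior) (auto)
  then show ?thesis
    unfolding Tht_def by (auto intro!: derivative_eq_intros)
qed

lemma Tht_ge_1: "s \<ge> 1 \<Longrightarrow> Tht s = s"
proof -
  assume s: "s \<ge> 1"
  have "Tht s - s = Tht 1 - 1"
  proof (cases "s = 1")
    case False
    have "((\<lambda>s. Tht s - s) has_real_derivative 0) (at x)" if "x \<ge> 1" for x
      using that has_derivative_Tht[of x] by (auto intro!: derivative_eq_intros simp: kap_eq_1)
    then show ?thesis
      using DERIV_isconst2[of 1 s "\<lambda>s. Tht s - s" s] False s
      by (metis (no_types, lifting) DERIV_isCont DERIV_isconst_end continuous_on_eq_continuous_at
          atLeastAtMost_iff order_le_less continuous_at_imp_continuous_on greaterThanLessThan_iff)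
  qed simp
  then show ?thesis by (simp add: Tht_def)
qed

text \<open>The Bregman divergence of the convex function \<open>Tht\<close>. It is the difference
  between the defining functions of the domain and of its tangent ellipsoid, hence the error term of
  every comparison below.\<close>

definition gap :: "real \<Rightarrow> real \<Rightarrow> real" where
  "gap s\<^sub>0 s = Tht s - Tht s\<^sub>0 - kap s\<^sub>0 * (s - s\<^sub>0)"

lemma gap_mvt:
  assumes "s > -1" "s\<^sub>0 > -1"
  obtains \<xi> where "min s s\<^sub>0 \<le> \<xi>" "\<xi> \<le> max s s\<^sub>0" "gap s\<^sub>0 s = (kap \<xi> - kap s\<^sub>0) * (s - s\<^sub>0)"
proof (cases s s\<^sub>0 rule: linorder_cases)
  case less
  then obtain \<xi> where "s < \<xi>" "\<xi> < s\<^sub>0" "Tht s\<^sub>0 - Tht s = (s\<^sub>0 - s) * kap \<xi>"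
    using MVT2[of s s\<^sub>0 Tht kap] has_derivative_Tht assms by (metis less_le_trans)
  then show ?thesis
    using less by (intro that[of \<xi>]) (auto simp: gap_def algebra_simps)
next
  case equal
  then show ?thesis by (intro that[of s]) (auto simp: gap_def)
next
  case greater
  then obtain \<xi> where "s\<^sub>0 < \<xi>" "\<xi> < s" "Tht s - Tht s\<^sub>0 = (s - s\<^sub>0) * kap \<xi>"
    using MVT2[of s\<^sub>0 s Tht kap] has_derivative_Tht assms by (metis less_le_trans)
  then show ?thesis
    using greater by (intro that[of \<xi>]) (auto simp: gap_def algebra_simps)
qed

lemma gap_nonneg:
  assumes "s > -1" "s\<^sub>0 > -1"
  shows "gap s\<^sub>0 s \<ge> 0"
proof -
  obtain \<xi> where \<xi>: "min s s\<^sub>0 \<le> \<xi>" "\<xi> \<le> max s s\<^sub>0" "gap s\<^sub>0 s = (kap \<xi> - kap s\<^sub>0) * (s - s\<^sub>0)"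
    using gap_mvt[OF assms] .
  show ?thesis
  proof (cases "s \<le> s\<^sub>0")
    case True
    then have "kap \<xi> \<le> kap s\<^sub>0" using \<xi> monoD[OF mono_kap] by auto
    then show ?thesis using True \<xi>(3) by (simp add: mult_nonpos_nonpos)
  next
    case False
    then have "kap \<xi> \<ge> kap s\<^sub>0" using \<xi> monoD[OF mono_kap] by auto
    then show ?thesis using False \<xi>(3) by simp
  qed
qed

lemma gap_same [simp]: "gap s s = 0"
  by (simp add: gap_def)

lemma gap_eq_0: "s \<ge> 1 \<Longrightarrow> s\<^sub>0 \<ge> 1 \<Longrightarrow> gap s\<^sub>0 s = 0"
  by (simp add: gap_def Tht_ge_1 kap_eq_1)

lemma gap_antimono:
  assumes "-1 < s" "s \<le> s'" "s' \<le> s\<^sub>0"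
  shows "gap s\<^sub>0 s' \<le> gap s\<^sub>0 s"
proof -
  have "((\<lambda>u. gap s\<^sub>0 u) has_real_derivative kap u - kap s\<^sub>0) (at u)" if "u > -1" for u
    unfolding gap_def using has_derivative_Tht[OF that] by (auto intro!: derivative_eq_intros)
  then show ?thesis
    using DERIV_nonpos_imp_nonincreasing[OF assms(2), of "gap s\<^sub>0"] assms monoD[OF mono_kap]
    by (smt (verit, ccfv_threshold))
qed

lemma Tht_ge: "s > -1 \<Longrightarrow> Tht s \<ge> s"
  using gap_nonneg[of s 1] by (simp add: gap_def Tht_ge_1 kap_eq_1)

lemma Tht_mono:
  assumes "-1 < s" "s \<le> s'"
  shows "Tht s \<le> Tht s'"
  using DERIV_nonneg_imp_nondecreasing[OF assms(2), of Tht] assms has_derivative_Tht kap_nonneg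
  by (smt (verit))

lemma Tht_lipschitz:
  assumes "-1 < s" "-1 < s'"
  shows "\<bar>Tht s - Tht s'\<bar> \<le> \<bar>s - s'\<bar>"
proof -
  have *: "Tht u - Tht v \<le> u - v" if "v \<le> u" "-1 < v" for u v
  proof -
    have "gap u v \<ge> 0" using that by (intro gap_nonneg) auto
    then have "Tht u - Tht v \<le> kap u * (u - v)" by (simp add: gap_def algebra_simps)
    also have "\<dots> \<le> u - v" using that kap_le_1[of u] by (simp add: mult_left_le_one_le kap_nonneg)
    finally show ?thesis .
  qed
  show ?thesis
    using *[of s s'] *[of s' s] Tht_mono[of s s'] Tht_mono[of s' s] assms by linarith
qed


section \<open>Estimates for the gap\<close>

text \<open>Passing from s to c s shifts ln s by the constant ln c, which is negligible as ln s
  tends to minus infinity.\<close>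

lemma kap_slowly_varying:
  assumes "c > 0"
  shows "((\<lambda>s. kap (c * s) / kap s) \<longlongrightarrow> 1) (at_right 0)"
proof -
  have "((\<lambda>s::real. (1 + (ln s)\<^sup>2) / (1 + (ln c + ln s)\<^sup>2)) \<longlongrightarrow> 1) (at_right 0)"
    by real_asymp
  then show ?thesis
  proof (rule Lim_transform_eventually)
    have "eventually (\<lambda>s::real. 0 < s \<and> s < min 1 (1 / c)) (at_right 0)"
      using assms by (auto simp: eventually_at_right_field intro!: exI[of _ "min 1 (1 / c)"])
    then show "eventually (\<lambda>s. (1 + (ln s)\<^sup>2) / (1 + (ln c + ln s)\<^sup>2) = kap (c * s) / kap s) (at_right 0)"
      by eventually_elim
        (use assms in \<open>auto simp: kap_def ln_mult field_simps mult_le_0_iff zero_less_mult_iff\<close>)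
  qed
qed

lemma kap'_small: "((\<lambda>s. s * kap' s / kap s) \<longlongrightarrow> 0) (at_right 0)"
proof -
  have "((\<lambda>s::real. - 2 * ln s / (1 + (ln s)\<^sup>2)) \<longlongrightarrow> 0) (at_right 0)"
    by real_asymp
  then show ?thesis
  proof (rule Lim_transform_eventually)
    have "eventually (\<lambda>s::real. 0 < s \<and> s < 1) (at_right 0)"
      by (auto simp: eventually_at_right_field intro!: exI[of _ 1])
    then show "eventually (\<lambda>s. - 2 * ln s / (1 + (ln s)\<^sup>2) = s * kap' s / kap s) (at_right 0)"
    proof eventually_elim
      case (elim s)
      have *: "x / q = s * (x / (s * q\<^sup>2)) / (1 / q)" if "q > 0" for x q :: real
        using that elim by (simp add: power2_eq_square)
      show ?case
        using *[OF one_plus_ln_pos[of s], of "- 2 * ln s"] elim by (simp add: kap_def kap'_def)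
    qed
  qed
qed

text \<open>Where s is at least \<mu> \<open>s\<^sub>0\<close>, slow variation bounds
  \<open>kap'\<close> by a small multiple of \<open>kap s\<^sub>0 / s\<^sub>0\<close> and the mean
  value theorem applies. Closer to 0 that bound on \<open>kap'\<close> is lost; there the gap is
  estimated by convexity and compared with (\<open>s\<^sub>0\<close> / 2)^2.\<close>

lemma gap_small:
  fixes \<Lambda> \<eta> :: real
  assumes "\<Lambda> \<ge> 1" "\<eta> > 0"
  obtains s\<^sub>1 where "s\<^sub>1 > 0"
    "\<And>s\<^sub>0 s. 0 < s\<^sub>0 \<Longrightarrow> s\<^sub>0 \<le> s\<^sub>1 \<Longrightarrow> 0 \<le> s \<Longrightarrow> s \<le> \<Lambda> * s\<^sub>0 \<Longrightarrow> gap s\<^sub>0 s \<le> \<eta> * kap s\<^sub>0 * ((s - s\<^sub>0)\<^sup>2 / s\<^sub>0)"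
proof -
  \<comment> \<open>\<mu> \<le> 1/2 keeps s < \<mu> \<open>s\<^sub>0\<close> at distance
    \<open>s\<^sub>0\<close> / 2 from \<open>s\<^sub>0\<close>, and 2 \<mu> \<le> \<eta> / 4 absorbs
    the loss there. The factor \<mu> / 2 in \<eta>' pays for replacing \<sigma> by \<mu>
    \<open>s\<^sub>0\<close> and \<open>kap \<sigma>\<close> by
    \<open>2 * kap s\<^sub>0\<close>.\<close>
  define \<mu> where "\<mu> = min (1/2) (\<eta> / 8)"
  have \<mu>: "\<mu> > 0" "\<mu> \<le> 1/2" "8 * \<mu> \<le> \<eta>" using assms by (auto simp: \<mu>_def)
  define \<eta>' where "\<eta>' = \<eta> * \<mu> / 2"
  have \<eta>': "\<eta>' > 0" using \<mu> assms by (simp add: \<eta>'_def)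
  have "eventually (\<lambda>s. kap (\<Lambda> * s) / kap s < 2) (at_right 0)"
    using kap_slowly_varying[of \<Lambda>] assms by (intro order_tendstoD) auto
  moreover have "eventually (\<lambda>s. kap (\<mu> * s) / kap s > 1 - \<mu>) (at_right 0)"
    using kap_slowly_varying[of \<mu>] \<mu> by (intro order_tendstoD) auto
  moreover have "eventually (\<lambda>s. s * kap' s / kap s < \<eta>') (at_right 0)"
    using kap'_small \<eta>' by (intro order_tendstoD) auto
  ultimately have "eventually (\<lambda>s. kap (\<Lambda> * s) / kap s < 2 \<and> kap (\<mu> * s) / kap s > 1 - \<mu>
      \<and> s * kap' s / kap s < \<eta>') (at_right 0)"
    by eventually_elim auto
  then obtain b where b: "b > 0" "\<And>s. 0 < s \<Longrightarrow> s < b \<Longrightarrow> kap (\<Lambda> * s) / kap s < 2 \<and> kap (\<mu> * s) / kap s > 1 - \<mu>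
      \<and> s * kap' s / kap s < \<eta>'"
    by (auto simp: eventually_at_right_field)
  have b\<Lambda>: "kap (\<Lambda> * s) \<le> 2 * kap s" and b\<mu>: "kap (\<mu> * s) \<ge> (1 - \<mu>) * kap s"
    and b': "s * kap' s \<le> \<eta>' * kap s" if "0 < s" "s < b" for s
    using b(2)[OF that] kap_pos[OF that(1)] by (auto simp: field_simps)
  show thesis
  proof (rule that[of "b / (2 * \<Lambda>)"])
    show "b / (2 * \<Lambda>) > 0" using b assms by auto
    fix s\<^sub>0 s :: real
    assume s0: "0 < s\<^sub>0" "s\<^sub>0 \<le> b / (2 * \<Lambda>)" and s: "0 \<le> s" "s \<le> \<Lambda> * s\<^sub>0"
    have \<Lambda>s0: "\<Lambda> * s\<^sub>0 < b" using s0 assms b by (auto simp: field_simps)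
    have s0b: "s\<^sub>0 < b" and s0\<Lambda>: "s\<^sub>0 \<le> \<Lambda> * s\<^sub>0"
    proof -
      show "s\<^sub>0 \<le> \<Lambda> * s\<^sub>0" using s0 assms by simp
      then show "s\<^sub>0 < b" using \<Lambda>s0 by simp
    qed
    note k0 = kap_pos[OF s0(1)]
    show "gap s\<^sub>0 s \<le> \<eta> * kap s\<^sub>0 * ((s - s\<^sub>0)\<^sup>2 / s\<^sub>0)"
    proof (cases "s < \<mu> * s\<^sub>0")
      case True
      have ms: "0 < \<mu> * s\<^sub>0" "\<mu> * s\<^sub>0 \<le> s\<^sub>0" "\<mu> * s\<^sub>0 \<le> s\<^sub>0 / 2"
        using \<mu> s0 by (auto simp: mult_left_le_one_le)
      have "gap s\<^sub>0 s \<le> gap s\<^sub>0 0"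
        using s True ms by (intro gap_antimono) auto
      also have "\<dots> = s\<^sub>0 * kap s\<^sub>0 - (Tht s\<^sub>0 - Tht 0)"
        by (simp add: gap_def)
      also have "\<dots> \<le> s\<^sub>0 * kap s\<^sub>0 - (Tht s\<^sub>0 - Tht (\<mu> * s\<^sub>0))"
        using Tht_mono[of 0 "\<mu> * s\<^sub>0"] ms by simp
      also have "\<dots> \<le> s\<^sub>0 * kap s\<^sub>0 - kap (\<mu> * s\<^sub>0) * (s\<^sub>0 - \<mu> * s\<^sub>0)"
        using gap_nonneg[of s\<^sub>0 "\<mu> * s\<^sub>0"] ms s0 by (simp add: gap_def)
      also have "\<dots> \<le> s\<^sub>0 * kap s\<^sub>0 - (1 - \<mu>) * kap s\<^sub>0 * (s\<^sub>0 - \<mu> * s\<^sub>0)"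
        using b\<mu>[OF s0(1) s0b] ms by (intro diff_left_mono mult_right_mono) auto
      also have "\<dots> = kap s\<^sub>0 * s\<^sub>0 * (2 * \<mu> - \<mu>\<^sup>2)"
        by (simp add: algebra_simps power2_eq_square)
      also have "\<dots> \<le> kap s\<^sub>0 * s\<^sub>0 * (\<eta> / 4)"
        using \<mu>(3) zero_le_power2[of \<mu>] k0 s0 by (intro mult_left_mono) (linarith, simp)
      also have "\<dots> = \<eta> * kap s\<^sub>0 * ((s\<^sub>0 / 2)\<^sup>2 / s\<^sub>0)"
        using s0 by (simp add: power2_eq_square)
      also have "\<dots> \<le> \<eta> * kap s\<^sub>0 * ((s\<^sub>0 - s)\<^sup>2 / s\<^sub>0)"
        using assms k0 s0 True ms by (intro mult_left_mono divide_right_mono power_mono) auto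
      finally show ?thesis by (simp add: power2_commute)
    next
      case False
      have ms: "0 < \<mu> * s\<^sub>0" "\<mu> * s\<^sub>0 \<le> s\<^sub>0"
        using \<mu> s0 by (auto simp: mult_left_le_one_le)
      have k': "kap' \<sigma> \<le> \<eta> * kap s\<^sub>0 / s\<^sub>0" if "\<mu> * s\<^sub>0 \<le> \<sigma>" "\<sigma> \<le> \<Lambda> * s\<^sub>0" for \<sigma>
      proof -
        have "kap' \<sigma> * (\<mu> * s\<^sub>0) \<le> \<sigma> * kap' \<sigma>"
          using that kap'_nonneg[of \<sigma>] by (subst mult.commute) (intro mult_right_mono)
        also have "\<dots> \<le> \<eta>' * kap \<sigma>"
          using that ms \<Lambda>s0 by (intro b') auto
        also have "\<dots> \<le> \<eta>' * (2 * kap s\<^sub>0)"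
          using b\<Lambda>[OF s0(1) s0b] monoD[OF mono_kap that(2)] \<eta>' by (intro mult_left_mono) auto
        finally have "kap' \<sigma> * s\<^sub>0 * \<mu> \<le> \<eta> * kap s\<^sub>0 * \<mu>"
          by (simp add: \<eta>'_def mult_ac)
        then have "kap' \<sigma> * s\<^sub>0 \<le> \<eta> * kap s\<^sub>0"
          using \<mu> by simp
        then show ?thesis
          using s0 by (simp add: field_simps)
      qed
      obtain \<xi> where \<xi>: "min s s\<^sub>0 \<le> \<xi>" "\<xi> \<le> max s s\<^sub>0" "gap s\<^sub>0 s = (kap \<xi> - kap s\<^sub>0) * (s - s\<^sub>0)"
        using gap_mvt[of s s\<^sub>0] s s0 by auto
      have "\<mu> * s\<^sub>0 \<le> \<xi>" "\<xi> \<le> \<Lambda> * s\<^sub>0"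
        using \<xi>(1,2) False s(2) ms s0\<Lambda> by linarith+
      then have "norm (kap \<xi> - kap s\<^sub>0) \<le> \<eta> * kap s\<^sub>0 / s\<^sub>0 * norm (\<xi> - s\<^sub>0)"
      proof (intro field_differentiable_bound[where S="{\<mu> * s\<^sub>0..\<Lambda> * s\<^sub>0}"])
        show "(kap has_field_derivative kap' z) (at z within {\<mu> * s\<^sub>0..\<Lambda> * s\<^sub>0})"
          if "z \<in> {\<mu> * s\<^sub>0..\<Lambda> * s\<^sub>0}" for z
          using has_derivative_kap[of z] that ms by (auto intro: has_field_derivative_at_within)
        show "norm (kap' z) \<le> \<eta> * kap s\<^sub>0 / s\<^sub>0" if "z \<in> {\<mu> * s\<^sub>0..\<Lambda> * s\<^sub>0}" for z
          using k'[of z] kap'_nonneg[of z] that by auto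
      qed (use ms s0\<Lambda> in auto)
      also have "\<dots> \<le> \<eta> * kap s\<^sub>0 / s\<^sub>0 * \<bar>s - s\<^sub>0\<bar>"
        using \<xi> k0 assms s0 by (intro mult_left_mono) auto
      finally have "\<bar>kap \<xi> - kap s\<^sub>0\<bar> * \<bar>s - s\<^sub>0\<bar> \<le> \<eta> * kap s\<^sub>0 / s\<^sub>0 * \<bar>s - s\<^sub>0\<bar> * \<bar>s - s\<^sub>0\<bar>"
        by (intro mult_right_mono) auto
      then have "gap s\<^sub>0 s \<le> \<eta> * kap s\<^sub>0 / s\<^sub>0 * \<bar>s - s\<^sub>0\<bar> * \<bar>s - s\<^sub>0\<bar>"
        unfolding \<xi>(3) by (metis abs_le_D1 abs_mult)
      then show ?thesis
        by (simp add: power2_eq_square mult_ac)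
    qed
  qed
qed

text \<open>Uniformity in \<open>s\<^sub>0\<close> comes from uniform continuity of
  \<open>kap'\<close> on [l/2, 2]. The first-order remainder \<open>E\<close> of \<open>kap\<close>
  is the derivative of \<open>F\<close>, so two successive mean value estimates give the order
  d^2.\<close>

lemma gap_taylor:
  fixes l \<epsilon> :: real
  assumes "l > 0" "\<epsilon> > 0"
  obtains r where "r > 0"
    "\<And>s\<^sub>0 d. l \<le> s\<^sub>0 \<Longrightarrow> s\<^sub>0 \<le> 3/2 \<Longrightarrow> \<bar>d\<bar> \<le> r \<Longrightarrow> \<bar>gap s\<^sub>0 (s\<^sub>0 + d) - kap' s\<^sub>0 / 2 * d\<^sup>2\<bar> \<le> \<epsilon> * d\<^sup>2"
proof -
  have "uniformly_continuous_on {l/2..2} kap'"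
    using assms by (intro compact_uniformly_continuous continuous_on_subset[OF continuous_kap']) auto
  then obtain \<delta> where \<delta>: "\<delta> > 0" "\<And>x y. x \<in> {l/2..2} \<Longrightarrow> y \<in> {l/2..2} \<Longrightarrow> dist y x < \<delta> \<Longrightarrow> dist (kap' y) (kap' x) < \<epsilon>"
    unfolding uniformly_continuous_on_def using assms(2) by metis
  define r where "r = min (min (\<delta>/2) (l/2)) (1/2)"
  have r: "r > 0" "r < \<delta>" "r \<le> l/2" "r \<le> 1/2"
    using \<delta> assms by (auto simp: r_def)
  show thesis
  proof (rule that[of r])
    fix s\<^sub>0 d :: real
    assume s0: "l \<le> s\<^sub>0" "s\<^sub>0 \<le> 3/2" and d: "\<bar>d\<bar> \<le> r"
    let ?I = "{s\<^sub>0 - \<bar>d\<bar>..s\<^sub>0 + \<bar>d\<bar>}"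
    have I: "z \<in> {l/2..2}" "z > 0" "dist z s\<^sub>0 < \<delta>" if "z \<in> ?I" for z
      using that s0 d r assms by (auto simp: dist_real_def)
    have s0I: "s\<^sub>0 \<in> {l/2..2}" using s0 assms by auto
    define E where "E u = kap u - kap s\<^sub>0 - kap' s\<^sub>0 * (u - s\<^sub>0)" for u
    have E: "\<bar>E u\<bar> \<le> \<epsilon> * \<bar>d\<bar>" if "u \<in> ?I" for u
    proof -
      have "norm (E u - E s\<^sub>0) \<le> \<epsilon> * norm (u - s\<^sub>0)"
      proof (rule field_differentiable_bound[where S="?I"])
        show "(E has_field_derivative kap' z - kap' s\<^sub>0) (at z within ?I)" if "z \<in> ?I" for z
          unfolding E_def
          by (rule has_field_derivative_at_within)
            (auto intro!: derivative_eq_intros has_derivative_kap[OF I(2)[OF that]])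
        show "norm (kap' z - kap' s\<^sub>0) \<le> \<epsilon>" if "z \<in> ?I" for z
          using \<delta>(2)[OF s0I I(1)[OF that] I(3)[OF that]] by (auto simp: dist_real_def)
      qed (use that in auto)
      also have "\<dots> \<le> \<epsilon> * \<bar>d\<bar>"
        using that assms by (intro mult_left_mono) auto
      finally show ?thesis by (simp add: E_def)
    qed
    define F where "F u = gap s\<^sub>0 u - kap' s\<^sub>0 / 2 * (u - s\<^sub>0)\<^sup>2" for u
    have "norm (F (s\<^sub>0 + d) - F s\<^sub>0) \<le> \<epsilon> * \<bar>d\<bar> * norm (s\<^sub>0 + d - s\<^sub>0)"
    proof (rule field_differentiable_bound[where S="?I"])
      show "(F has_field_derivative E z) (at z within ?I)" if "z \<in> ?I" for z
      proof (rule has_field_derivative_at_within)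
        have "-1 < z" using I(2)[OF that] by simp
        from has_derivative_Tht[OF this] show "(F has_field_derivative E z) (at z)"
          unfolding E_def F_def gap_def by (auto intro!: derivative_eq_intros)
      qed
      show "norm (E z) \<le> \<epsilon> * \<bar>d\<bar>" if "z \<in> ?I" for z
        using E[OF that] by simp
      show "convex ?I" by simp
      show "s\<^sub>0 + d \<in> ?I" by (simp add: abs_if)
      show "s\<^sub>0 \<in> ?I" by simp
    qed
    moreover have "F s\<^sub>0 = 0" "F (s\<^sub>0 + d) = gap s\<^sub>0 (s\<^sub>0 + d) - kap' s\<^sub>0 / 2 * d\<^sup>2"
      by (simp_all add: F_def)
    moreover have "\<epsilon> * \<bar>d\<bar> * norm (s\<^sub>0 + d - s\<^sub>0) = \<epsilon> * d\<^sup>2"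
      by (simp add: power2_eq_square)
    ultimately show "\<bar>gap s\<^sub>0 (s\<^sub>0 + d) - kap' s\<^sub>0 / 2 * d\<^sup>2\<bar> \<le> \<epsilon> * d\<^sup>2"
      by (metis diff_zero real_norm_def)
  qed (rule r)
qed


section \<open>The domain\<close>

definition flat_dom :: "'n \<Rightarrow> (complex ^ 'n) set" where
  "flat_dom i = {x. (cmod (x $ i))\<^sup>2 + Tht ((norm (prj i x))\<^sup>2) < 4}"

definition depth :: "'n \<Rightarrow> complex ^ 'n \<Rightarrow> real" where
  "depth i x = 4 - (cmod (x $ i))\<^sup>2 - Tht ((norm (prj i x))\<^sup>2)"

lemma flat_dom_iff: "x \<in> flat_dom i \<longleftrightarrow> depth i x > 0"
  by (auto simp: flat_dom_def depth_def)

lemma sq_gt_m1: "-1 < (x::real)\<^sup>2"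
  using zero_le_power2[of x] by linarith

text \<open>
  The tangent of \<open>Tht\<close> at \<open>s\<^sub>0\<close> defines an ellipsoid around the domain, and \<open>\<delta>\<close> measures the
  depth of \<open>P\<close> in it. A point of the ellipsoid at pseudohyperbolic distance at most \<open>1 - \<epsilon>\<close> from \<open>P\<close>
  has depth at least \<open>\<epsilon> \<delta> / 4\<close> and its \<open>z\<close>-component satisfies the premise of \<open>gap\<close>.
\<close>
lemma ellipsoid_embedding:
  fixes P :: "complex ^ 'n"
  assumes P: "P \<in> flat_dom i" and s0: "s\<^sub>0 > 0" and \<epsilon>: "0 < \<epsilon>" "\<epsilon> < 1"
    and \<delta>: "\<delta> = depth i P + gap s\<^sub>0 ((norm (prj i P))\<^sup>2)"
    and gap: "\<And>z. kap s\<^sub>0 * (norm (z - prj i P))\<^sup>2 \<le> 4 * \<delta> / \<epsilon> \<Longrightarrow> gap s\<^sub>0 ((norm z)\<^sup>2) < \<epsilon> * \<delta> / 4"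
  shows "\<exists>f. ball_embedding (flat_dom i) f \<and> f P = 0 \<and> ball 0 (1 - \<epsilon>) \<subseteq> f ` flat_dom i"
proof -
  define k where "k = kap s\<^sub>0"
  have k: "k > 0" unfolding k_def using kap_pos[OF s0] .
  \<comment> \<open>|w|^2 + k |z|^2 < M is the ellipsoid obtained by replacing \<open>Tht\<close>
    with its tangent; by \<open>M_eq\<close> the depth in it exceeds the depth in the domain by
    exactly the gap.\<close>
  define M where "M = 4 - Tht s\<^sub>0 + k * s\<^sub>0"
  have M_eq: "M - (cmod (x $ i))\<^sup>2 - k * (norm (prj i x))\<^sup>2 = depth i x + gap s\<^sub>0 ((norm (prj i x))\<^sup>2)" for x
    by (simp add: M_def depth_def gap_def k_def algebra_simps)
  have gap0: "gap s\<^sub>0 ((norm z)\<^sup>2) \<ge> 0" for z :: "complex ^ 'n"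
    using s0 sq_gt_m1 by (intro gap_nonneg) auto
  have \<delta>0: "\<delta> > 0"
    unfolding \<delta> using P gap0[of "prj i P"] by (simp add: flat_dom_iff)
  have M: "M > 0"
    using M_eq[of P] \<delta>0 k unfolding \<delta> by (smt (verit) zero_le_power2 mult_nonneg_nonneg)
  define A where "A x = complex_of_real (1 / sqrt M) *s (axis i (x $ i) + complex_of_real (sqrt k) *s prj i x)" for x
  define B where "B y = complex_of_real (sqrt M) *s (axis i (y $ i) + complex_of_real (1 / sqrt k) *s prj i y)" for y
  have BA: "B (A x) = x" and AB: "A (B x) = x" for x
    unfolding A_def B_def using M k
    by (auto simp: vec_eq_iff prj_nth axis_def simp flip: of_real_mult)
  have nA0: "(norm (A x))\<^sup>2 = ((cmod (x $ i))\<^sup>2 + k * (norm (prj i x))\<^sup>2) / M" for x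
  proof -
    have "(complex_of_real (sqrt k) *s prj i x) $ i = 0"
      by simp
    from norm_axis_add[OF this, of "x $ i"] show ?thesis
      unfolding A_def norm_cscale[of "complex_of_real (1 / sqrt M)"] using M k
      by (simp add: power_mult_distrib power_divide norm_divide)
  qed
  have nA: "M * (1 - (norm (A x))\<^sup>2) = depth i x + gap s\<^sub>0 ((norm (prj i x))\<^sup>2)" for x
  proof -
    have "(norm (A x))\<^sup>2 = ((cmod (x $ i))\<^sup>2 + k * (norm (prj i x))\<^sup>2) / M"
      by (rule nA0)
    then show ?thesis
      unfolding M_eq[symmetric] using M by (simp add: field_simps)
  qed
  have nAd: "M * (norm (A x - A y))\<^sup>2 \<ge> k * (norm (prj i x - prj i y))\<^sup>2" for x y
  proof -
    have "A x - A y = A (x - y)"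
      unfolding A_def by (simp add: vec_eq_iff prj_nth axis_def algebra_simps diff_divide_distrib)
    also have "M * (norm (A (x - y)))\<^sup>2 = (cmod ((x - y) $ i))\<^sup>2 + k * (norm (prj i (x - y)))\<^sup>2"
      unfolding nA0 using M by simp
    finally show ?thesis by (simp add: prj_diff)
  qed
  have A_ball: "norm (A x) < 1" if "x \<in> flat_dom i" for x
  proof -
    have "M * (1 - (norm (A x))\<^sup>2) > 0"
      unfolding nA using that gap0[of "prj i x"] by (simp add: flat_dom_iff)
    then have "(norm (A x))\<^sup>2 < 1" using M by (simp add: zero_less_mult_iff)
    then show ?thesis by (simp add: abs_square_less_1)
  qed
  define p where "p = A P"
  have p: "norm p < 1" unfolding p_def by (rule A_ball[OF P])
  have dp: "M * (1 - (norm p)\<^sup>2) = \<delta>"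
    unfolding p_def nA \<delta> ..
  define f where "f x = ball_aut p (A x)" for x
  have "ball_embedding (flat_dom i) f"
    unfolding ball_embedding_def
  proof (intro conjI)
    show "holomorphic_map_on f (flat_dom i)"
      unfolding holomorphic_map_on_iff
    proof
      fix x assume "x \<in> flat_dom i"
      have "vdiff A x" unfolding A_def by (intro vdiff_cscale vdiff_add vdiff_axis vdiff_prj) auto
      then show "vdiff f x"
        unfolding f_def using p A_ball[OF \<open>x \<in> flat_dom i\<close>] by (rule vdiff_ball_aut)
    qed
    show "inj_on f (flat_dom i)"
      by (rule inj_on_inverseI[where g="\<lambda>y. B (ball_aut p y)"])
        (simp add: f_def ball_aut_involution[OF p] A_ball BA)
    show "f ` flat_dom i \<subseteq> ball 0 1"
      using ball_aut_in_ball[OF p] A_ball by (auto simp: f_def)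
  qed
  moreover have "f P = 0"
    unfolding f_def p_def[symmetric] by (rule ball_aut_self[OF p])
  moreover have "ball 0 (1 - \<epsilon>) \<subseteq> f ` flat_dom i"
  proof
    fix y :: "complex ^ 'n" assume y: "y \<in> ball 0 (1 - \<epsilon>)"
    then have ny: "norm y < 1 - \<epsilon>" by simp
    then have y1: "norm y < 1" using \<epsilon> by simp
    define X where "X = ball_aut p y"
    have X1: "norm X < 1" unfolding X_def by (rule ball_aut_in_ball[OF p y1])
    have yX: "ball_aut p X = y" unfolding X_def by (rule ball_aut_involution[OF p y1])
    define D where "D = cmod (1 - hin X p)"
    have D0: "D > 0" unfolding D_def using hin_ne_1[OF p X1] by simp
    define dX where "dX = 1 - (norm X)\<^sup>2"
    define dP where "dP = 1 - (norm p)\<^sup>2"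
    have dX0: "dX > 0" and dP0: "dP > 0"
      using X1 p by (simp_all add: dX_def dP_def abs_square_less_1)
    have "(norm y)\<^sup>2 \<le> (1 - \<epsilon>)\<^sup>2"
      using ny by (intro power_mono) auto
    also have "\<dots> \<le> 1 - \<epsilon>"
      using \<epsilon> by (simp add: power2_eq_square mult_left_le_one_le)
    finally have "\<epsilon> \<le> 1 - (norm (ball_aut p X))\<^sup>2"
      unfolding yX by simp
    then have "\<epsilon> \<le> dP * dX / D\<^sup>2"
      unfolding norm_ball_aut[OF p X1] dX_def dP_def D_def .
    then have eD: "\<epsilon> * D\<^sup>2 \<le> dP * dX"
      using D0 by (simp add: field_simps)
    \<comment> \<open>This identity makes \<open>D\<close> dominate \<open>dX\<close>,
      \<open>dP\<close> and |X - p|^2 at once. Together with \<epsilon> D^2 \<le> dP dX it bounds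
      \<open>dX\<close> from below and |X - p|^2 from above by multiples of
      \<open>dP\<close>.\<close>
    have "2 * Re (1 - hin X p) = dX + dP + (norm (X - p))\<^sup>2"
      unfolding dX_def dP_def norm_diff_square by simp
    then have D2: "dX + dP + (norm (X - p))\<^sup>2 \<le> 2 * D"
      unfolding D_def using complex_Re_le_cmod[of "1 - hin X p"] by simp
    then have D2': "dX \<le> 2 * D" "dP \<le> 2 * D" "(norm (X - p))\<^sup>2 \<le> 2 * D"
      using dX0 dP0 zero_le_power2[of "norm (X - p)"] by linarith+
    have "\<epsilon> * D * D \<le> dP * (2 * D)"
      using eD D2'(1) dP0 by (smt (verit) mult_left_mono power2_eq_square mult.assoc)
    then have "\<epsilon> * D * D \<le> (2 * dP) * D" by simp
    then have DP: "\<epsilon> * D \<le> 2 * dP"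
      using D0 by (simp only: mult_le_cancel_right_pos)
    have "\<epsilon> * (dP / 2 * (dP / 2)) \<le> \<epsilon> * (D * D)"
      using D2'(2) dP0 \<epsilon> by (intro mult_left_mono mult_mono) auto
    also have "\<dots> \<le> dP * dX" using eD by (simp add: power2_eq_square)
    finally have "dP * (\<epsilon> * dP / 4) \<le> dP * dX" by (simp add: mult_ac)
    then have dXP: "\<epsilon> * dP / 4 \<le> dX" using dP0 by (simp only: mult_le_cancel_left_pos)
    define x where "x = B X"
    have Ax: "A x = X" unfolding x_def by (rule AB)
    have "k * (norm (prj i x - prj i P))\<^sup>2 \<le> M * (norm (X - p))\<^sup>2"
      using nAd[of x P] unfolding Ax p_def .
    also have "\<dots> \<le> M * (4 * dP / \<epsilon>)"
    proof -
      have "(norm (X - p))\<^sup>2 \<le> 4 * dP / \<epsilon>"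
      proof -
        have "D \<le> 2 * dP / \<epsilon>" using DP \<epsilon> by (simp add: field_simps)
        then have "2 * D \<le> 2 * (2 * dP / \<epsilon>)" by simp
        then show ?thesis using D2'(3) by simp
      qed
      then show ?thesis using M by (intro mult_left_mono) auto
    qed
    also have "\<dots> = 4 * \<delta> / \<epsilon>"
      unfolding dp[symmetric] dP_def by simp
    finally have "gap s\<^sub>0 ((norm (prj i x))\<^sup>2) < \<epsilon> * \<delta> / 4"
      unfolding k_def by (rule gap)
    also have "\<dots> = M * (\<epsilon> * dP / 4)" unfolding dp[symmetric] dP_def by simp
    also have "\<dots> \<le> M * dX" using dXP M by simp
    also have "\<dots> = depth i x + gap s\<^sub>0 ((norm (prj i x))\<^sup>2)"
      unfolding dX_def using nA[of x] unfolding Ax .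
    finally have "x \<in> flat_dom i" by (simp add: flat_dom_iff)
    moreover have "f x = y" unfolding f_def Ax yX ..
    ultimately show "y \<in> f ` flat_dom i" by blast
  qed
  ultimately show ?thesis by blast
qed

section \<open>Boundary points at which a tangent ellipsoid suffices\<close>

lemma embedding_outer:
  fixes \<epsilon> :: real
  assumes "0 < \<epsilon>" "\<epsilon> < 1"
  obtains t where "t > 0"
    "\<And>P :: complex ^ 'n. P \<in> flat_dom i \<Longrightarrow> depth i P < t \<Longrightarrow> (norm (prj i P))\<^sup>2 \<ge> 3/2 \<Longrightarrow>
       \<exists>f. ball_embedding (flat_dom i) f \<and> f P = 0 \<and> ball 0 (1 - \<epsilon>) \<subseteq> f ` flat_dom i"
\<comment> \<open>Then 4 depth / \<epsilon> < 1/100, so z moves by at most 1/10 from a point of norm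
  at least 1.2 (as 1.44 < 3/2). Thus |z| \<ge> 1, where \<open>Tht\<close> is the identity and the
  gap vanishes.\<close>
proof (rule that[of "\<epsilon> / 400"])
  fix P :: "complex ^ 'n"
  assume P: "P \<in> flat_dom i" "depth i P < \<epsilon> / 400" "(norm (prj i P))\<^sup>2 \<ge> 3/2"
  define s\<^sub>0 where "s\<^sub>0 = (norm (prj i P))\<^sup>2"
  have s0: "s\<^sub>0 \<ge> 1" using P by (simp add: s\<^sub>0_def)
  show "\<exists>f. ball_embedding (flat_dom i) f \<and> f P = 0 \<and> ball 0 (1 - \<epsilon>) \<subseteq> f ` flat_dom i"
  proof (rule ellipsoid_embedding[OF P(1) _ assms, of s\<^sub>0 "depth i P"])
    fix z assume z: "kap s\<^sub>0 * (norm (z - prj i P))\<^sup>2 \<le> 4 * depth i P / \<epsilon>"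
    then have "(norm (z - prj i P))\<^sup>2 \<le> 4 * depth i P / \<epsilon>"
      using s0 by (simp add: kap_eq_1)
    also have "\<dots> \<le> (1 / 10)\<^sup>2"
      using P(2) assms by (simp add: field_simps power2_eq_square)
    finally have "norm (z - prj i P) \<le> 1 / 10"
      by (rule power2_le_imp_le) simp
    moreover have "norm (prj i P) \<ge> 1.2"
      by (rule power2_le_imp_le) (use P(3) in \<open>auto simp: power2_eq_square\<close>)
    ultimately have "norm z \<ge> 1"
      using norm_triangle_ineq2[of "prj i P" z] by (simp add: norm_minus_commute)
    then have "gap s\<^sub>0 ((norm z)\<^sup>2) = 0"
      using s0 by (intro gap_eq_0) (auto simp: one_le_power)
    then show "gap s\<^sub>0 ((norm z)\<^sup>2) < \<epsilon> * depth i P / 4"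
      using P assms by (simp add: flat_dom_iff)
  qed (use s0 in \<open>auto simp: s\<^sub>0_def\<close>)
qed (use assms in simp)

text \<open>The tangent point \<open>s\<^sub>0\<close> has to meet two competing demands: t at most
  \<open>s\<^sub>0 * kap s\<^sub>0\<close>, so that the relevant z satisfy |z|^2 \<le> \<Lambda>
  \<open>s\<^sub>0\<close>, and \<open>gap s\<^sub>0 q\<close> at most t, so that \<delta> remains
  comparable to t.\<close>

lemma embedding_inner:
  fixes \<epsilon> :: real
  assumes \<epsilon>: "0 < \<epsilon>" "\<epsilon> < 1"
  obtains t s\<^sub>1 where "t > 0" "s\<^sub>1 > 0"
    "\<And>P :: complex ^ 'n. P \<in> flat_dom i \<Longrightarrow> depth i P < t \<Longrightarrow> (norm (prj i P))\<^sup>2 \<le> s\<^sub>1 \<Longrightarrow>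
       \<exists>f. ball_embedding (flat_dom i) f \<and> f P = 0 \<and> ball 0 (1 - \<epsilon>) \<subseteq> f ` flat_dom i"
proof -
  \<comment> \<open>From k \<rho>^2 \<le> 8 t / \<epsilon> and t \<le> k \<open>s\<^sub>0\<close>
    follows \<rho> \<le> \<open>c * sqrt s\<^sub>0\<close>, hence |z| \<le>
    \<open>(1 + c) * sqrt s\<^sub>0\<close>; this is the origin of \<Lambda>.\<close>
  define c where "c = sqrt (8 / \<epsilon>)"
  have c: "c \<ge> 0" "c\<^sup>2 = 8 / \<epsilon>" using \<epsilon> by (auto simp: c_def)
  define \<Lambda> where "\<Lambda> = (1 + c)\<^sup>2"
  have \<Lambda>: "\<Lambda> \<ge> 1" unfolding \<Lambda>_def using c by (simp add: one_le_power)
  define \<eta> where "\<eta> = \<epsilon>\<^sup>2 / (200 * \<Lambda>\<^sup>2)"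
  have \<eta>: "\<eta> > 0" unfolding \<eta>_def using \<epsilon> \<Lambda> by simp
  have \<eta>1: "\<eta> \<le> 1" and \<eta>2: "\<eta> * \<Lambda>\<^sup>2 < \<epsilon> / 4" and \<eta>3: "\<eta> * (32 * \<Lambda> / \<epsilon>) < \<epsilon> / 4"
  proof -
    have \<epsilon>2: "\<epsilon>\<^sup>2 \<le> \<epsilon>" using \<epsilon> by (simp add: power2_eq_square mult_left_le_one_le)
    have \<Lambda>2: "\<Lambda> \<le> \<Lambda>\<^sup>2" "1 \<le> \<Lambda>\<^sup>2" using \<Lambda> by (auto simp: self_le_power one_le_power)
    have "\<eta> * \<Lambda>\<^sup>2 = \<epsilon>\<^sup>2 / 200" unfolding \<eta>_def using \<Lambda> by simp
    then show e: "\<eta> * \<Lambda>\<^sup>2 < \<epsilon> / 4" using \<epsilon>2 \<epsilon> by linarith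
    have "\<eta> \<le> \<eta> * \<Lambda>\<^sup>2" using \<Lambda>2 \<eta> by simp
    then show "\<eta> \<le> 1" using e \<epsilon> by linarith
    have "\<eta> * (32 * \<Lambda> / \<epsilon>) \<le> \<eta> * (32 * \<Lambda>\<^sup>2 / \<epsilon>)"
      using \<Lambda>2 \<eta> \<epsilon> by (intro mult_left_mono divide_right_mono) auto
    also have "\<dots> = (32 / 200) * \<epsilon>" unfolding \<eta>_def using \<Lambda> \<epsilon> by (simp add: power2_eq_square)
    also have "\<dots> < \<epsilon> / 4" using \<epsilon> by simp
    finally show "\<eta> * (32 * \<Lambda> / \<epsilon>) < \<epsilon> / 4" .
  qed
  obtain s\<^sub>1 where s1: "s\<^sub>1 > 0" and small:
    "\<And>s\<^sub>0 s. 0 < s\<^sub>0 \<Longrightarrow> s\<^sub>0 \<le> s\<^sub>1 \<Longrightarrow> 0 \<le> s \<Longrightarrow> s \<le> \<Lambda> * s\<^sub>0 \<Longrightarrow> gap s\<^sub>0 s \<le> \<eta> * kap s\<^sub>0 * ((s - s\<^sub>0)\<^sup>2 / s\<^sub>0)"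
    using gap_small[OF \<Lambda> \<eta>] by blast
  show thesis
  \<comment> \<open>This bound on the depth lets the intermediate value theorem find a solution of x
    kap(x) = t below \<open>s\<^sub>1\<close>.\<close>
  proof (rule that[of "s\<^sub>1 * kap s\<^sub>1" s\<^sub>1])
    show "s\<^sub>1 * kap s\<^sub>1 > 0" "s\<^sub>1 > 0" using s1 kap_pos[OF s1] by auto
    fix P :: "complex ^ 'n"
    assume P: "P \<in> flat_dom i" "depth i P < s\<^sub>1 * kap s\<^sub>1" "(norm (prj i P))\<^sup>2 \<le> s\<^sub>1"
    define q where "q = (norm (prj i P))\<^sup>2"
    define t where "t = depth i P"
    have t: "t > 0" using P by (simp add: t_def flat_dom_iff)
    have q: "0 \<le> q" "q \<le> s\<^sub>1" using P by (auto simp: q_def)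
    \<comment> \<open>If \<open>q\<close> is too small for the depth \<open>t\<close>, take the tangent at the natural scale of \<open>t\<close> instead.\<close>
    have "\<exists>s\<^sub>0>0. q \<le> s\<^sub>0 \<and> s\<^sub>0 \<le> s\<^sub>1 \<and> t \<le> s\<^sub>0 * kap s\<^sub>0 \<and> (s\<^sub>0 = q \<or> s\<^sub>0 * kap s\<^sub>0 = t)"
    proof (cases "t \<le> q * kap q")
      case True
      then have "q > 0" using q t by (cases "q = 0") auto
      with True q show ?thesis by (intro exI[of _ q]) auto
    next
      case False
      have "\<exists>x\<ge>q. x \<le> s\<^sub>1 \<and> x * kap x = t"
        using False P(2) q
        by (intro IVT') (auto simp: t_def intro!: continuous_intros continuous_on_subset[OF continuous_kap])
      then obtain x where x: "q \<le> x" "x \<le> s\<^sub>1" "x * kap x = t" by blast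
      then have "x > 0" using q t by (cases "x = 0") auto
      with x show ?thesis by (intro exI[of _ x]) auto
    qed
    then obtain s\<^sub>0 where s0: "s\<^sub>0 > 0" "q \<le> s\<^sub>0" "s\<^sub>0 \<le> s\<^sub>1" "t \<le> s\<^sub>0 * kap s\<^sub>0" "s\<^sub>0 = q \<or> s\<^sub>0 * kap s\<^sub>0 = t"
      by blast
    define k where "k = kap s\<^sub>0"
    have k: "k > 0" unfolding k_def by (rule kap_pos[OF s0(1)])
    define \<delta> where "\<delta> = t + gap s\<^sub>0 q"
    have \<delta>t: "t \<le> \<delta>"
      unfolding \<delta>_def using gap_nonneg[of q s\<^sub>0] q s0 by simp
    have \<delta>2: "\<delta> \<le> 2 * t"
      using s0(5)
    proof
      assume "s\<^sub>0 = q" then show ?thesis using t by (simp add: \<delta>_def)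
    next
      assume st: "s\<^sub>0 * kap s\<^sub>0 = t"
      have "s\<^sub>0 \<le> \<Lambda> * s\<^sub>0" using \<Lambda> s0(1) by simp
      then have "gap s\<^sub>0 q \<le> \<eta> * kap s\<^sub>0 * ((q - s\<^sub>0)\<^sup>2 / s\<^sub>0)"
        using q s0 by (intro small) linarith+
      also have "\<dots> \<le> 1 * kap s\<^sub>0 * (s\<^sub>0\<^sup>2 / s\<^sub>0)"
        using \<eta> \<eta>1 q s0 kap_nonneg[of s\<^sub>0]
        by (intro mult_mono divide_right_mono) (auto simp: abs_le_square_iff[symmetric])
      also have "\<dots> = t" using st s0 by (simp add: power2_eq_square mult.commute)
      finally show ?thesis by (simp add: \<delta>_def)
    qed
    have s0q: "sqrt q \<le> sqrt s\<^sub>0" using s0 by simp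
    show "\<exists>f. ball_embedding (flat_dom i) f \<and> f P = 0 \<and> ball 0 (1 - \<epsilon>) \<subseteq> f ` flat_dom i"
    proof (rule ellipsoid_embedding[OF P(1) s0(1) \<epsilon>, of \<delta>])
      show "\<delta> = depth i P + gap s\<^sub>0 ((norm (prj i P))\<^sup>2)"
        by (simp add: \<delta>_def t_def q_def)
      fix z assume z: "kap s\<^sub>0 * (norm (z - prj i P))\<^sup>2 \<le> 4 * \<delta> / \<epsilon>"
      define \<rho> where "\<rho> = norm (z - prj i P)"
      define s where "s = (norm z)\<^sup>2"
      have "k * \<rho>\<^sup>2 \<le> 4 * \<delta> / \<epsilon>" using z by (simp add: k_def \<rho>_def)
      also have "\<dots> \<le> 4 * (2 * t) / \<epsilon>"
        using \<delta>2 \<epsilon> by (intro divide_right_mono mult_left_mono) auto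
      finally have k\<rho>: "k * \<rho>\<^sup>2 \<le> 8 * t / \<epsilon>" by simp
      also have "\<dots> \<le> 8 * (s\<^sub>0 * k) / \<epsilon>"
        using s0(4) \<epsilon> by (intro divide_right_mono mult_left_mono) (auto simp: k_def)
      also have "\<dots> = k * (c * sqrt s\<^sub>0)\<^sup>2"
        using s0 by (simp add: power_mult_distrib c)
      finally have "\<rho>\<^sup>2 \<le> (c * sqrt s\<^sub>0)\<^sup>2" using k by simp
      then have \<rho>: "\<rho> \<le> c * sqrt s\<^sub>0"
        by (rule power2_le_imp_le) (use c s0 in auto)
      have nq: "norm (prj i P) = sqrt q" by (simp add: q_def)
      have nz: "norm z \<le> sqrt q + \<rho>"
        unfolding \<rho>_def nq[symmetric] by (metis norm_triangle_sub)
      also have "\<dots> \<le> (1 + c) * sqrt s\<^sub>0"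
        using s0q \<rho> unfolding distrib_right mult_1 by (rule add_mono)
      finally have "s \<le> ((1 + c) * sqrt s\<^sub>0)\<^sup>2"
        unfolding s_def by (intro power_mono) auto
      also have "\<dots> = \<Lambda> * s\<^sub>0" using s0 by (simp add: power_mult_distrib \<Lambda>_def)
      finally have s\<Lambda>: "s \<le> \<Lambda> * s\<^sub>0" .
      have s_nn: "0 \<le> s" by (simp add: s_def)
      have gs: "gap s\<^sub>0 s \<le> \<eta> * k * ((s - s\<^sub>0)\<^sup>2 / s\<^sub>0)"
        unfolding k_def using s0 s\<Lambda> s_nn by (intro small) auto
      have "gap s\<^sub>0 s < \<epsilon> * t / 4"
        using s0(5)
      proof
        \<comment> \<open>Here t may be far smaller than \<open>s\<^sub>0 * kap s\<^sub>0\<close>,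
          so s - \<open>s\<^sub>0\<close> must be estimated through \<rho>, which t controls. In the
          other case t equals that product and the crude bound \<Lambda> \<open>s\<^sub>0\<close> is
          enough.\<close>
        assume sq: "s\<^sub>0 = q"
        have "\<bar>norm z - sqrt s\<^sub>0\<bar> \<le> \<rho>"
          unfolding sq nq[symmetric] \<rho>_def by (rule norm_triangle_ineq3)
        moreover have "norm z + sqrt s\<^sub>0 \<le> (2 + c) * sqrt s\<^sub>0"
          using nz s0q \<rho> unfolding distrib_right by linarith
        ultimately have "\<bar>norm z - sqrt s\<^sub>0\<bar> * (norm z + sqrt s\<^sub>0) \<le> \<rho> * ((2 + c) * sqrt s\<^sub>0)"
          using s0 c by (intro mult_mono) (auto simp: \<rho>_def)
        moreover have "s - s\<^sub>0 = (norm z - sqrt s\<^sub>0) * (norm z + sqrt s\<^sub>0)"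
          using s0 by (simp add: s_def algebra_simps power2_eq_square)
        moreover have "norm z + sqrt s\<^sub>0 \<ge> 0" using s0 by simp
        ultimately have "\<bar>s - s\<^sub>0\<bar> \<le> \<rho> * ((2 + c) * sqrt s\<^sub>0)"
          by (simp add: abs_mult)
        then have "(s - s\<^sub>0)\<^sup>2 \<le> (\<rho> * ((2 + c) * sqrt s\<^sub>0))\<^sup>2"
          using c s0 by (intro abs_le_square_iff[THEN iffD1]) (auto simp: \<rho>_def)
        also have "\<dots> = \<rho>\<^sup>2 * (2 + c)\<^sup>2 * s\<^sub>0"
          using s0 by (simp add: power_mult_distrib)
        finally have "(s - s\<^sub>0)\<^sup>2 / s\<^sub>0 \<le> \<rho>\<^sup>2 * (2 + c)\<^sup>2"
          using s0 by (simp add: field_simps)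
        moreover have "(2 + c)\<^sup>2 \<le> 4 * \<Lambda>"
        proof -
          have "(2 + c)\<^sup>2 \<le> (2 * (1 + c))\<^sup>2" using c by (intro power_mono) auto
          also have "(2 * (1 + c))\<^sup>2 = 4 * \<Lambda>" unfolding \<Lambda>_def power_mult_distrib by simp
          finally show ?thesis .
        qed
        ultimately have "(s - s\<^sub>0)\<^sup>2 / s\<^sub>0 \<le> \<rho>\<^sup>2 * (4 * \<Lambda>)"
          by (meson mult_left_mono order_trans zero_le_power2)
        then have "\<eta> * k * ((s - s\<^sub>0)\<^sup>2 / s\<^sub>0) \<le> \<eta> * k * (\<rho>\<^sup>2 * (4 * \<Lambda>))"
          using \<eta> k by (intro mult_left_mono) auto
        also have "\<dots> = \<eta> * (4 * \<Lambda>) * (k * \<rho>\<^sup>2)" by simp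
        also have "\<dots> \<le> \<eta> * (4 * \<Lambda>) * (8 * t / \<epsilon>)"
          using k\<rho> \<eta> \<Lambda> by (intro mult_left_mono) auto
        also have "\<dots> = \<eta> * (32 * \<Lambda> / \<epsilon>) * t" by simp
        also have "\<dots> < \<epsilon> / 4 * t" using \<eta>3 t by (intro mult_strict_right_mono) auto
        finally show ?thesis using gs by linarith
      next
        assume st: "s\<^sub>0 * kap s\<^sub>0 = t"
        have "s\<^sub>0 \<le> \<Lambda> * s\<^sub>0" using \<Lambda> s0(1) by simp
        then have "\<bar>s - s\<^sub>0\<bar> \<le> \<Lambda> * s\<^sub>0" using s\<Lambda> s_nn s0 by linarith
        then have "(s - s\<^sub>0)\<^sup>2 \<le> (\<Lambda> * s\<^sub>0)\<^sup>2"
          using \<Lambda> s0 by (intro abs_le_square_iff[THEN iffD1]) auto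
        then have "(s - s\<^sub>0)\<^sup>2 / s\<^sub>0 \<le> (\<Lambda> * s\<^sub>0)\<^sup>2 / s\<^sub>0"
          using s0 by (intro divide_right_mono) auto
        also have "\<dots> = \<Lambda>\<^sup>2 * s\<^sub>0" using s0 by (simp add: power2_eq_square)
        finally have "\<eta> * k * ((s - s\<^sub>0)\<^sup>2 / s\<^sub>0) \<le> \<eta> * k * (\<Lambda>\<^sup>2 * s\<^sub>0)"
          using \<eta> k by (intro mult_left_mono) auto
        also have "\<dots> = \<eta> * \<Lambda>\<^sup>2 * t" using st by (simp add: k_def mult.commute)
        also have "\<dots> < \<epsilon> / 4 * t" using \<eta>2 t by (intro mult_strict_right_mono) auto
        finally show ?thesis using gs by linarith
      qed
      also have "\<dots> \<le> \<epsilon> * \<delta> / 4" using \<delta>t \<epsilon> by simp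
      finally show "gap s\<^sub>0 ((norm z)\<^sup>2) < \<epsilon> * \<delta> / 4" by (simp add: s_def)
    qed
  qed
qed


section \<open>Embedding model domains\<close>

text \<open>A rank one perturbation of the identity. For a suitable d it is an explicit square root
  of the Hermitian form |h|^2 + G |<h, a>|^2 with G \<ge> 0.\<close>

definition stretch :: "real \<Rightarrow> complex ^ 'n \<Rightarrow> complex ^ 'n \<Rightarrow> complex ^ 'n" where
  "stretch d a h = h + (complex_of_real d * hin h a) *s a"

lemma norm_stretch:
  "(norm (stretch d a h))\<^sup>2 = (norm h)\<^sup>2 + (2 * d + d\<^sup>2 * (norm a)\<^sup>2) * (cmod (hin h a))\<^sup>2"
proof -
  have "Re (hin h ((complex_of_real d * hin h a) *s a)) = d * (cmod (hin h a))\<^sup>2"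
    unfolding cmod_power2 by (simp add: power2_eq_square algebra_simps)
  then show ?thesis
    unfolding stretch_def norm_add_square
    by (simp add: norm_mult power_mult_distrib algebra_simps)
qed

lemma stretch_stretch:
  assumes "d + e + d * e * (norm a)\<^sup>2 = 0"
  shows "stretch e a (stretch d a h) = h"
proof -
  have "complex_of_real d + of_real e + of_real d * of_real e * of_real ((norm a)\<^sup>2) = 0"
    using assms by (metis of_real_0 of_real_add of_real_mult)
  then have *: "hin h a * (complex_of_real d + of_real e + of_real d * of_real e * of_real ((norm a)\<^sup>2)) = 0"
    by simp
  have "hin (stretch d a h) a = hin h a + of_real d * hin h a * of_real ((norm a)\<^sup>2)"
    by (simp add: stretch_def hin_add_left hin_self)
  then have "stretch e a (stretch d a h) = h + (hin h a * (complex_of_real d + of_real e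
      + of_real d * of_real e * of_real ((norm a)\<^sup>2))) *s a"
    unfolding stretch_def[of e] by (simp add: stretch_def vec_eq_iff algebra_simps)
  then show ?thesis unfolding * by simp
qed

lemma stretch_nth: "a $ i = 0 \<Longrightarrow> stretch d a h $ i = h $ i"
  by (simp add: stretch_def)

lemma stretch_zero [simp]: "stretch d a 0 = 0"
  by (simp add: stretch_def)

lemma stretch_exists:
  fixes G :: real
  assumes "G \<ge> 0"
  obtains d e where "\<And>h. stretch e a (stretch d a h) = h" "\<And>h. stretch d a (stretch e a h) = h"
    "\<And>h. (norm (stretch d a h))\<^sup>2 = (norm h)\<^sup>2 + G * (cmod (hin h a))\<^sup>2"
proof -
  define N where "N = (norm a)\<^sup>2"
  define q where "q = sqrt (1 + G * N)"
  have N: "N \<ge> 0" by (simp add: N_def)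
  have q: "q\<^sup>2 = 1 + G * N" "q \<ge> 0" using assms N by (auto simp: q_def)
  \<comment> \<open>The nonnegative root of 2 d + d^2 N = G, rationalised so that N = 0 is
    allowed.\<close>
  define d where "d = G / (1 + q)"
  define e where "e = - d / (1 + d * N)"
  have d: "d \<ge> 0" using assms q by (simp add: d_def)
  have dq: "d * (1 + q) = G" using q by (simp add: d_def)
  have "(2 * d + d\<^sup>2 * N) * (1 + q)\<^sup>2 = 2 * G * (1 + q) + G\<^sup>2 * N"
    unfolding dq[symmetric] by (simp add: power2_eq_square algebra_simps)
  also have "\<dots> = G * (1 + q)\<^sup>2"
    using q(1) by (simp add: power2_eq_square algebra_simps)
  finally have dG: "2 * d + d\<^sup>2 * N = G"
    using q(2) by simp
  have "d * N \<ge> 0" using d N by simp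
  then have "1 + d * N \<noteq> 0" by linarith
  then have "d + e + d * e * N = 0"
    by (simp add: e_def field_simps)
  then show thesis
    using stretch_stretch[of d e a] stretch_stretch[of e d a] norm_stretch[of d a] dG
    by (intro that[of e d]) (auto simp: N_def algebra_simps)
qed

text \<open>
  The last bound is nearly \<open>|\<psi>| + |1 - \<psi>| \<le> 1\<close>: a small exponent keeps \<open>\<psi>\<close> close to the segment
  \<open>[0, 1]\<close> on the whole half-plane.
\<close>
lemma powr_right_halfplane:
  fixes u :: complex and \<mu> :: real
  assumes "Re u \<ge> 0" "\<mu> > 0"
  defines "\<psi> \<equiv> (1 + u) powr (- of_real \<mu>)"
  shows "cmod \<psi> = cmod (1 + u) powr (- \<mu>)" "cmod \<psi> \<le> 1" "cmod (1 - \<psi>) \<le> 1 - cmod \<psi> + cmod \<psi> * (2 * \<mu>)"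
proof -
  have nz: "1 + u \<noteq> 0" using assms(1) by (auto simp: complex_eq_iff)
  have ge1: "cmod (1 + u) \<ge> 1"
    using complex_Re_le_cmod[of "1 + u"] assms(1) by simp
  define \<theta> where "\<theta> = - (\<mu> * Im (Ln (1 + u)))"
  have \<psi>: "\<psi> = exp (of_real (- (\<mu> * ln (cmod (1 + u)))) + \<i> * of_real \<theta>)"
  proof -
    define y where "y = Im (Ln (1 + u))"
    have "Ln (1 + u) = of_real (ln (cmod (1 + u))) + \<i> * of_real y"
      unfolding y_def by (rule complex_eqI) (simp_all add: Re_Ln[OF nz] del: Re_Ln)
    then show ?thesis
      unfolding \<psi>_def powr_def \<theta>_def y_def[symmetric] using nz by (simp add: algebra_simps)
  qed
  have \<psi>': "\<psi> = of_real (cmod (1 + u) powr (- \<mu>)) * exp (\<i> * of_real \<theta>)"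
    unfolding \<psi> exp_add using nz by (simp add: powr_def exp_of_real[symmetric])
  show n: "cmod \<psi> = cmod (1 + u) powr (- \<mu>)"
    unfolding \<psi>' by (simp add: norm_mult)
  show le1: "cmod \<psi> \<le> 1"
    unfolding n using ge_one_powr_ge_zero[OF ge1, of \<mu>] assms(2) by (simp add: powr_minus inverse_le_1_iff)
  have "\<bar>Im (Ln (1 + u))\<bar> < pi / 2"
    using Re_Ln_pos_lt[OF nz] assms(1) by simp
  then have \<theta>: "\<bar>\<theta>\<bar> \<le> 2 * \<mu>"
    unfolding \<theta>_def using assms(2) pi_less_4 by (simp add: abs_mult)
  have "cmod (1 - exp (\<i> * of_real \<theta>)) \<le> \<bar>\<theta>\<bar>"
  proof -
    have "(cmod (1 - exp (\<i> * of_real \<theta>)))\<^sup>2 = (2 * sin (\<theta> / 2))\<^sup>2"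
    proof -
      have "exp (\<i> * of_real \<theta>) = Complex (cos \<theta>) (sin \<theta>)"
        by (simp add: complex_eq_iff flip: cis_conv_exp)
      then have "(cmod (1 - exp (\<i> * of_real \<theta>)))\<^sup>2 = (1 - cos \<theta>)\<^sup>2 + (sin \<theta>)\<^sup>2"
        by (simp add: cmod_power2)
      also have "\<dots> = 2 * (1 - cos \<theta>)"
        using sin_cos_squared_add[of \<theta>] by (simp add: power2_eq_square algebra_simps)
      also have "cos \<theta> = 1 - 2 * (sin (\<theta> / 2))\<^sup>2"
        using cos_double_sin[of "\<theta> / 2"] by simp
      finally show ?thesis by (simp add: power_mult_distrib)
    qed
    then have "cmod (1 - exp (\<i> * of_real \<theta>)) = \<bar>2 * sin (\<theta> / 2)\<bar>"
      by (metis abs_norm_cancel power2_eq_iff_nonneg power2_abs abs_ge_zero)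
    also have "\<dots> \<le> \<bar>\<theta>\<bar>"
      using abs_sin_x_le_abs_x[of "\<theta> / 2"] by simp
    finally show ?thesis .
  qed
  then have *: "cmod (1 - exp (\<i> * of_real \<theta>)) \<le> 2 * \<mu>" using \<theta> by simp
  \<comment> \<open>The deviation splits into the radial part 1 - |\<psi>| and an angular part at
    most |\<psi>| |\<theta>|, where |\<theta>| \<le> \<mu> pi / 2 because 1 + u lies in the right
    half-plane.\<close>
  have "1 - \<psi> = of_real (1 - cmod \<psi>) + of_real (cmod \<psi>) * (1 - exp (\<i> * of_real \<theta>))"
    using \<psi>' n by (simp add: algebra_simps)
  then have "cmod (1 - \<psi>) \<le> cmod (of_real (1 - cmod \<psi>)) + cmod (of_real (cmod \<psi>) * (1 - exp (\<i> * of_real \<theta>)))"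
    by (metis norm_triangle_ineq)
  also have "\<dots> = (1 - cmod \<psi>) + cmod \<psi> * cmod (1 - exp (\<i> * of_real \<theta>))"
    using le1 by (simp only: norm_mult norm_of_real) simp
  also have "\<dots> \<le> (1 - cmod \<psi>) + cmod \<psi> * (2 * \<mu>)"
    using * by (intro add_left_mono mult_left_mono) auto
  finally show "cmod (1 - \<psi>) \<le> 1 - cmod \<psi> + cmod \<psi> * (2 * \<mu>)" .
qed

text \<open>Equivalently |1 - W|^2 < 1 - V(h): a family of discs centred at 1, which touch the
  origin over h = 0 when V(0) = 0.\<close>

definition model_dom :: "'n \<Rightarrow> (complex ^ 'n \<Rightarrow> real) \<Rightarrow> (complex ^ 'n) set" where
  "model_dom i V = {y. (cmod (y $ i))\<^sup>2 + V (prj i y) < 2 * Re (y $ i)}"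

text \<open>The threshold for \<tau> depends only on \<epsilon>, c, C and \<open>r\<^sub>0\<close>,
  so one value serves all base points of a compact family. The target is the Siegel domain of
  \<beta> H instead of H: the factor \<beta> < 1 leaves room for the errors of the shear, at a cost
  that the loss \<epsilon> in the radius can pay.\<close>

lemma model_embedding:
  fixes \<epsilon> c C r\<^sub>0 :: real
  assumes \<epsilon>: "0 < \<epsilon>" "\<epsilon> < 1" and c: "c > 0" and C: "C > 0" and r0: "r\<^sub>0 > 0"
  obtains \<tau>\<^sub>0 where "\<tau>\<^sub>0 > 0"
    "\<And>\<tau> (a :: complex ^ 'n) m \<gamma> V. 0 < \<tau> \<Longrightarrow> \<tau> < \<tau>\<^sub>0 \<Longrightarrow> a $ i = 0 \<Longrightarrow> c \<le> m \<Longrightarrow> 0 \<le> \<gamma> \<Longrightarrow>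
      m + 2 * \<gamma> * (norm a)\<^sup>2 \<le> C \<Longrightarrow>
      (\<And>h. h $ i = 0 \<Longrightarrow> V h < 1 \<Longrightarrow> c * (norm h)\<^sup>2 \<le> V h) \<Longrightarrow>
      (\<And>h. h $ i = 0 \<Longrightarrow> norm h \<le> r\<^sub>0 \<Longrightarrow>
         \<bar>V h - m * (norm h)\<^sup>2 - 2 * \<gamma> * (Re (hin h a))\<^sup>2\<bar> \<le> c * \<epsilon> / 32 * (norm h)\<^sup>2) \<Longrightarrow>
      \<exists>G. ball_embedding (model_dom i V) G \<and> G (axis i (of_real \<tau>)) = 0 \<and> ball 0 (1 - \<epsilon>) \<subseteq> G ` model_dom i V"
proof -
  \<comment> \<open>\<beta> = 1 - 2 \<mu> matches the angular error in
    \<open>powr_right_halfplane\<close>, and \<eta> \<le> (1 - \<beta>) m absorbs the error of the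
    jet. |W| < \<open>r\<^sub>1\<close> forces |h| \<le> \<open>r\<^sub>0\<close>, while r is so
    small that |W| \<ge> \<open>r\<^sub>1\<close> forces |\<sigma>^2| \<le> c / C.\<close>
  define \<eta> where "\<eta> = c * \<epsilon> / 32"
  define \<beta> where "\<beta> = 1 - \<epsilon> / 16"
  define \<mu> where "\<mu> = \<epsilon> / 32"
  have \<beta>: "\<beta> \<ge> 1/2" "\<beta> < 1" "\<beta> = 1 - 2 * \<mu>" and \<mu>: "\<mu> > 0" using \<epsilon> by (auto simp: \<beta>_def \<mu>_def)
  define r\<^sub>1 where "r\<^sub>1 = c * r\<^sub>0\<^sup>2 / 2"
  have r1: "r\<^sub>1 > 0" using c r0 by (simp add: r\<^sub>1_def)
  define r where "r = r\<^sub>1 * ((c / C) powr (1 / \<mu>))"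
  have r: "r > 0" using r1 c C by (simp add: r_def)
  have "isCont (\<lambda>u. (1 + u) powr complex_of_real \<mu>) 0"
    by (intro continuous_intros) auto
  then obtain \<delta> where \<delta>: "\<delta> > 0" "\<And>u. cmod u < \<delta> \<Longrightarrow> cmod ((1 + u) powr of_real \<mu> - 1) < \<epsilon> / 32"
    unfolding continuous_at_eps_delta using \<epsilon>
    by (metis (no_types, lifting) add_0_right diff_0_right dist_norm divide_pos_pos one_neq_zero powr_one_eq_one zero_less_numeral)
  \<comment> \<open>The points to be covered have |W| \<le> 6 X with X <
    \<open>\<tau>\<^sub>0 / \<epsilon>\<^sup>2\<close>. The four bounds give, in order: \<sigma>
    close to 1, W inside the domain of \<sigma>, |W|^2 negligible against \<epsilon> X, and the
    z-component within \<open>r\<^sub>0\<close>.\<close>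
  define \<tau>\<^sub>0 where "\<tau>\<^sub>0 = \<epsilon>\<^sup>2 * min (min (\<delta> * r / 6) (r / 6)) (min (\<epsilon> / 144) (c * r\<^sub>0\<^sup>2 / 8))"
  show thesis
  proof (rule that[of \<tau>\<^sub>0])
    show "\<tau>\<^sub>0 > 0" using \<epsilon> \<delta> r c r0 by (simp add: \<tau>\<^sub>0_def)
    fix \<tau> :: real and a :: "complex ^ 'n" and m \<gamma> :: real and V
    assume \<tau>: "0 < \<tau>" "\<tau> < \<tau>\<^sub>0" and a: "a $ i = 0" and m: "c \<le> m" and \<gamma>: "0 \<le> \<gamma>"
      and mC: "m + 2 * \<gamma> * (norm a)\<^sup>2 \<le> C"
      and Vge: "\<And>h. h $ i = 0 \<Longrightarrow> V h < 1 \<Longrightarrow> c * (norm h)\<^sup>2 \<le> V h"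
      and Vjet: "\<And>h. h $ i = 0 \<Longrightarrow> norm h \<le> r\<^sub>0 \<Longrightarrow>
         \<bar>V h - m * (norm h)\<^sup>2 - 2 * \<gamma> * (Re (hin h a))\<^sup>2\<bar> \<le> c * \<epsilon> / 32 * (norm h)\<^sup>2"
    have m0: "m > 0" using c m by simp
    define D where "D = model_dom i V"
    define H where "H h = m * (norm h)\<^sup>2 + \<gamma> * (cmod (hin h a))\<^sup>2" for h
    have H0: "H h \<ge> 0" for h using m0 \<gamma> by (simp add: H_def)
    have Re2: "2 * (Re z)\<^sup>2 = (cmod z)\<^sup>2 + Re (z\<^sup>2)" for z
      unfolding cmod_power2 by (simp add: power2_eq_square)
    have Vjet': "\<bar>V h - (H h + \<gamma> * Re ((hin h a)\<^sup>2))\<bar> \<le> \<eta> * (norm h)\<^sup>2" if "h $ i = 0" "norm h \<le> r\<^sub>0" for h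
    proof -
      have "m * (norm h)\<^sup>2 + 2 * \<gamma> * (Re (hin h a))\<^sup>2 = m * (norm h)\<^sup>2 + \<gamma> * (2 * (Re (hin h a))\<^sup>2)"
        by simp
      also have "\<dots> = H h + \<gamma> * Re ((hin h a)\<^sup>2)"
        unfolding Re2 by (simp add: H_def algebra_simps)
      finally show ?thesis using Vjet[OF that] unfolding \<eta>_def by (simp add: algebra_simps)
    qed
    obtain d e where de: "\<And>h. stretch e a (stretch d a h) = h" "\<And>h. stretch d a (stretch e a h) = h"
      "\<And>h. (norm (stretch d a h))\<^sup>2 = (norm h)\<^sup>2 + \<gamma> / m * (cmod (hin h a))\<^sup>2"
    proof -
      have "\<gamma> / m \<ge> 0" using m0 \<gamma> by simp
      then show thesis
      proof (rule stretch_exists[of _ a])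
        fix d e
        assume *: "\<And>h. stretch e a (stretch d a h) = h" "\<And>h. stretch d a (stretch e a h) = h"
          "\<And>h. (norm (stretch d a h))\<^sup>2 = (norm h)\<^sup>2 + \<gamma> / m * (cmod (hin h a))\<^sup>2"
        show thesis by (rule that[of e d, OF *])
      qed
    qed
    have mde: "m * (norm (stretch d a h))\<^sup>2 = H h" for h
      unfolding de(3) H_def distrib_left using m0 by simp

    \<comment> \<open>The damped shear and the Cayley transform\<close>
    define \<sigma> where "\<sigma> W = (1 + W / of_real r) powr (- of_real (\<mu> / 2))" for W :: complex
    define \<psi> where "\<psi> W = (1 + W / of_real r) powr (- of_real \<mu>)" for W :: complex
    have \<sigma>2: "(\<sigma> W)\<^sup>2 = \<psi> W" for W
    proof -
      have *: "- complex_of_real (\<mu> / 2) + - complex_of_real (\<mu> / 2) = - of_real \<mu>"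
        by (simp add: field_simps)
      show ?thesis
        unfolding \<sigma>_def \<psi>_def power2_eq_square powr_add[symmetric] * ..
    qed
    define q where "q = sqrt (2 * \<tau> * \<beta> * m)"
    have q: "q > 0" "q\<^sup>2 = 2 * \<tau> * \<beta> * m" using \<tau> \<beta> m0 by (auto simp: q_def)
    define h1 where "h1 y = \<sigma> (y $ i) *s prj i y" for y
    define W1 where "W1 y = y $ i - of_real (\<gamma> / 2) * (hin (h1 y) a)\<^sup>2" for y
    \<comment> \<open>After the shear this is the Cayley transform of 2 Re W > \<beta> H(h) onto the
      ball with (\<tau>, 0) going to 0. It rests on |W - \<tau>|^2 + 4 \<tau> Re W = |W + \<tau>|^2
      and on the choice of q.\<close>
    define G where "G y = axis i ((W1 y - of_real \<tau>) / (W1 y + of_real \<tau>))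
        + (of_real q / (W1 y + of_real \<tau>)) *s stretch d a (h1 y)" for y
    have D: "y $ i \<noteq> 0" "Re (y $ i) > 0" "V (prj i y) < 2 * Re (y $ i)" "c * (norm (prj i y))\<^sup>2 < 2 * Re (y $ i)"
      if "y \<in> D" for y
    proof -
      have 1: "(cmod (y $ i))\<^sup>2 + V (prj i y) < 2 * Re (y $ i)"
        using that by (simp add: D_def model_dom_def)
      \<comment> \<open>Points of the model satisfy V(h) < 2 Re W - |W|^2 \<le> 1, which is why a
        lower bound for V is only demanded where V < 1.\<close>
      have "0 \<le> (cmod (1 - y $ i))\<^sup>2" by simp
      also have "\<dots> = 1 - 2 * Re (y $ i) + (cmod (y $ i))\<^sup>2"
        unfolding cmod_power2 by (simp add: power2_eq_square algebra_simps)
      finally have "V (prj i y) < 1" using 1 by linarith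
      then have 2: "c * (norm (prj i y))\<^sup>2 \<le> V (prj i y)"
        by (intro Vge) simp_all
      moreover have 3: "c * (norm (prj i y))\<^sup>2 \<ge> 0" using c by simp
      ultimately show "Re (y $ i) > 0" "V (prj i y) < 2 * Re (y $ i)" "c * (norm (prj i y))\<^sup>2 < 2 * Re (y $ i)"
        using 1 zero_le_power2[of "cmod (y $ i)"] by linarith+
      then show "y $ i \<noteq> 0" by auto
    qed
    have \<sigma>nz: "\<sigma> W \<noteq> 0" if "Re W > - r" for W
    proof -
      have "Re (1 + W / of_real r) > 0" using that r by (simp add: field_simps)
      then have "1 + W / of_real r \<noteq> 0" by (metis less_irrefl zero_complex.sel(1))
      then show ?thesis by (simp add: \<sigma>_def powr_def)
    qed
    have nh1: "(norm (h1 y))\<^sup>2 = cmod (\<psi> (y $ i)) * (norm (prj i y))\<^sup>2" for y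
      unfolding h1_def by (simp add: power_mult_distrib \<sigma>2[symmetric] norm_power)
    have g1: "(hin (h1 y) a)\<^sup>2 = \<psi> (y $ i) * (hin (prj i y) a)\<^sup>2" for y
      unfolding h1_def by (simp add: power_mult_distrib \<sigma>2)
    have Hh1: "H (h1 y) = cmod (\<psi> (y $ i)) * H (prj i y)" for y
    proof -
      have "(cmod (hin (h1 y) a))\<^sup>2 = cmod ((hin (h1 y) a)\<^sup>2)" by (simp add: norm_power)
      then show ?thesis unfolding H_def nh1 g1 by (simp add: norm_mult norm_power algebra_simps)
    qed

    \<comment> \<open>Containment of the sheared model in the Siegel domain\<close>
    have siegel: "\<beta> * H (h1 y) < 2 * Re (W1 y)" if y: "y \<in> D" for y
    proof -
      let ?W = "y $ i" and ?h = "prj i y"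
      let ?g = "hin ?h a" and ?\<psi> = "\<psi> (y $ i)"
      note Dy = D[OF y]
      have Ru: "Re (?W / of_real r) \<ge> 0" using Dy r by simp
      have \<psi>1: "cmod ?\<psi> \<le> 1" "cmod (1 - ?\<psi>) \<le> 1 - cmod ?\<psi> + cmod ?\<psi> * (2 * \<mu>)"
        "cmod ?\<psi> = cmod (1 + ?W / of_real r) powr (- \<mu>)"
        unfolding \<psi>_def using powr_right_halfplane[OF Ru \<mu>] by auto
      have W1: "2 * Re (W1 y) = 2 * Re ?W - \<gamma> * Re (?\<psi> * ?g\<^sup>2)"
        unfolding W1_def g1 by (simp flip: of_real_mult)
      show ?thesis
      proof (cases "cmod ?W < r\<^sub>1")
        case True
        \<comment> \<open>Near the boundary point the jet is available and the shear leaves \<gamma>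
          Re ((1 - \<psi>) g^2). Since |1 - \<psi>| \<le> 1 - \<beta> |\<psi>|, adding \<gamma>
          |g|^2 keeps at least \<beta> |\<psi>| \<gamma> |g|^2, which is the part of \<beta> H(h1)
          in g.\<close>
        have "c * (norm ?h)\<^sup>2 \<le> 2 * cmod ?W"
          using Dy(4) complex_Re_le_cmod[of ?W] by linarith
        also have "\<dots> \<le> c * r\<^sub>0\<^sup>2" using True by (simp add: r\<^sub>1_def)
        finally have "norm ?h \<le> r\<^sub>0"
          using c r0 by (auto intro: power2_le_imp_le)
        then have "H ?h + \<gamma> * Re (?g\<^sup>2) - \<eta> * (norm ?h)\<^sup>2 \<le> V ?h"
          using Vjet'[of ?h] by simp
        then have "H ?h + \<gamma> * Re (?g\<^sup>2) - \<eta> * (norm ?h)\<^sup>2 - \<gamma> * Re (?\<psi> * ?g\<^sup>2) < 2 * Re (W1 y)"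
          unfolding W1 using Dy(3) by linarith
        moreover have "\<gamma> * Re (?g\<^sup>2) - \<gamma> * Re (?\<psi> * ?g\<^sup>2) = \<gamma> * Re ((1 - ?\<psi>) * ?g\<^sup>2)"
          by (simp add: algebra_simps)
        moreover have "\<gamma> * Re ((1 - ?\<psi>) * ?g\<^sup>2) \<ge> \<gamma> * (- (cmod (1 - ?\<psi>) * (cmod ?g)\<^sup>2))"
          using abs_Re_le_cmod[of "(1 - ?\<psi>) * ?g\<^sup>2"] \<gamma>
          by (intro mult_left_mono) (auto simp: norm_mult norm_power)
        moreover have "\<gamma> * (cmod ?g)\<^sup>2 * cmod (1 - ?\<psi>) \<le> \<gamma> * (cmod ?g)\<^sup>2 * (1 - \<beta> * cmod ?\<psi>)"
        proof (rule mult_left_mono)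
          show "cmod (1 - ?\<psi>) \<le> 1 - \<beta> * cmod ?\<psi>"
            unfolding \<beta>(3) using \<psi>1(2) by (simp add: algebra_simps)
        qed (use \<gamma> in simp)
        ultimately have 1: "m * (norm ?h)\<^sup>2 - \<eta> * (norm ?h)\<^sup>2 + \<beta> * cmod ?\<psi> * (\<gamma> * (cmod ?g)\<^sup>2) < 2 * Re (W1 y)"
          unfolding H_def left_diff_distrib right_diff_distrib mult_1_right mult_minus_right
          by (simp only: mult_ac)
        have "\<eta> \<le> (1 - \<beta>) * m"
          using m m0 \<epsilon> by (simp add: \<eta>_def \<beta>_def field_simps)
        then have "\<beta> * m * (norm ?h)\<^sup>2 \<le> (m - \<eta>) * (norm ?h)\<^sup>2"
          by (intro mult_right_mono) (auto simp: algebra_simps)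
        moreover have "\<beta> * m * (norm ?h)\<^sup>2 * cmod ?\<psi> \<le> \<beta> * m * (norm ?h)\<^sup>2"
          using \<psi>1(1) \<beta> m0 by (intro mult_left_le) auto
        moreover have "\<beta> * H (h1 y) = \<beta> * m * (norm ?h)\<^sup>2 * cmod ?\<psi> + \<beta> * cmod ?\<psi> * (\<gamma> * (cmod ?g)\<^sup>2)"
          unfolding Hh1 by (simp add: H_def algebra_simps)
        moreover have "(m - \<eta>) * (norm ?h)\<^sup>2 = m * (norm ?h)\<^sup>2 - \<eta> * (norm ?h)\<^sup>2"
          by (rule left_diff_distrib)
        ultimately show ?thesis using 1 by linarith
      next
        case False
        \<comment> \<open>Far away only V \<ge> c |h|^2 is known. H(h1) and the shear term, with g
          entering twice, add up to at most |\<psi>| C |h|^2 \<le> c |h|^2.\<close>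
        have "(c / C) powr (- 1 / \<mu>) \<le> cmod ?W / r"
          using False r1 r c C by (simp add: r_def field_simps powr_minus)
        also have "\<dots> = cmod (?W / of_real r)" using r by (simp add: norm_divide)
        also have "\<dots> \<le> cmod (1 + ?W / of_real r)"
          using Ru by (auto simp: cmod_def intro!: power_mono)
        finally have "cmod ?\<psi> \<le> ((c / C) powr (- 1 / \<mu>)) powr (- \<mu>)"
          unfolding \<psi>1(3) using \<mu> c C by (intro powr_mono2') auto
        also have "\<dots> = c / C" using \<mu> c C by (simp add: powr_powr)
        finally have \<psi>c: "cmod ?\<psi> * C \<le> c" using C by (simp add: field_simps)
        have "(cmod ?g)\<^sup>2 \<le> (norm ?h * norm a)\<^sup>2" by (intro power_mono norm_hin_le) auto
        then have "\<gamma> * (cmod ?g)\<^sup>2 \<le> \<gamma> * ((norm a)\<^sup>2 * (norm ?h)\<^sup>2)"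
          using \<gamma> by (intro mult_left_mono) (auto simp: power_mult_distrib mult_ac)
        then have "m * (norm ?h)\<^sup>2 + 2 * (\<gamma> * (cmod ?g)\<^sup>2) \<le> (m + 2 * \<gamma> * (norm a)\<^sup>2) * (norm ?h)\<^sup>2"
          by (simp add: algebra_simps)
        also have "\<dots> \<le> C * (norm ?h)\<^sup>2" using mC by (intro mult_right_mono) auto
        finally have "cmod ?\<psi> * (m * (norm ?h)\<^sup>2 + 2 * (\<gamma> * (cmod ?g)\<^sup>2)) \<le> cmod ?\<psi> * (C * (norm ?h)\<^sup>2)"
          by (intro mult_left_mono) auto
        also have "\<dots> \<le> c * (norm ?h)\<^sup>2" using \<psi>c by (simp add: mult.assoc[symmetric] mult_right_mono)
        also have "\<dots> < 2 * Re ?W" by (rule Dy(4))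
        finally have 1: "cmod ?\<psi> * (m * (norm ?h)\<^sup>2 + 2 * (\<gamma> * (cmod ?g)\<^sup>2)) < 2 * Re ?W" .
        have "\<gamma> * Re (?\<psi> * ?g\<^sup>2) \<le> \<gamma> * (cmod ?\<psi> * (cmod ?g)\<^sup>2)"
          using complex_Re_le_cmod[of "?\<psi> * ?g\<^sup>2"] \<gamma>
          by (intro mult_left_mono) (auto simp: norm_mult norm_power)
        then have "cmod ?\<psi> * H ?h < 2 * Re (W1 y)"
          unfolding W1 H_def using 1 by (simp add: algebra_simps)
        moreover have "\<beta> * (cmod ?\<psi> * H ?h) \<le> cmod ?\<psi> * H ?h"
          using \<beta> H0 by (intro mult_left_le_one_le) auto
        ultimately show ?thesis unfolding Hh1 by simp
      qed
    qed
    have ReW1: "Re (W1 y) > 0" if "y \<in> D" for y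
    proof -
      have "0 \<le> \<beta> * H (h1 y)" using H0[of "h1 y"] \<beta>(1) by (intro mult_nonneg_nonneg) auto
      then show ?thesis using siegel[OF that] by linarith
    qed
    have W1nz: "W1 y + of_real \<tau> \<noteq> 0" if "y \<in> D" for y
      using ReW1[OF that] \<tau> by (auto simp: complex_eq_iff)
    have Gi: "G y $ i = (W1 y - of_real \<tau>) / (W1 y + of_real \<tau>)"
      "prj i (G y) = (of_real q / (W1 y + of_real \<tau>)) *s stretch d a (h1 y)" for y
    proof -
      have *: "((of_real q / (W1 y + of_real \<tau>)) *s stretch d a (h1 y)) $ i = 0"
        using a by (simp add: stretch_nth h1_def)
      show "prj i (G y) = (of_real q / (W1 y + of_real \<tau>)) *s stretch d a (h1 y)"
        unfolding G_def prj_add prj_axis prj_id[OF *] by simp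
      show "G y $ i = (W1 y - of_real \<tau>) / (W1 y + of_real \<tau>)"
        unfolding G_def using * by (simp add: axis_def)
    qed
    have "ball_embedding D G"
      unfolding ball_embedding_def
    proof (intro conjI)
      show "holomorphic_map_on G D"
        unfolding holomorphic_map_on_iff
      proof
        fix y assume y: "y \<in> D"
        have "1 + y $ i / of_real r \<notin> \<real>\<^sub>\<le>\<^sub>0"
        proof -
          have "Re (1 + y $ i / of_real r) > 0" using D(2)[OF y] r by (simp add: add_pos_pos)
          then show ?thesis by (auto simp: complex_nonpos_Reals_iff)
        qed
        then have h1: "vdiff h1 y"
          unfolding h1_def \<sigma>_def using r
          by (intro vdiff_cscale cdiff_powr cdiff_add cdiff_const cdiff_divide cdiff_nth vdiff_prj vdiff_id) auto
        then have W1: "cdiff W1 y"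
          unfolding W1_def by (intro cdiff_diff cdiff_nth cdiff_mult cdiff_const cdiff_power2 cdiff_hin)
        show "vdiff G y"
          unfolding G_def stretch_def
          by (intro vdiff_add vdiff_axis vdiff_cscale cdiff_divide cdiff_diff cdiff_add cdiff_const
              cdiff_mult cdiff_hin vdiff_const h1 W1 W1nz[OF y])
      qed
      show "inj_on G D"
      proof (rule inj_onI)
        fix y y' assume y: "y \<in> D" "y' \<in> D" and eq: "G y = G y'"
        have inj: "w = w'" if "(w - t) / (w + t) = (w' - t) / (w' + t)" "w + t \<noteq> 0" "w' + t \<noteq> 0" "t \<noteq> 0"
          for w w' t :: complex
        proof -
          have "(w - t) * (w' + t) = (w' - t) * (w + t)"
            using that by (simp add: frac_eq_eq)
          then have "2 * t * (w - w') = 0" by (simp add: algebra_simps)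
          then show ?thesis using that by simp
        qed
        have W: "W1 y = W1 y'"
        proof (rule inj[OF _ W1nz[OF y(1)] W1nz[OF y(2)]])
          show "(W1 y - of_real \<tau>) / (W1 y + of_real \<tau>) = (W1 y' - of_real \<tau>) / (W1 y' + of_real \<tau>)"
            unfolding Gi(1)[symmetric] eq ..
        qed (use \<tau> in simp)
        have k: "of_real q / (W1 y + of_real \<tau>) \<noteq> 0"
          using q W1nz[OF y(1)] by simp
        have "(of_real q / (W1 y + of_real \<tau>)) *s stretch d a (h1 y) = (of_real q / (W1 y + of_real \<tau>)) *s stretch d a (h1 y')"
          using eq Gi(2)[of y] Gi(2)[of y'] W by metis
        then have "stretch d a (h1 y) = stretch d a (h1 y')"
          unfolding vector_mul_lcancel using k by argo
        then have h: "h1 y = h1 y'" by (metis de(1))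
        \<comment> \<open>The shear is undone in triangular order: h1 determines the correction in
          W1, hence W, hence \<sigma>(W) and finally h.\<close>
        then have yi: "y $ i = y' $ i" using W unfolding W1_def h by simp
        have "\<sigma> (y $ i) \<noteq> 0" using D(2)[OF y(1)] r by (intro \<sigma>nz) auto
        then have "prj i y = prj i y'" using h unfolding h1_def yi[symmetric] vector_mul_lcancel by argo
        then show "y = y'" by (rule prj_eqI[OF yi])
      qed
      show "G ` D \<subseteq> ball 0 1"
      proof
        fix x assume "x \<in> G ` D"
        then obtain y where y: "y \<in> D" "x = G y" by blast
        have "(norm (G y))\<^sup>2 = ((cmod (W1 y - of_real \<tau>))\<^sup>2 + q\<^sup>2 * (norm (stretch d a (h1 y)))\<^sup>2) / (cmod (W1 y + of_real \<tau>))\<^sup>2"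
          unfolding norm_split[of "G y" i] Gi using q
          by (simp add: norm_divide power_divide power_mult_distrib add_divide_distrib)
        also have "q\<^sup>2 * (norm (stretch d a (h1 y)))\<^sup>2 = 2 * \<tau> * (\<beta> * H (h1 y))"
          unfolding q mde[symmetric] by simp
        also have "\<dots> < 2 * \<tau> * (2 * Re (W1 y))"
          using siegel[OF y(1)] \<tau> by (intro mult_strict_left_mono) auto
        also have "(cmod (W1 y - of_real \<tau>))\<^sup>2 + \<dots> = (cmod (W1 y + of_real \<tau>))\<^sup>2"
          unfolding cmod_power2 by (simp add: power2_eq_square algebra_simps)
        finally have "(norm (G y))\<^sup>2 < 1"
          using W1nz[OF y(1)] by (simp add: divide_strict_right_mono)
        then show "x \<in> ball 0 1" using y by (simp add: abs_square_less_1)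
      qed
    qed
    moreover have "G (axis i (of_real \<tau>)) = 0"
    proof -
      have h0: "h1 (axis i (of_real \<tau>)) = 0" by (simp add: h1_def)
      have ai: "axis i (of_real \<tau> :: complex) $ i = of_real \<tau>" by (simp add: axis_def)
      show ?thesis unfolding G_def W1_def h0 ai by (simp add: axis_def vec_eq_iff)
    qed

    \<comment> \<open>Covering the ball of radius 1 - \<epsilon>\<close>
    moreover have "ball 0 (1 - \<epsilon>) \<subseteq> G ` D"
    proof
      fix x :: "complex ^ 'n" assume "x \<in> ball 0 (1 - \<epsilon>)"
      then have nx: "norm x < 1 - \<epsilon>" by simp
      define \<omega> where "\<omega> = x $ i"
      \<comment> \<open>The common scale of the preimage: |w| and H(h) are at most 4 X, and the
        slack 2 Re w - \<beta> H(h) = 2 X (1 - |x|^2) is at least 2 \<epsilon> X. All errors have to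
        stay below this slack.\<close>
      define X where "X = \<tau> / (cmod (1 - \<omega>))\<^sup>2"
      have "(norm x)\<^sup>2 \<le> (1 - \<epsilon>)\<^sup>2"
        using nx by (intro power_mono) auto
      also have "\<dots> \<le> 1 - \<epsilon>"
        using \<epsilon> by (simp add: power2_eq_square mult_left_le_one_le)
      finally have nx2: "\<epsilon> \<le> 1 - (norm x)\<^sup>2" by simp
      have \<omega>: "cmod \<omega> < 1 - \<epsilon>"
        using nx Finite_Cartesian_Product.norm_nth_le[of x i] by (simp add: \<omega>_def)
      have \<kappa>: "cmod (1 - \<omega>) \<ge> \<epsilon>" "cmod (1 - \<omega>) \<le> 2" "cmod (1 + \<omega>) \<le> 2"
        using norm_triangle_ineq2[of 1 \<omega>] norm_triangle_ineq4[of 1 \<omega>] norm_triangle_ineq[of 1 \<omega>] \<omega> \<epsilon> by auto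
      have \<omega>1: "1 - \<omega> \<noteq> 0" using \<kappa> \<epsilon> by auto
      have X0: "X > 0" using \<tau> \<omega>1 by (simp add: X_def)
      have "X \<le> \<tau> / \<epsilon>\<^sup>2"
        unfolding X_def using \<tau> \<kappa> \<epsilon> by (intro divide_left_mono power_mono mult_pos_pos) auto
      also have "\<dots> < \<tau>\<^sub>0 / \<epsilon>\<^sup>2" using \<tau> \<epsilon> by (simp add: divide_strict_right_mono)
      also have "\<dots> = min (min (\<delta> * r / 6) (r / 6)) (min (\<epsilon> / 144) (c * r\<^sub>0\<^sup>2 / 8))"
        using \<epsilon> by (simp add: \<tau>\<^sub>0_def)
      finally have X: "6 * X < \<delta> * r" "6 * X < r" "144 * X < \<epsilon>" "8 * X < c * r\<^sub>0\<^sup>2"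
        by auto
      define w where "w = of_real \<tau> * (1 + \<omega>) / (1 - \<omega>)"
      have wp: "w + of_real \<tau> = 2 * of_real \<tau> / (1 - \<omega>)" and wm: "w - of_real \<tau> = 2 * of_real \<tau> * \<omega> / (1 - \<omega>)"
        unfolding w_def using \<omega>1 by (simp_all add: field_simps)
      have wnz: "w + of_real \<tau> \<noteq> 0" unfolding wp using \<tau> \<omega>1 by simp
      have cw: "cmod w \<le> 4 * X"
      proof -
        have "cmod w = \<tau> * cmod (1 + \<omega>) / cmod (1 - \<omega>)"
          unfolding w_def using \<tau> by (simp add: norm_mult norm_divide)
        also have "\<dots> = X * (cmod (1 + \<omega>) * cmod (1 - \<omega>))"
          unfolding X_def using \<omega>1 by (simp add: power2_eq_square)
        also have "\<dots> \<le> X * (2 * 2)"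
          using \<kappa> X0 by (intro mult_left_mono mult_mono) auto
        finally show ?thesis by simp
      qed
      have Rw: "2 * Re w = 2 * X * (1 - (cmod \<omega>)\<^sup>2)"
      proof -
        have "w = of_real \<tau> * ((1 + \<omega>) * cnj (1 - \<omega>)) / of_real ((cmod (1 - \<omega>))\<^sup>2)"
        proof -
          have "p / u = p * cnj u / (u * cnj u)" if "u \<noteq> 0" for p u :: complex
            using that by simp
          from this[OF \<omega>1, of "of_real \<tau> * (1 + \<omega>)"] show ?thesis
            unfolding w_def complex_norm_square mult.assoc .
        qed
        then have "Re w = \<tau> * Re ((1 + \<omega>) * cnj (1 - \<omega>)) / (cmod (1 - \<omega>))\<^sup>2"
          by (simp flip: of_real_power)
        also have "Re ((1 + \<omega>) * cnj (1 - \<omega>)) = 1 - (cmod \<omega>)\<^sup>2"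
          unfolding cmod_power2 by (simp add: power2_eq_square algebra_simps)
        finally show ?thesis by (simp add: X_def)
      qed
      define k where "k = (w + of_real \<tau>) / of_real q"
      have knz: "k \<noteq> 0" using wnz q by (simp add: k_def)
      define h where "h = stretch e a (k *s prj i x)"
      define g where "g = hin h a"
      have hi: "h $ i = 0" unfolding h_def using a by (simp add: stretch_nth)
      have dh: "stretch d a h = k *s prj i x" unfolding h_def by (rule de(2))
      have Hh: "\<beta> * H h = 2 * X * (norm (prj i x))\<^sup>2"
      proof -
        have "\<beta> * H h = \<beta> * m * (cmod k)\<^sup>2 * (norm (prj i x))\<^sup>2"
          unfolding mde[symmetric] dh by (simp add: power_mult_distrib)
        also have "(cmod k)\<^sup>2 = 4 * \<tau>\<^sup>2 / (cmod (1 - \<omega>))\<^sup>2 / (2 * \<tau> * \<beta> * m)"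
          unfolding k_def wp using q \<tau> by (simp add: norm_divide norm_mult power_divide power_mult_distrib)
        also have "\<beta> * m * \<dots> = 2 * X"
          unfolding X_def using \<tau> \<beta> m0 \<omega>1 by (simp add: field_simps power2_eq_square)
        finally show ?thesis .
      qed
      have nx3: "(norm x)\<^sup>2 = (cmod \<omega>)\<^sup>2 + (norm (prj i x))\<^sup>2"
        unfolding \<omega>_def by (rule norm_split)
      have HX: "H h \<le> 4 * X"
      proof -
        have "(norm (prj i x))\<^sup>2 \<le> 1" using nx3 nx2 \<epsilon> zero_le_power2[of "cmod \<omega>"] by linarith
        then have "\<beta> * H h \<le> 2 * X * 1" unfolding Hh using X0 by (intro mult_left_mono) auto
        moreover have "1/2 * H h \<le> \<beta> * H h" using \<beta> H0 by (intro mult_right_mono) auto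
        ultimately show ?thesis by linarith
      qed
      have E: "2 * Re w - \<beta> * H h \<ge> 2 * X * \<epsilon>"
      proof -
        have "2 * Re w - \<beta> * H h = 2 * X * (1 - (norm x)\<^sup>2)"
          unfolding Rw Hh nx3 by (simp add: algebra_simps)
        then show ?thesis using nx2 X0 by (simp add: mult_left_mono)
      qed
      have \<gamma>g: "\<gamma> * (cmod g)\<^sup>2 \<le> H h" and mh: "m * (norm h)\<^sup>2 \<le> H h"
        using m0 \<gamma> by (auto simp: H_def g_def)
      \<comment> \<open>The inverse of the shear is explicit because W is determined by w and g
        before \<sigma> has to be evaluated at W.\<close>
      define W where "W = w + of_real (\<gamma> / 2) * g\<^sup>2"
      have cW: "cmod W \<le> 6 * X"
      proof -
        have "cmod W \<le> cmod w + \<gamma> / 2 * (cmod g)\<^sup>2"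
          unfolding W_def using norm_triangle_ineq[of w "of_real (\<gamma> / 2) * g\<^sup>2"] \<gamma>
          by (simp add: norm_mult norm_power norm_divide)
        then show ?thesis using cw \<gamma>g HX by simp
      qed
      have W_r: "Re W > - r" using abs_Re_le_cmod[of W] cW X by linarith
      have s: "\<sigma> W \<noteq> 0" by (rule \<sigma>nz[OF W_r])
      define \<nu> where "\<nu> = (1 + W / of_real r) powr of_real \<mu>"
      have \<nu>1: "cmod (\<nu> - 1) < \<epsilon> / 32"
        unfolding \<nu>_def
      proof (rule \<delta>(2))
        show "cmod (W / of_real r) < \<delta>"
          using cW X(1) r by (simp add: norm_divide divide_less_eq)
      qed
      then have \<nu>2: "cmod \<nu> \<le> 1 + \<epsilon> / 32"
        using norm_triangle_ineq2[of \<nu> 1] by simp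
      have \<nu>s: "1 / (\<sigma> W)\<^sup>2 = \<nu>"
        unfolding \<sigma>2 \<psi>_def \<nu>_def by (simp add: powr_minus_divide)
      define h' where "h' = (1 / \<sigma> W) *s h"
      define y where "y = axis i W + h'"
      have h'i: "h' $ i = 0" using hi by (simp add: h'_def)
      have yi: "y $ i = W"
        unfolding y_def using h'i by (simp add: axis_def)
      have py: "prj i y = h'"
        unfolding y_def using h'i by (simp add: prj_add prj_id)
      have nh': "(norm h')\<^sup>2 = cmod \<nu> * (norm h)\<^sup>2"
        unfolding h'_def \<nu>s[symmetric] by (simp add: power_mult_distrib norm_divide norm_power power_divide)
      have gh': "(hin h' a)\<^sup>2 = \<nu> * g\<^sup>2"
        unfolding h'_def \<nu>s[symmetric] g_def by (simp add: power_divide)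
      have "cmod ((hin h' a)\<^sup>2) = cmod \<nu> * (cmod g)\<^sup>2" unfolding gh' by (simp add: norm_mult norm_power)
      then have Hh': "H h' = cmod \<nu> * H h"
        unfolding H_def nh' by (simp add: norm_power g_def algebra_simps)
      have ch: "c * (norm h)\<^sup>2 \<le> H h"
        using mh m mult_right_mono[OF m, of "(norm h)\<^sup>2"] by simp
      have \<nu>3: "cmod \<nu> \<le> 2" using \<nu>2 \<epsilon> by linarith
      have ch': "c * (norm h')\<^sup>2 \<le> 2 * H h"
      proof -
        have "c * (norm h')\<^sup>2 = cmod \<nu> * (c * (norm h)\<^sup>2)" unfolding nh' by simp
        also have "\<dots> \<le> 2 * H h" using \<nu>3 ch c by (intro mult_mono) auto
        finally show ?thesis .
      qed
      then have "c * (norm h')\<^sup>2 \<le> c * r\<^sub>0\<^sup>2" using HX X(4) by linarith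
      then have "norm h' \<le> r\<^sub>0" using c r0 by (auto intro: power2_le_imp_le)
      then have "V h' \<le> H h' + \<gamma> * Re ((hin h' a)\<^sup>2) + \<eta> * (norm h')\<^sup>2"
        using Vjet'[OF h'i] by (simp add: abs_le_iff)
      moreover have "\<eta> * (norm h')\<^sup>2 \<le> \<epsilon> / 16 * H h"
      proof -
        have "\<eta> * (norm h')\<^sup>2 = \<epsilon> / 32 * (c * (norm h')\<^sup>2)" by (simp add: \<eta>_def)
        also have "\<dots> \<le> \<epsilon> / 32 * (2 * H h)" using ch' \<epsilon> by (intro mult_left_mono) auto
        finally show ?thesis by simp
      qed
      moreover have "H h' \<le> (1 + \<epsilon> / 32) * H h"
        unfolding Hh' using \<nu>2 H0 by (intro mult_right_mono) auto
      moreover have "\<gamma> * Re ((hin h' a)\<^sup>2) \<le> \<gamma> * Re (g\<^sup>2) + \<epsilon> / 32 * H h"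
      proof -
        have "Re (\<nu> * g\<^sup>2) - Re (g\<^sup>2) = Re ((\<nu> - 1) * g\<^sup>2)" by (simp add: algebra_simps)
        also have "\<dots> \<le> cmod (\<nu> - 1) * (cmod g)\<^sup>2"
          using complex_Re_le_cmod[of "(\<nu> - 1) * g\<^sup>2"] by (simp add: norm_mult norm_power)
        also have "\<dots> \<le> \<epsilon> / 32 * (cmod g)\<^sup>2" using \<nu>1 by (intro mult_right_mono) auto
        finally have "\<gamma> * (Re (\<nu> * g\<^sup>2) - Re (g\<^sup>2)) \<le> \<gamma> * (\<epsilon> / 32 * (cmod g)\<^sup>2)"
          using \<gamma> by (intro mult_left_mono)
        also have "\<dots> = \<epsilon> / 32 * (\<gamma> * (cmod g)\<^sup>2)" by simp
        also have "\<dots> \<le> \<epsilon> / 32 * H h" using \<gamma>g \<epsilon> by (intro mult_left_mono) auto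
        finally show ?thesis unfolding gh' by (simp add: algebra_simps)
      qed
      moreover have "2 * Re W = 2 * Re w + \<gamma> * Re (g\<^sup>2)"
        unfolding W_def by (simp flip: of_real_mult)
      moreover have "(cmod W)\<^sup>2 \<le> \<epsilon> / 4 * X"
      proof -
        have "(cmod W)\<^sup>2 \<le> (6 * X)\<^sup>2" using cW by (intro power_mono) auto
        also have "\<dots> = 36 * X * X" by (simp add: power2_eq_square)
        also have "\<dots> \<le> \<epsilon> / 4 * X" using X(3) X0 by (intro mult_right_mono) auto
        finally show ?thesis .
      qed
      moreover have "\<epsilon> * H h \<le> \<epsilon> * (4 * X)" using HX \<epsilon> by (intro mult_left_mono) auto
      moreover have "\<beta> * H h = H h - \<epsilon> / 16 * H h" by (simp add: \<beta>_def algebra_simps)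
      moreover have "\<epsilon> * X > 0" using \<epsilon> X0 by simp
      \<comment> \<open>The losses from \<beta>, \<nu> and the jet sum to (2 + 1 + 2 + 1) \<epsilon>
        / 32 times H(h), at most 3 \<epsilon> X / 4; |W|^2 adds at most \<epsilon> X / 4.\<close>
      ultimately have "(cmod W)\<^sup>2 + V h' < 2 * Re W"
        using E by (simp add: algebra_simps)
      then have yD: "y \<in> D" by (simp add: D_def model_dom_def yi py)
      have h1y: "h1 y = h" unfolding h1_def yi py h'_def using s by simp
      have W1y: "W1 y = w" unfolding W1_def h1y yi W_def g_def by simp
      have "G y = x"
      proof (rule prj_eqI[of _ i])
        show "G y $ i = x $ i"
          unfolding Gi W1y wp wm using \<tau> \<omega>1 by (simp add: \<omega>_def)
        show "prj i (G y) = prj i x"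
          unfolding Gi W1y h1y dh k_def using wnz q by simp
      qed
      then show "x \<in> G ` D" using yD by blast
    qed
    ultimately show "\<exists>G. ball_embedding (model_dom i V) G \<and> G (axis i (of_real \<tau>)) = 0
        \<and> ball 0 (1 - \<epsilon>) \<subseteq> G ` model_dom i V"
      unfolding D_def by blast
  qed
qed


section \<open>Points over strongly pseudoconvex boundary points\<close>

lemma exp_remainder_small:
  fixes \<epsilon> :: real
  assumes "\<epsilon> > 0"
  obtains \<delta> where "\<delta> > 0"
    "\<And>x. \<bar>x\<bar> < \<delta> \<Longrightarrow> \<bar>1 - exp x * (1 - x) - x\<^sup>2 / 2\<bar> \<le> \<epsilon> * x\<^sup>2"
    "\<And>x. \<bar>x\<bar> < \<delta> \<Longrightarrow> \<bar>exp x - 1\<bar> \<le> \<epsilon>"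
proof -
  have "((\<lambda>x::real. (1 - exp x * (1 - x) - x\<^sup>2 / 2) / x\<^sup>2) \<longlongrightarrow> 0) (at 0)"
    by real_asymp
  then have "eventually (\<lambda>x::real. dist ((1 - exp x * (1 - x) - x\<^sup>2 / 2) / x\<^sup>2) 0 < \<epsilon>) (at 0)"
    using assms by (rule tendstoD)
  moreover have "((\<lambda>x::real. exp x - 1) \<longlongrightarrow> 0) (at 0)"
    by real_asymp
  then have "eventually (\<lambda>x::real. dist (exp x - 1) 0 < \<epsilon>) (at 0)"
    using assms by (rule tendstoD)
  ultimately have "eventually (\<lambda>x::real. dist ((1 - exp x * (1 - x) - x\<^sup>2 / 2) / x\<^sup>2) 0 < \<epsilon> \<and> dist (exp x - 1) 0 < \<epsilon>) (at 0)"
    by (rule eventually_conj)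
  then obtain \<delta> where \<delta>: "\<delta> > 0"
    "\<And>x. x \<noteq> 0 \<Longrightarrow> \<bar>x\<bar> < \<delta> \<Longrightarrow> \<bar>(1 - exp x * (1 - x) - x\<^sup>2 / 2) / x\<^sup>2\<bar> < \<epsilon> \<and> \<bar>exp x - 1\<bar> < \<epsilon>"
    unfolding eventually_at by (auto simp: dist_real_def)
  show thesis
  proof (rule that[OF \<delta>(1)])
    fix x :: real assume x: "\<bar>x\<bar> < \<delta>"
    show "\<bar>1 - exp x * (1 - x) - x\<^sup>2 / 2\<bar> \<le> \<epsilon> * x\<^sup>2"
    proof (cases "x = 0")
      case False
      then have "\<bar>1 - exp x * (1 - x) - x\<^sup>2 / 2\<bar> / x\<^sup>2 < \<epsilon>"
        using \<delta>(2)[OF False x] by (simp add: abs_divide)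
      then show ?thesis using False by (simp add: divide_less_eq)
    qed simp
    show "\<bar>exp x - 1\<bar> \<le> \<epsilon>"
      using \<delta>(2)[OF _ x] assms by (cases "x = 0") auto
  qed
qed

text \<open>The zero-free factor exp (m g) rescales the disc fibres over h so that their radius is
  stationary at h = 0; this preserves injectivity and reduces the claim to
  \<open>model_embedding\<close>. The compact range of |z|^2 makes c, C and \<open>r\<^sub>0\<close>
  independent of P.\<close>

lemma embedding_middle:
  fixes \<epsilon> l :: real
  assumes \<epsilon>: "0 < \<epsilon>" "\<epsilon> < 1" and l: "l > 0"
  obtains t where "t > 0"
    "\<And>P :: complex ^ 'n. P \<in> flat_dom i \<Longrightarrow> depth i P < t \<Longrightarrow> l \<le> (norm (prj i P))\<^sup>2 \<Longrightarrow>
       (norm (prj i P))\<^sup>2 \<le> 3/2 \<Longrightarrow>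
       \<exists>f. ball_embedding (flat_dom i) f \<and> f P = 0 \<and> ball 0 (1 - \<epsilon>) \<subseteq> f ` flat_dom i"
proof -
  \<comment> \<open>Wherever V < 1 one has |h| \<le> 4 and |2 m Re g| \<le> 8, while m \<ge>
    \<open>kap l / 4\<close>. C bounds m + 2 \<gamma> |a|^2 by means of \<open>kap'\<close> \<le> 1
    / l and |a|^2 \<le> 3/2.\<close>
  define c where "c = kap l * exp (-8) / 4"
  have c: "c > 0" using kap_pos[OF l] by (simp add: c_def)
  define C where "C = 4 + 3 / l"
  have C: "C > 0" using l by (simp add: C_def add_pos_pos)
  define \<eta> where "\<eta> = c * \<epsilon> / 32"
  have \<eta>: "\<eta> > 0" using c \<epsilon> by (simp add: \<eta>_def)
  define K where "K = 1 / l"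
  have K: "K > 0" using l by (simp add: K_def)
  \<comment> \<open>55 + 13 K is the total of the error terms in \<open>Vjet\<close>: 4, 1 + 25 (K/2
    + 1), 25 and K/2.\<close>
  define e where "e = min 1 (\<eta> / (55 + 13 * K))"
  have e: "e > 0" "e \<le> 1" using \<eta> K by (auto simp: e_def)
  have e\<eta>: "e * (55 + 13 * K) \<le> \<eta>"
  proof -
    have "e \<le> \<eta> / (55 + 13 * K)" by (simp add: e_def)
    then show ?thesis using K by (simp add: field_simps)
  qed
  obtain \<delta> where \<delta>: "\<delta> > 0"
    "\<And>x. \<bar>x\<bar> < \<delta> \<Longrightarrow> \<bar>1 - exp x * (1 - x) - x\<^sup>2 / 2\<bar> \<le> e * x\<^sup>2"
    "\<And>x. \<bar>x\<bar> < \<delta> \<Longrightarrow> \<bar>exp x - 1\<bar> \<le> e"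
    using exp_remainder_small[OF e(1)] by blast
  obtain r where r: "r > 0"
    "\<And>s\<^sub>0 d. l \<le> s\<^sub>0 \<Longrightarrow> s\<^sub>0 \<le> 3/2 \<Longrightarrow> \<bar>d\<bar> \<le> r \<Longrightarrow> \<bar>gap s\<^sub>0 (s\<^sub>0 + d) - kap' s\<^sub>0 / 2 * d\<^sup>2\<bar> \<le> e * d\<^sup>2"
    using gap_taylor[OF l e(1)] by blast
  define r\<^sub>0 where "r\<^sub>0 = min (min 1 (\<delta> / 3)) (min (r / 5) (e / 9))"
  have r0: "r\<^sub>0 > 0" "r\<^sub>0 \<le> 1" "3 * r\<^sub>0 \<le> \<delta>" "5 * r\<^sub>0 \<le> r" "9 * r\<^sub>0 \<le> e"
    using \<delta> r e by (auto simp: r\<^sub>0_def)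
  obtain \<tau>\<^sub>0 where \<tau>0: "\<tau>\<^sub>0 > 0" and model:
    "\<And>\<tau> (a :: complex ^ 'n) m \<gamma> V. 0 < \<tau> \<Longrightarrow> \<tau> < \<tau>\<^sub>0 \<Longrightarrow> a $ i = 0 \<Longrightarrow> c \<le> m \<Longrightarrow> 0 \<le> \<gamma> \<Longrightarrow>
      m + 2 * \<gamma> * (norm a)\<^sup>2 \<le> C \<Longrightarrow>
      (\<And>h. h $ i = 0 \<Longrightarrow> V h < 1 \<Longrightarrow> c * (norm h)\<^sup>2 \<le> V h) \<Longrightarrow>
      (\<And>h. h $ i = 0 \<Longrightarrow> norm h \<le> r\<^sub>0 \<Longrightarrow>
         \<bar>V h - m * (norm h)\<^sup>2 - 2 * \<gamma> * (Re (hin h a))\<^sup>2\<bar> \<le> c * \<epsilon> / 32 * (norm h)\<^sup>2) \<Longrightarrow>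
      \<exists>G. ball_embedding (model_dom i V) G \<and> G (axis i (of_real \<tau>)) = 0 \<and> ball 0 (1 - \<epsilon>) \<subseteq> G ` model_dom i V"
    using model_embedding[OF \<epsilon> c C r0(1), of i] by blast
  show thesis
  proof (rule that[of "min 1 \<tau>\<^sub>0"])
    show "min 1 \<tau>\<^sub>0 > 0" using \<tau>0 by simp
    fix P :: "complex ^ 'n"
    assume P: "P \<in> flat_dom i" "depth i P < min 1 \<tau>\<^sub>0" "l \<le> (norm (prj i P))\<^sup>2" "(norm (prj i P))\<^sup>2 \<le> 3/2"
    define a where "a = prj i P"
    define s\<^sub>0 where "s\<^sub>0 = (norm a)\<^sup>2"
    have s0: "l \<le> s\<^sub>0" "s\<^sub>0 \<le> 3/2" "s\<^sub>0 > 0" using P l by (auto simp: s\<^sub>0_def a_def)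
    have na: "norm a \<le> 2"
      by (rule power2_le_imp_le) (use s0 in \<open>auto simp: s\<^sub>0_def\<close>)
    define \<beta> where "\<beta> = 4 - Tht s\<^sub>0"
    have \<beta>: "\<beta> \<ge> 5/2" "\<beta> \<le> 4"
      using Tht_mono[of s\<^sub>0 "3/2"] Tht_ge[of s\<^sub>0] Tht_ge_1[of "3/2"] s0 by (auto simp: \<beta>_def)
    \<comment> \<open>With x = 2 m Re g this m cancels the linear term: exp x (1 - x) = 1 - x^2 / 2
      + o(x^2), so V begins with m |h|^2 + x^2 / 2 + gap / \<beta>. As the gap is about
      \<open>kap' s\<^sub>0 / 2\<close> times (2 Re g)^2, the coefficient of 2 (Re g)^2 is the
      \<gamma> below.\<close>
    define m where "m = kap s\<^sub>0 / \<beta>"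
    have kl: "kap l \<le> kap s\<^sub>0" using monoD[OF mono_kap s0(1)] .
    have m4: "kap l / 4 \<le> m"
      unfolding m_def using kl \<beta> kap_nonneg[of l] by (intro frac_le) auto
    have m2: "m \<le> 1/2"
    proof -
      have "m \<le> 1 / (5/2)"
        unfolding m_def using kap_le_1[of s\<^sub>0] \<beta> by (intro frac_le) auto
      then show ?thesis by simp
    qed
    have m0: "m > 0" using m4 kap_pos[OF l] by simp
    define \<gamma> where "\<gamma> = m\<^sup>2 + kap' s\<^sub>0 / \<beta>"
    have \<gamma>0: "\<gamma> \<ge> 0" using kap'_nonneg[of s\<^sub>0] \<beta> by (simp add: \<gamma>_def)
    have kK: "kap' s\<^sub>0 \<le> K"
    proof -
      have "l * kap' s\<^sub>0 \<le> s\<^sub>0 * kap' s\<^sub>0" using s0 kap'_nonneg by (intro mult_right_mono) auto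
      also have "\<dots> \<le> 1" by (rule kap'_mult_le[OF s0(3)])
      finally show ?thesis using l by (simp add: K_def field_simps)
    qed
    have \<gamma>1: "\<gamma> \<le> 1 + K"
    proof -
      have "m\<^sup>2 \<le> 1" using m0 m2 by (intro power_le_one) auto
      moreover have "kap' s\<^sub>0 / \<beta> \<le> K / 1" using kK kap'_nonneg[of s\<^sub>0] \<beta> K by (intro frac_le) auto
      ultimately show ?thesis by (simp add: \<gamma>_def)
    qed
    define V where "V h = 1 - exp (2 * m * Re (hin h a)) * (4 - Tht ((norm (a + h))\<^sup>2)) / \<beta>" for h
    have nah: "(norm (a + h))\<^sup>2 = s\<^sub>0 + (2 * Re (hin h a) + (norm h)\<^sup>2)" for h
      unfolding norm_add_square s\<^sub>0_def using hin_sym[of a h] by simp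
    have V: "V h = 1 - exp (2 * m * Re (hin h a)) *
        (1 - 2 * m * Re (hin h a) - m * (norm h)\<^sup>2 - gap s\<^sub>0 (s\<^sub>0 + (2 * Re (hin h a) + (norm h)\<^sup>2)) / \<beta>)" for h
    proof -
      have "4 - Tht ((norm (a + h))\<^sup>2) = \<beta> - kap s\<^sub>0 * (2 * Re (hin h a) + (norm h)\<^sup>2)
          - gap s\<^sub>0 (s\<^sub>0 + (2 * Re (hin h a) + (norm h)\<^sup>2))"
        unfolding nah by (simp add: gap_def \<beta>_def)
      then have eq: "(4 - Tht ((norm (a + h))\<^sup>2)) / \<beta> = 1 - m * (2 * Re (hin h a) + (norm h)\<^sup>2)
          - gap s\<^sub>0 (s\<^sub>0 + (2 * Re (hin h a) + (norm h)\<^sup>2)) / \<beta>"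
        unfolding m_def using \<beta> by (simp add: diff_divide_distrib)
      have "V h = 1 - exp (2 * m * Re (hin h a)) * ((4 - Tht ((norm (a + h))\<^sup>2)) / \<beta>)"
        by (simp add: V_def)
      also have "(4 - Tht ((norm (a + h))\<^sup>2)) / \<beta> = 1 - 2 * m * Re (hin h a) - m * (norm h)\<^sup>2
          - gap s\<^sub>0 (s\<^sub>0 + (2 * Re (hin h a) + (norm h)\<^sup>2)) / \<beta>"
        unfolding eq by (simp add: distrib_left)
      finally show ?thesis .
    qed
    have A: "\<bar>Re (hin h a)\<bar> \<le> 2 * norm h" for h
    proof -
      have "\<bar>Re (hin h a)\<bar> \<le> norm h * norm a"
        using abs_Re_le_cmod[of "hin h a"] norm_hin_le[of h a] by linarith
      also have "\<dots> \<le> norm h * 2" using na by (intro mult_left_mono) auto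
      finally show ?thesis by simp
    qed
    have Vge: "c * (norm h)\<^sup>2 \<le> V h" if "V h < 1" for h
    proof -
      \<comment> \<open>V h < 1 means that the domain has a nonempty fibre over a + h, which
        confines h to a bounded set.\<close>
      have "exp (2 * m * Re (hin h a)) * (4 - Tht ((norm (a + h))\<^sup>2)) / \<beta> > 0"
        using that by (simp add: V_def)
      then have "4 - Tht ((norm (a + h))\<^sup>2) > 0"
        using \<beta> by (simp add: zero_less_divide_iff zero_less_mult_iff)
      then have "(norm (a + h))\<^sup>2 < 4"
        using Tht_ge[OF sq_gt_m1[of "norm (a + h)"]] by linarith
      then have "norm (a + h) < 2"
        by (intro power2_less_imp_less[of _ 2]) auto
      then have nh: "norm h \<le> 4"
        using na norm_triangle_ineq4[of "a + h" a] by simp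
      define x where "x = 2 * m * Re (hin h a)"
      have "\<bar>x\<bar> = 2 * m * \<bar>Re (hin h a)\<bar>" using m0 by (simp add: x_def abs_mult)
      also have "\<dots> \<le> 1 * \<bar>Re (hin h a)\<bar>" using m2 by (intro mult_right_mono) auto
      also have "\<dots> \<le> 8" using A[of h] nh by simp
      finally have x8: "x \<ge> -8" by simp
      have "gap s\<^sub>0 ((norm (a + h))\<^sup>2) \<ge> 0" using s0 sq_gt_m1 by (intro gap_nonneg) auto
      then have g: "gap s\<^sub>0 (s\<^sub>0 + (2 * Re (hin h a) + (norm h)\<^sup>2)) / \<beta> \<ge> 0"
        unfolding nah using \<beta> by simp
      \<comment> \<open>This inequality holds for every real x and the gap is nonnegative, so the
        quadratic lower bound is global and not just a jet estimate.\<close>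
      have "exp x * (1 - x) \<le> exp x * exp (- x)"
        using exp_ge_add_one_self[of "- x"] by (intro mult_left_mono) auto
      then have ex: "exp x * (1 - x) \<le> 1" by (simp add: exp_minus)
      have "c * (norm h)\<^sup>2 \<le> exp x * (m * (norm h)\<^sup>2)"
      proof -
        have "c \<le> exp x * m"
        proof -
          have "c = exp (-8) * (kap l / 4)" by (simp add: c_def)
          also have "\<dots> \<le> exp x * m"
            using x8 m4 kap_nonneg[of l] by (intro mult_mono) auto
          finally show ?thesis .
        qed
        from mult_right_mono[OF this, of "(norm h)\<^sup>2"] show ?thesis by (simp add: mult.assoc)
      qed
      also have "\<dots> \<le> 1 - exp x * (1 - x - m * (norm h)\<^sup>2)"
        using ex by (simp add: algebra_simps)
      also have "\<dots> \<le> V h"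
        unfolding V x_def[symmetric] using g by (intro diff_left_mono mult_left_mono) auto
      finally show ?thesis .
    qed
    have Vjet: "\<bar>V h - m * (norm h)\<^sup>2 - 2 * \<gamma> * (Re (hin h a))\<^sup>2\<bar> \<le> \<eta> * (norm h)\<^sup>2" if h: "norm h \<le> r\<^sub>0" for h
    proof -
      define n where "n = norm h"
      define k where "k = n\<^sup>2"
      define y where "y = Re (hin h a)"
      define x where "x = 2 * m * y"
      define d where "d = 2 * y + k"
      define g where "g = gap s\<^sub>0 (s\<^sub>0 + d)"
      have n: "0 \<le> n" "n \<le> r\<^sub>0" "n \<le> 1" using h r0 by (auto simp: n_def)
      have k: "0 \<le> k" "k \<le> n" using n by (auto simp: k_def power2_eq_square mult_left_le_one_le)
      have y: "\<bar>y\<bar> \<le> 2 * n" using A[of h] by (simp add: y_def n_def)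
      have x: "\<bar>x\<bar> \<le> 2 * n"
      proof -
        have "\<bar>x\<bar> = 2 * m * \<bar>y\<bar>" using m0 by (simp add: x_def abs_mult)
        also have "\<dots> \<le> 1 * \<bar>y\<bar>" using m2 by (intro mult_right_mono) auto
        finally show ?thesis using y by simp
      qed
      have "\<bar>x\<bar> < \<delta>"
      proof (cases "n = 0")
        case True then show ?thesis using x \<delta>(1) by simp
      next
        case False then show ?thesis using x n r0(3) by linarith
      qed
      note xs = \<delta>(2,3)[OF this]
      have x2: "x\<^sup>2 \<le> 4 * k"
      proof -
        have "x\<^sup>2 \<le> (2 * n)\<^sup>2" using x n by (intro abs_le_square_iff[THEN iffD1]) auto
        then show ?thesis by (simp add: k_def power_mult_distrib)
      qed
      have d: "\<bar>d\<bar> \<le> 5 * n" using y k n by (auto simp: d_def)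
      have d2: "d\<^sup>2 \<le> 25 * k"
      proof -
        have "d\<^sup>2 \<le> (5 * n)\<^sup>2" using d n by (intro abs_le_square_iff[THEN iffD1]) auto
        then show ?thesis by (simp add: k_def power_mult_distrib)
      qed
      have "\<bar>d\<bar> \<le> r" using d n r0(4) by linarith
      then have gT: "\<bar>g - kap' s\<^sub>0 / 2 * d\<^sup>2\<bar> \<le> e * d\<^sup>2"
        unfolding g_def using r(2) s0 by blast
      have ed2: "e * d\<^sup>2 \<le> e * (25 * k)" using d2 e by (intro mult_left_mono) auto
      have kd2: "kap' s\<^sub>0 / 2 * d\<^sup>2 \<le> K / 2 * (25 * k)"
        using kK d2 K by (intro mult_mono) auto
      have g_nn: "0 \<le> kap' s\<^sub>0 / 2 * d\<^sup>2" using kap'_nonneg by simp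
      have ek: "e * k \<le> k" "0 \<le> e * k" using e k by (auto simp: mult_left_le_one_le)
      have gabs: "\<bar>g\<bar> \<le> 25 * (K / 2 + 1) * k"
        using gT ed2 kd2 g_nn ek by (simp add: algebra_simps abs_le_iff)
      have div\<beta>: "\<bar>z / \<beta>\<bar> \<le> \<bar>z\<bar>" for z
      proof -
        have "\<bar>z\<bar> / \<beta> \<le> \<bar>z\<bar> / 1" using \<beta> by (intro divide_left_mono) auto
        then show ?thesis using \<beta> by (simp add: abs_divide)
      qed
      have tri: "\<bar>z\<bar> \<le> b1 + b2 + b3" if "z = z1 + z2 + z3" "\<bar>z1\<bar> \<le> b1" "\<bar>z2\<bar> \<le> b2" "\<bar>z3\<bar> \<le> b3"
        for z z1 z2 z3 b1 b2 b3 :: real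
        using that by linarith
      \<comment> \<open>The summands are the remainder of the exponential, a product of a small
        factor with a quadratic one, and the Taylor error of the gap including the replacement of d
        by 2 y.\<close>
      have "V h - m * (norm h)\<^sup>2 - 2 * \<gamma> * (Re (hin h a))\<^sup>2
          = (1 - exp x * (1 - x) - x\<^sup>2 / 2) + (exp x - 1) * (m * k + g / \<beta>) + (g - kap' s\<^sub>0 / 2 * (4 * y\<^sup>2)) / \<beta>"
        unfolding V y_def[symmetric] n_def[symmetric] k_def[symmetric] d_def[symmetric] g_def[symmetric] \<gamma>_def
          x_def[symmetric]
        by (simp add: x_def diff_divide_distrib algebra_simps power2_eq_square)
      moreover have "\<bar>1 - exp x * (1 - x) - x\<^sup>2 / 2\<bar> \<le> 4 * (e * k)"
        using xs(1) mult_left_mono[OF x2, of e] e by linarith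
      moreover have "\<bar>(exp x - 1) * (m * k + g / \<beta>)\<bar> \<le> e * ((1 + 25 * (K / 2 + 1)) * k)"
      proof -
        have "\<bar>m * k + g / \<beta>\<bar> \<le> \<bar>m * k\<bar> + \<bar>g / \<beta>\<bar>" by (rule abs_triangle_ineq)
        also have "\<dots> \<le> k + 25 * (K / 2 + 1) * k"
          using div\<beta>[of g] gabs m0 m2 k mult_left_le_one_le[of k m] by (simp add: abs_mult)
        finally have "\<bar>m * k + g / \<beta>\<bar> \<le> (1 + 25 * (K / 2 + 1)) * k" by (simp only: distrib_right mult_1)
        then show ?thesis unfolding abs_mult using xs(2) e by (intro mult_mono) auto
      qed
      moreover have "\<bar>(g - kap' s\<^sub>0 / 2 * (4 * y\<^sup>2)) / \<beta>\<bar> \<le> e * (25 * k) + K / 2 * (e * k)"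
      proof -
        have "d\<^sup>2 - 4 * y\<^sup>2 = k * (4 * y + k)" by (simp add: d_def power2_eq_square algebra_simps)
        then have "\<bar>d\<^sup>2 - 4 * y\<^sup>2\<bar> = k * \<bar>4 * y + k\<bar>" using k by (simp add: abs_mult)
        also have "\<dots> \<le> k * e" using y k n r0(5) by (intro mult_left_mono) auto
        finally have "kap' s\<^sub>0 / 2 * \<bar>d\<^sup>2 - 4 * y\<^sup>2\<bar> \<le> K / 2 * (e * k)"
          using kK kap'_nonneg[of s\<^sub>0] K by (intro mult_mono) (auto simp: mult.commute)
        then have "\<bar>kap' s\<^sub>0 / 2 * d\<^sup>2 - kap' s\<^sub>0 / 2 * (4 * y\<^sup>2)\<bar> \<le> K / 2 * (e * k)"
          unfolding right_diff_distrib[symmetric] abs_mult using kap'_nonneg[of s\<^sub>0] by simp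
        then have "\<bar>g - kap' s\<^sub>0 / 2 * (4 * y\<^sup>2)\<bar> \<le> e * (25 * k) + K / 2 * (e * k)"
          using gT ed2 by linarith
        then show ?thesis using div\<beta> order_trans by blast
      qed
      ultimately have "\<bar>V h - m * (norm h)\<^sup>2 - 2 * \<gamma> * (Re (hin h a))\<^sup>2\<bar> \<le>
          4 * (e * k) + e * ((1 + 25 * (K / 2 + 1)) * k) + (e * (25 * k) + K / 2 * (e * k))"
        by (rule tri)
      also have "\<dots> = (e * (55 + 13 * K)) * k" by (simp add: algebra_simps)
      also have "\<dots> \<le> \<eta> * k" using e\<eta> k by (intro mult_right_mono) auto
      finally show ?thesis by (simp add: k_def n_def)
    qed
    define w where "w = P $ i"
    have wdep: "(cmod w)\<^sup>2 = \<beta> - depth i P"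
      by (simp add: depth_def \<beta>_def s\<^sub>0_def a_def w_def)
    have dep: "0 < depth i P" "depth i P < 1" "depth i P < \<tau>\<^sub>0" using P by (auto simp: flat_dom_iff)
    \<comment> \<open>Since \<beta> \<ge> 5/2 and the depth is below 1, w can be pushed radially to
      a boundary point (b, a) with |b|^2 = \<beta>.\<close>
    have "(cmod w)\<^sup>2 > 0" using wdep dep \<beta> by linarith
    then have w0: "w \<noteq> 0" by auto
    define b where "b = of_real (sqrt \<beta> / cmod w) * w"
    have nb: "cmod b = sqrt \<beta>" using w0 \<beta> by (simp add: b_def norm_mult norm_divide)
    have b0: "b \<noteq> 0" using nb \<beta> by auto
    define \<tau> where "\<tau> = 1 - cmod w / sqrt \<beta>"
    have wb: "w / b = of_real (1 - \<tau>)"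
      using w0 \<beta> by (simp add: b_def \<tau>_def)
    have wl: "cmod w < sqrt \<beta>"
      by (rule real_less_rsqrt) (use wdep dep in auto)
    have \<tau>: "0 < \<tau>" "\<tau> < \<tau>\<^sub>0"
    proof -
      show "0 < \<tau>" using wl \<beta> by (simp add: \<tau>_def)
      have q: "0 \<le> cmod w / sqrt \<beta>" "cmod w / sqrt \<beta> \<le> 1" using wl \<beta> by auto
      have "(cmod w / sqrt \<beta>)\<^sup>2 \<le> cmod w / sqrt \<beta>"
        using q by (simp add: power2_eq_square mult_left_le_one_le del: times_divide_eq_left times_divide_eq_right)
      moreover have "(cmod w / sqrt \<beta>)\<^sup>2 = 1 - depth i P / \<beta>"
        using wdep \<beta> by (simp add: power_divide diff_divide_distrib)
      moreover have "depth i P / \<beta> \<le> depth i P / 1" using \<beta> dep by (intro divide_left_mono) auto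
      ultimately show "\<tau> < \<tau>\<^sub>0" using dep by (simp add: \<tau>_def)
    qed
    have "\<exists>G. ball_embedding (model_dom i V) G \<and> G (axis i (of_real \<tau>)) = 0 \<and> ball 0 (1 - \<epsilon>) \<subseteq> G ` model_dom i V"
    proof (rule model[OF \<tau>])
      show "a $ i = 0" by (simp add: a_def)
      have "c \<le> kap l / 4" using kap_nonneg[of l] by (simp add: c_def mult_left_le)
      then show "c \<le> m" using m4 by simp
      show "0 \<le> \<gamma>" by (rule \<gamma>0)
      have "2 * \<gamma> * (norm a)\<^sup>2 \<le> 2 * (1 + K) * (3/2)"
        using \<gamma>0 \<gamma>1 s0 K unfolding s\<^sub>0_def[symmetric] by (intro mult_mono) auto
      then show "m + 2 * \<gamma> * (norm a)\<^sup>2 \<le> C" using m2 by (simp add: C_def K_def)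
      show "c * (norm h)\<^sup>2 \<le> V h" if "V h < 1" for h using Vge[OF that] .
      show "\<bar>V h - m * (norm h)\<^sup>2 - 2 * \<gamma> * (Re (hin h a))\<^sup>2\<bar> \<le> c * \<epsilon> / 32 * (norm h)\<^sup>2"
        if "norm h \<le> r\<^sub>0" for h using Vjet[OF that] by (simp add: \<eta>_def)
    qed
    then obtain G where G: "ball_embedding (model_dom i V) G" "G (axis i (of_real \<tau>)) = 0"
      "ball 0 (1 - \<epsilon>) \<subseteq> G ` model_dom i V" by blast
    define E where "E h = exp (of_real m * hin h a)" for h
    have nE: "(cmod (E h))\<^sup>2 = exp (2 * m * Re (hin h a))" for h
      unfolding E_def norm_exp_eq_Re by (simp add: power2_eq_square flip: exp_add)
    have E0: "E h \<noteq> 0" for h by (simp add: E_def)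
    define F where "F x = axis i (1 - x $ i / b * E (prj i x - a)) + (prj i x - a)" for x
    have Fi: "F x $ i = 1 - x $ i / b * E (prj i x - a)" and pF: "prj i (F x) = prj i x - a" for x
    proof -
      have *: "(prj i x - a) $ i = 0" by (simp add: a_def)
      show "F x $ i = 1 - x $ i / b * E (prj i x - a)" unfolding F_def using * by (simp add: axis_def)
      show "prj i (F x) = prj i x - a" unfolding F_def prj_add prj_id[OF *] by simp
    qed
    \<comment> \<open>Both |1 - W|^2 and 1 - V(h) carry the factor exp (2 m Re g) / \<beta>;
      cancelling it returns the inequality defining the domain.\<close>
    have Fdom: "F x \<in> model_dom i V \<longleftrightarrow> x \<in> flat_dom i" for x
    proof -
      define h where "h = prj i x - a"
      have ah: "prj i x = a + h" by (simp add: h_def)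
      have "(cmod (1 - F x $ i))\<^sup>2 = (cmod (x $ i))\<^sup>2 / \<beta> * exp (2 * m * Re (hin h a))"
        unfolding Fi h_def[symmetric] using nb \<beta>
        by (simp add: norm_mult norm_divide power_mult_distrib power_divide nE)
      moreover have "(cmod (1 - F x $ i))\<^sup>2 = 1 - 2 * Re (F x $ i) + (cmod (F x $ i))\<^sup>2"
        unfolding cmod_power2 by (simp add: power2_eq_square algebra_simps)
      ultimately have "F x \<in> model_dom i V \<longleftrightarrow>
          (cmod (x $ i))\<^sup>2 / \<beta> * exp (2 * m * Re (hin h a)) < 1 - V h"
        unfolding model_dom_def mem_Collect_eq pF h_def[symmetric] by auto
      also have "1 - V h = (4 - Tht ((norm (a + h))\<^sup>2)) / \<beta> * exp (2 * m * Re (hin h a))"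
        by (simp add: V_def)
      also have "(cmod (x $ i))\<^sup>2 / \<beta> * exp (2 * m * Re (hin h a)) < \<dots> \<longleftrightarrow> x \<in> flat_dom i"
        unfolding flat_dom_def mem_Collect_eq ah using \<beta> by (auto simp: divide_less_cancel)
      finally show ?thesis .
    qed
    define f where "f x = G (F x)" for x
    have "f ` flat_dom i = G ` model_dom i V"
    proof -
      have "y \<in> F ` flat_dom i" if y: "y \<in> model_dom i V" for y
      proof -
        define z where "z = prj i y + a"
        define x where "x = axis i (b * (1 - y $ i) / E (prj i y)) + z"
        have zi: "z $ i = 0" by (simp add: z_def a_def)
        have xi: "x $ i = b * (1 - y $ i) / E (prj i y)" unfolding x_def using zi by (simp add: axis_def)
        have px: "prj i x = z" unfolding x_def prj_add prj_id[OF zi] by simp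
        have "F x = y"
        proof (rule prj_eqI[of _ i])
          show "F x $ i = y $ i" unfolding Fi px xi z_def using E0[of "prj i y"] b0 by simp
          show "prj i (F x) = prj i y" unfolding pF px z_def by simp
        qed
        moreover from this have "x \<in> flat_dom i" using Fdom[of x] y by simp
        ultimately show ?thesis by blast
      qed
      then have "F ` flat_dom i = model_dom i V" using Fdom by blast
      then show ?thesis unfolding f_def by (metis image_image)
    qed
    moreover have "ball_embedding (flat_dom i) f"
      unfolding ball_embedding_def
    proof (intro conjI)
      show "holomorphic_map_on f (flat_dom i)"
        unfolding holomorphic_map_on_iff
      proof
        fix x assume x: "x \<in> flat_dom i"
        have "vdiff F x"
          unfolding F_def E_def
          by (intro vdiff_add vdiff_axis cdiff_diff cdiff_const cdiff_mult cdiff_divide cdiff_nth cdiff_exp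
              cdiff_hin vdiff_diff vdiff_prj vdiff_id vdiff_const b0)
        moreover have "vdiff G (F x)"
          using G(1) x Fdom[of x] by (simp add: ball_embedding_def holomorphic_map_on_iff)
        ultimately show "vdiff f x" unfolding f_def by (rule vdiff_compose)
      qed
      show "inj_on f (flat_dom i)"
      proof (rule inj_onI)
        fix x y assume xy: "x \<in> flat_dom i" "y \<in> flat_dom i" "f x = f y"
        then have F: "F x = F y"
          using G(1) Fdom by (auto simp: ball_embedding_def f_def dest: inj_onD)
        then have p: "prj i x = prj i y" using pF[of x] pF[of y] by simp
        then have "1 - x $ i / b * E (prj i y - a) = 1 - y $ i / b * E (prj i y - a)"
          using F Fi[of x] Fi[of y] by metis
        then have "x $ i / b = y $ i / b" using E0 by simp
        then have "x $ i = y $ i" using b0 by simp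
        then show "x = y" using p by (rule prj_eqI)
      qed
      show "f ` flat_dom i \<subseteq> ball 0 1"
        using G(1) Fdom by (auto simp: ball_embedding_def f_def)
    qed
    moreover have "f P = 0"
    proof -
      have "F P = axis i (of_real \<tau>)"
        unfolding F_def a_def[symmetric] w_def[symmetric] wb by (simp add: E_def)
      then show ?thesis by (simp add: f_def G)
    qed
    ultimately show "\<exists>f. ball_embedding (flat_dom i) f \<and> f P = 0 \<and> ball 0 (1 - \<epsilon>) \<subseteq> f ` flat_dom i"
      using G(3) by metis
  qed
qed

lemma embedding_exists:
  fixes \<epsilon> :: real
  assumes \<epsilon>: "0 < \<epsilon>" "\<epsilon> < 1"
  obtains t where "t > 0"
    "\<And>P :: complex ^ 'n. P \<in> flat_dom i \<Longrightarrow> depth i P < t \<Longrightarrow>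
       \<exists>f. ball_embedding (flat_dom i) f \<and> f P = 0 \<and> ball 0 (1 - \<epsilon>) \<subseteq> f ` flat_dom i"
proof -
  obtain t\<^sub>1 where t1: "t\<^sub>1 > 0"
    "\<And>P :: complex ^ 'n. P \<in> flat_dom i \<Longrightarrow> depth i P < t\<^sub>1 \<Longrightarrow> (norm (prj i P))\<^sup>2 \<ge> 3/2 \<Longrightarrow>
       \<exists>f. ball_embedding (flat_dom i) f \<and> f P = 0 \<and> ball 0 (1 - \<epsilon>) \<subseteq> f ` flat_dom i"
    using embedding_outer[OF \<epsilon>] by blast
  obtain t\<^sub>2 s\<^sub>1 where t2: "t\<^sub>2 > 0" "s\<^sub>1 > 0"
    "\<And>P :: complex ^ 'n. P \<in> flat_dom i \<Longrightarrow> depth i P < t\<^sub>2 \<Longrightarrow> (norm (prj i P))\<^sup>2 \<le> s\<^sub>1 \<Longrightarrow>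
       \<exists>f. ball_embedding (flat_dom i) f \<and> f P = 0 \<and> ball 0 (1 - \<epsilon>) \<subseteq> f ` flat_dom i"
    using embedding_inner[OF \<epsilon>] by blast
  obtain t\<^sub>3 where t3: "t\<^sub>3 > 0"
    "\<And>P :: complex ^ 'n. P \<in> flat_dom i \<Longrightarrow> depth i P < t\<^sub>3 \<Longrightarrow> s\<^sub>1 \<le> (norm (prj i P))\<^sup>2 \<Longrightarrow>
       (norm (prj i P))\<^sup>2 \<le> 3/2 \<Longrightarrow>
       \<exists>f. ball_embedding (flat_dom i) f \<and> f P = 0 \<and> ball 0 (1 - \<epsilon>) \<subseteq> f ` flat_dom i"
    using embedding_middle[OF \<epsilon> t2(2)] by blast
  show thesis
  proof (rule that[of "min t\<^sub>1 (min t\<^sub>2 t\<^sub>3)"])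
    fix P :: "complex ^ 'n"
    assume P: "P \<in> flat_dom i" "depth i P < min t\<^sub>1 (min t\<^sub>2 t\<^sub>3)"
    consider "(norm (prj i P))\<^sup>2 \<ge> 3/2" | "(norm (prj i P))\<^sup>2 \<le> s\<^sub>1"
      | "s\<^sub>1 \<le> (norm (prj i P))\<^sup>2" "(norm (prj i P))\<^sup>2 \<le> 3/2" by linarith
    then show "\<exists>f. ball_embedding (flat_dom i) f \<and> f P = 0 \<and> ball 0 (1 - \<epsilon>) \<subseteq> f ` flat_dom i"
    proof cases
      case 1 then show ?thesis using t1(2) P by simp
    next
      case 2 then show ?thesis using t2(3) P by simp
    next
      case 3 then show ?thesis using t3(2) P by simp
    qed
  qed (use t1 t2 t3 in simp)
qed


section \<open>Convexity and the boundary\<close>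

lemma Tht_0_le: "Tht 0 \<le> 1"
  using Tht_mono[of 0 1] Tht_ge_1[of 1] by simp

lemma continuous_Tht: "continuous_on {0..} Tht"
  by (rule continuous_at_imp_continuous_on) (auto intro!: DERIV_isCont has_derivative_Tht)

lemma continuous_depth: "continuous_on UNIV (depth i :: complex ^ 'n \<Rightarrow> real)"
proof -
  have "continuous_on UNIV (\<lambda>x :: complex ^ 'n. (norm (prj i x))\<^sup>2)"
    by (intro continuous_intros linear_continuous_on bounded_linear_prj)
  then have "continuous_on UNIV (\<lambda>x :: complex ^ 'n. Tht ((norm (prj i x))\<^sup>2))"
    by (rule continuous_on_compose2[OF continuous_Tht]) auto
  then show ?thesis
    unfolding depth_def by (intro continuous_intros)
qed

lemma open_flat_dom: "open (flat_dom i)"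
proof -
  have "flat_dom i = {x. 0 < depth i x}" by (auto simp: flat_dom_iff)
  then show ?thesis using continuous_depth[of i] by (auto intro!: open_Collect_less continuous_intros)
qed

lemma norm_le_2:
  assumes "depth i x \<ge> 0"
  shows "norm (x :: complex ^ 'n) \<le> 2"
proof -
  have "(norm x)\<^sup>2 \<le> 2\<^sup>2"
    using assms Tht_ge[OF sq_gt_m1[of "norm (prj i x)"]] norm_split[of x i] by (simp add: depth_def)
  then show ?thesis by (rule power2_le_imp_le) simp
qed

lemma bounded_flat_dom: "bounded (flat_dom i :: (complex ^ 'n) set)"
  by (rule boundedI[of _ 2]) (auto simp: flat_dom_iff intro!: norm_le_2[of i])

lemma norm_sq_convex:
  fixes x y :: "'a :: real_normed_vector"
  assumes "u \<ge> 0" "v \<ge> 0" "u + v = 1"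
  shows "(norm (u *\<^sub>R x + v *\<^sub>R y))\<^sup>2 \<le> u * (norm x)\<^sup>2 + v * (norm y)\<^sup>2"
proof -
  have "(norm (u *\<^sub>R x + v *\<^sub>R y))\<^sup>2 \<le> (u * norm x + v * norm y)\<^sup>2"
    using assms by (intro power_mono order_trans[OF norm_triangle_ineq]) auto
  also have "\<dots> = u * (norm x)\<^sup>2 + v * (norm y)\<^sup>2 - u * v * (norm x - norm y)\<^sup>2"
  proof -
    have v: "v = 1 - u" using assms by simp
    show ?thesis unfolding v by (simp add: power2_eq_square algebra_simps)
  qed
  also have "\<dots> \<le> u * (norm x)\<^sup>2 + v * (norm y)\<^sup>2" using assms by simp
  finally show ?thesis .
qed

text \<open>\<open>Tht\<close> is convex and nondecreasing and squared norms are convex. In the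
  proof \<open>Tht\<close> is replaced by its tangent at the value \<open>s\<close> of the
  combination, whose slope is nonnegative.\<close>

lemma depth_concave:
  fixes x y :: "complex ^ 'n"
  assumes uv: "u \<ge> 0" "v \<ge> 0" "u + v = 1"
  shows "u * depth i x + v * depth i y \<le> depth i (u *\<^sub>R x + v *\<^sub>R y)"
proof -
  let ?z = "u *\<^sub>R x + v *\<^sub>R y"
  define s where "s = (norm (prj i ?z))\<^sup>2"
  have T: "Tht s + kap s * ((norm p)\<^sup>2 - s) \<le> Tht ((norm p)\<^sup>2)" for p :: "complex ^ 'n"
    using gap_nonneg[of "(norm p)\<^sup>2" s] sq_gt_m1 by (simp add: gap_def s_def)
  have "kap s * s \<le> kap s * (u * (norm (prj i x))\<^sup>2 + v * (norm (prj i y))\<^sup>2)"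
    unfolding s_def prj_add prj_scaleR using uv by (intro mult_left_mono norm_sq_convex kap_nonneg)
  moreover have "u * (Tht s + kap s * ((norm (prj i x))\<^sup>2 - s)) \<le> u * Tht ((norm (prj i x))\<^sup>2)"
    "v * (Tht s + kap s * ((norm (prj i y))\<^sup>2 - s)) \<le> v * Tht ((norm (prj i y))\<^sup>2)"
    using uv T by (auto intro: mult_left_mono)
  moreover have "(cmod (?z $ i))\<^sup>2 \<le> u * (cmod (x $ i))\<^sup>2 + v * (cmod (y $ i))\<^sup>2"
    using norm_sq_convex[OF uv, of "x $ i" "y $ i"] by simp
  moreover have "u * t + v * t = t" for t
    using uv(3) by (metis distrib_right mult_1)
  note this[of 4] this[of "Tht s"] this[of "kap s * s"]
  ultimately show ?thesis
    unfolding depth_def s_def[symmetric] by (simp add: algebra_simps)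
qed

lemma convex_flat_dom: "convex (flat_dom i :: (complex ^ 'n) set)"
proof (rule convexI)
  fix x y :: "complex ^ 'n" and u v :: real
  assume *: "x \<in> flat_dom i" "y \<in> flat_dom i" "0 \<le> u" "0 \<le> v" "u + v = 1"
  have "0 < u * depth i x + v * depth i y"
  proof (cases "u = 0")
    case True then show ?thesis using * by (simp add: flat_dom_iff)
  next
    case False
    then have "u * depth i x > 0" "v * depth i y \<ge> 0" using * by (simp_all add: flat_dom_iff)
    then show ?thesis by simp
  qed
  then show "u *\<^sub>R x + v *\<^sub>R y \<in> flat_dom i"
    using depth_concave[of u v i x y] * by (simp add: flat_dom_iff)
qed

lemma depth_zero: "depth i (0 :: complex ^ 'n) \<ge> 3"
proof -
  have "prj i (0 :: complex ^ 'n) = 0" by (simp add: prj_id)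
  then show ?thesis using Tht_0_le by (simp add: depth_def)
qed

lemma zero_in_flat_dom: "0 \<in> flat_dom i"
  using depth_zero[of i] by (simp add: flat_dom_iff)

lemma bounded_domain_flat_dom: "bounded_domain (flat_dom i :: (complex ^ 'n) set)"
  unfolding bounded_domain_def
  using open_flat_dom[of i] bounded_flat_dom[of i] convex_connected[OF convex_flat_dom[of i]] zero_in_flat_dom[of i] by auto

text \<open>A point of depth 0 is a limit of interior points because, by concavity, the depth is
  positive on the half-open segment from it to the origin.\<close>

lemma frontier_flat_dom: "frontier (flat_dom i) = {x :: complex ^ 'n. depth i x = 0}"
proof (intro equalityI subsetI)
  fix x :: "complex ^ 'n" assume x: "x \<in> frontier (flat_dom i)"
  have "closed {x :: complex ^ 'n. 0 \<le> depth i x}"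
    using continuous_depth by (intro closed_Collect_le continuous_intros)
  then have "closure (flat_dom i) \<subseteq> {x :: complex ^ 'n. 0 \<le> depth i x}"
    by (intro closure_minimal) (auto simp: flat_dom_iff)
  then have "depth i x \<ge> 0" using x by (auto simp: frontier_def)
  moreover have "x \<notin> flat_dom i"
    using x open_flat_dom[of i] by (auto simp: frontier_def interior_open)
  ultimately show "x \<in> {x. depth i x = 0}" by (simp add: flat_dom_iff)
next
  fix x :: "complex ^ 'n" assume "x \<in> {x. depth i x = 0}"
  then have x: "depth i x = 0" by simp
  have "x \<in> closure (flat_dom i)"
    unfolding closure_approachable
  proof (intro allI impI)
    fix e :: real assume e: "e > 0"
    define v where "v = min (1/2) (e / (2 * (norm x + 1)))"
    have v: "v > 0" "v \<le> 1/2" unfolding v_def using e by (simp add: add_nonneg_pos, intro min.cobounded1)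
    have "v * norm x \<le> e / (2 * (norm x + 1)) * norm x"
      by (intro mult_right_mono) (auto simp: v_def)
    also have "\<dots> = e * norm x / (2 * (norm x + 1))" by simp
    also have "\<dots> < e"
    proof -
      have pos: "2 * (norm x + 1) > 0" by (simp add: add_nonneg_pos)
      have "norm x < 2 * (norm x + 1)" by (smt (verit) norm_ge_zero)
      then show ?thesis
        unfolding pos_divide_less_eq[OF pos] using e by (rule mult_strict_left_mono)
    qed
    finally have "v * norm x < e" .
    then have "dist (v *\<^sub>R 0 + (1 - v) *\<^sub>R x) x < e"
      using v by (simp add: dist_norm algebra_simps)
    moreover have "0 < v * depth i (0 :: complex ^ 'n) + (1 - v) * depth i x"
      using v depth_zero[of i] x by simp
    then have "v *\<^sub>R 0 + (1 - v) *\<^sub>R x \<in> flat_dom i"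
      using depth_concave[of v "1 - v" i 0 x] v by (simp add: flat_dom_iff)
    ultimately show "\<exists>y\<in>flat_dom i. dist y x < e" by blast
  qed
  then show "x \<in> frontier (flat_dom i)"
    using x open_flat_dom[of i] by (simp add: frontier_def interior_open flat_dom_iff)
qed

text \<open>On the ball of radius 2 each squared norm is Lipschitz with constant 4 and
  \<open>Tht\<close> is 1-Lipschitz. This passes from distance to the boundary to the depth used in
  the embedding lemmas.\<close>

lemma depth_le_infdist:
  fixes x :: "complex ^ 'n"
  assumes x: "x \<in> flat_dom i" and ne: "frontier (flat_dom i) \<noteq> ({} :: (complex ^ 'n) set)"
  shows "depth i x \<le> 8 * infdist x (frontier (flat_dom i))"
proof -
  obtain p where p: "p \<in> frontier (flat_dom i)" "infdist x (frontier (flat_dom i)) = dist x p"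
    using infdist_attains_inf[OF frontier_closed ne] by blast
  have p0: "depth i p = 0" using p frontier_flat_dom by auto
  have n: "norm x \<le> 2" "norm p \<le> 2" using x p0 by (auto intro!: norm_le_2[of i] simp: flat_dom_iff)
  have nn: "cmod (x $ i) \<le> 2" "cmod (p $ i) \<le> 2" "norm (prj i x) \<le> 2" "norm (prj i p) \<le> 2"
    using n Finite_Cartesian_Product.norm_nth_le[of x i] Finite_Cartesian_Product.norm_nth_le[of p i]
      norm_prj_le[of i x] norm_prj_le[of i p] by linarith+
  have sq: "\<bar>a\<^sup>2 - b\<^sup>2\<bar> \<le> 4 * d" if "0 \<le> a" "0 \<le> b" "a \<le> 2" "b \<le> 2" "\<bar>a - b\<bar> \<le> d" for a b d :: real
  proof -
    have "\<bar>a\<^sup>2 - b\<^sup>2\<bar> = (a + b) * \<bar>a - b\<bar>"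
      using that by (simp add: power2_eq_square square_diff_square_factored abs_mult)
    also have "\<dots> \<le> 4 * d" using that by (intro mult_mono) auto
    finally show ?thesis .
  qed
  have "\<bar>(cmod (p $ i))\<^sup>2 - (cmod (x $ i))\<^sup>2\<bar> \<le> 4 * dist x p"
  proof (rule sq)
    have "\<bar>cmod (p $ i) - cmod (x $ i)\<bar> \<le> cmod ((p - x) $ i)"
      by (simp add: norm_triangle_ineq3)
    also have "\<dots> \<le> dist x p" by (metis Finite_Cartesian_Product.norm_nth_le dist_commute dist_norm)
    finally show "\<bar>cmod (p $ i) - cmod (x $ i)\<bar> \<le> dist x p" .
  qed (use nn in auto)
  moreover have "\<bar>(norm (prj i p))\<^sup>2 - (norm (prj i x))\<^sup>2\<bar> \<le> 4 * dist x p"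
  proof (rule sq)
    have "\<bar>norm (prj i p) - norm (prj i x)\<bar> \<le> norm (prj i (p - x))"
      unfolding prj_diff by (rule norm_triangle_ineq3)
    also have "\<dots> \<le> dist x p" by (metis norm_prj_le dist_commute dist_norm)
    finally show "\<bar>norm (prj i p) - norm (prj i x)\<bar> \<le> dist x p" .
  qed (use nn in auto)
  moreover have "\<bar>Tht ((norm (prj i p))\<^sup>2) - Tht ((norm (prj i x))\<^sup>2)\<bar> \<le> \<bar>(norm (prj i p))\<^sup>2 - (norm (prj i x))\<^sup>2\<bar>"
    by (intro Tht_lipschitz sq_gt_m1)
  ultimately show ?thesis
    using p0 unfolding p(2) depth_def by linarith
qed


section \<open>Smoothness of the boundary\<close>

lemma s_kap'_tendsto_0: "((\<lambda>s. s * kap' s) \<longlongrightarrow> 0) (at_right 0)"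
proof (rule tendsto_sandwich[OF _ _ tendsto_const kap'_small])
  have ev: "eventually (\<lambda>s::real. s > 0) (at_right 0)" by (simp add: eventually_at_right_less)
  then show "eventually (\<lambda>s. 0 \<le> s * kap' s) (at_right 0)"
    by eventually_elim (simp add: kap'_nonneg)
  show "eventually (\<lambda>s. s * kap' s \<le> s * kap' s / kap s) (at_right 0)"
    using ev
  proof eventually_elim
    case (elim s)
    have "s * kap' s / 1 \<le> s * kap' s / kap s"
      using elim kap_pos[of s] kap_le_1[of s] kap'_nonneg[of s] by (intro divide_left_mono) auto
    then show ?case by simp
  qed
qed

lemma isCont_kap: "isCont kap s"
  using continuous_kap continuous_on_eq_continuous_at open_UNIV by blast

lemma kap_0 [simp]: "kap 0 = 0" and kap'_0 [simp]: "kap' 0 = 0"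
  by (simp_all add: kap_def kap'_def)

text \<open>The field is half the gradient of Tht(|z|^2). Although \<open>kap\<close> is not
  differentiable at 0, kap(|z|^2) --> 0 already makes the field o(|z|) there.\<close>

lemma kap_field_derivative:
  fixes z :: "'a :: real_inner"
  shows "((\<lambda>z. kap ((norm z)\<^sup>2) *\<^sub>R z) has_derivative
    (\<lambda>v. kap ((norm z)\<^sup>2) *\<^sub>R v + (2 * kap' ((norm z)\<^sup>2) * (z \<bullet> v)) *\<^sub>R z)) (at z)"
proof (cases "z = 0")
  case True
  have "((\<lambda>y::'a. kap ((norm y)\<^sup>2)) \<longlongrightarrow> kap ((norm (0::'a))\<^sup>2)) (at 0)"
    by (intro isCont_tendsto_compose[OF isCont_kap] tendsto_intros)
  then have "((\<lambda>y::'a. kap ((norm y)\<^sup>2)) \<longlongrightarrow> 0) (at 0)" by simp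
  then have "((\<lambda>y::'a. norm (kap ((norm y)\<^sup>2) *\<^sub>R y - kap ((norm (0::'a))\<^sup>2) *\<^sub>R 0 - 0) / norm (y - 0)) \<longlongrightarrow> 0) (at 0)"
    by (rule Lim_transform_eventually) (auto simp: eventually_at_filter kap_nonneg)
  then have "((\<lambda>z::'a. kap ((norm z)\<^sup>2) *\<^sub>R z) has_derivative (\<lambda>v. 0)) (at 0)"
    unfolding has_derivative_iff_norm by simp
  then show ?thesis using True by simp
next
  case False
  then have "z \<bullet> z > 0" by simp
  have "((\<lambda>z. z \<bullet> z) has_derivative (\<lambda>v. z \<bullet> v + v \<bullet> z)) (at z)"
    by (auto intro!: derivative_eq_intros)
  from DERIV_compose_FDERIV[OF has_derivative_kap[OF \<open>z \<bullet> z > 0\<close>] this]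
  have "((\<lambda>z. kap (z \<bullet> z)) has_derivative (\<lambda>v. (z \<bullet> v + v \<bullet> z) * kap' (z \<bullet> z))) (at z)" .
  from has_derivative_scaleR[OF this has_derivative_ident]
  show ?thesis
    unfolding power2_norm_eq_inner
    by (rule has_derivative_eq_rhs) (auto simp: inner_commute algebra_simps)
qed

lemma C2_on_neg_depth: "C2_on UNIV (\<lambda>x :: complex ^ 'n. - depth i x)"
proof -
  define p :: "(complex ^ 'n) \<Rightarrow>\<^sub>L (complex ^ 'n)" where "p = Blinfun (prj i)"
  have p: "blinfun_apply p = prj i"
    unfolding p_def by (rule bounded_linear_Blinfun_apply[OF bounded_linear_prj])
  have blw: "bounded_linear (\<lambda>x :: complex ^ 'n. x - prj i x)"
    by (intro bounded_linear_sub bounded_linear_ident bounded_linear_prj)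
  define w :: "(complex ^ 'n) \<Rightarrow>\<^sub>L (complex ^ 'n)" where "w = Blinfun (\<lambda>x. x - prj i x)"
  have w: "blinfun_apply w x = x - prj i x" for x
    unfolding w_def by (simp add: bounded_linear_Blinfun_apply[OF blw])
  define I :: "(complex ^ 'n) \<Rightarrow>\<^sub>L (complex ^ 'n) \<Rightarrow>\<^sub>L real" where "I = Blinfun blinfun_inner_right"
  have I: "blinfun_apply I = blinfun_inner_right"
    unfolding I_def by (rule bounded_linear_Blinfun_apply[OF bounded_linear_blinfun_inner_right])
  \<comment> \<open>\<open>G\<close> is the gradient of \<open>- depth i\<close> and
    \<open>D\<close> the derivative of \<open>G\<close>. The rank one part \<open>Q\<close> is the
    only place where \<open>kap'\<close> enters; its norm is at most 4 |z|^2 kap'(|z|^2), which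
    tends to 0 at the origin.\<close>
  define G where "G x = 2 *\<^sub>R blinfun_apply w x + 2 *\<^sub>R (kap ((norm (prj i x))\<^sup>2) *\<^sub>R prj i x)" for x
  define Q :: "complex ^ 'n \<Rightarrow> (complex ^ 'n) \<Rightarrow>\<^sub>L (complex ^ 'n)" where
    "Q z = (4 * kap' ((norm z)\<^sup>2)) *\<^sub>R (blinfun_scaleR_left z o\<^sub>L blinfun_inner_right z)" for z
  define D where "D x = 2 *\<^sub>R w + (2 * kap ((norm (prj i x))\<^sup>2)) *\<^sub>R p + Q (prj i x)" for x
  have orth: "prj i x \<bullet> (v - prj i v) = 0" for x v :: "complex ^ 'n"
    by (simp add: prj_def[of i v] inner_axis)
  have orth': "prj i x \<bullet> prj i v = prj i x \<bullet> v" for x v :: "complex ^ 'n"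
    using orth[of x v] by (simp add: inner_diff_right)
  have orth'': "(x - prj i x) \<bullet> v = x $ i \<bullet> v $ i" for x v :: "complex ^ 'n"
    by (simp add: prj_def inner_axis')
  have DG: "(G has_derivative blinfun_apply (D x)) (at x)" for x
  proof -
    have "((\<lambda>x. kap ((norm (prj i x))\<^sup>2) *\<^sub>R prj i x) has_derivative
        (\<lambda>v. kap ((norm (prj i x))\<^sup>2) *\<^sub>R prj i v + (2 * kap' ((norm (prj i x))\<^sup>2) * (prj i x \<bullet> prj i v)) *\<^sub>R prj i x)) (at x)"
      by (rule has_derivative_compose[OF bounded_linear_imp_has_derivative[OF bounded_linear_prj] kap_field_derivative])
    then have "(G has_derivative (\<lambda>v. 2 *\<^sub>R blinfun_apply w v + 2 *\<^sub>R (kap ((norm (prj i x))\<^sup>2) *\<^sub>R prj i v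
        + (2 * kap' ((norm (prj i x))\<^sup>2) * (prj i x \<bullet> prj i v)) *\<^sub>R prj i x))) (at x)"
      unfolding G_def
      by (intro has_derivative_add has_derivative_scaleR_right bounded_linear_imp_has_derivative blinfun.bounded_linear_right)
    moreover have "blinfun_apply (D x) = (\<lambda>v. 2 *\<^sub>R blinfun_apply w v + 2 *\<^sub>R (kap ((norm (prj i x))\<^sup>2) *\<^sub>R prj i v
        + (2 * kap' ((norm (prj i x))\<^sup>2) * (prj i x \<bullet> prj i v)) *\<^sub>R prj i x))"
      by (rule ext) (simp add: D_def Q_def blinfun.add_left blinfun.scaleR_left p orth' algebra_simps)
    ultimately show ?thesis by simp
  qed
  have D\<rho>: "((\<lambda>x. - depth i x) has_derivative blinfun_apply (blinfun_inner_right (G x))) (at x)" for x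
  proof -
    have n2: "((\<lambda>x. (norm (L x))\<^sup>2) has_derivative (\<lambda>v. 2 * (L x \<bullet> L v))) (at x)"
      if "bounded_linear L" for L :: "complex ^ 'n \<Rightarrow> 'b :: real_inner"
      unfolding power2_norm_eq_inner
      using bounded_linear_imp_has_derivative[OF that, of "at x"]
      by (auto intro!: derivative_eq_intros simp: inner_commute)
    have "((\<lambda>x. Tht ((norm (prj i x))\<^sup>2)) has_derivative (\<lambda>v. 2 * (prj i x \<bullet> prj i v) * kap ((norm (prj i x))\<^sup>2))) (at x)"
      by (rule DERIV_compose_FDERIV[OF has_derivative_Tht[OF sq_gt_m1] n2[OF bounded_linear_prj]])
    then have "((\<lambda>x. (cmod (x $ i))\<^sup>2 + Tht ((norm (prj i x))\<^sup>2) - 4) has_derivative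
        (\<lambda>v. 2 * (x $ i \<bullet> v $ i) + 2 * (prj i x \<bullet> prj i v) * kap ((norm (prj i x))\<^sup>2) - 0)) (at x)"
      by (intro has_derivative_diff has_derivative_add has_derivative_const n2 bounded_linear_vec_nth)
    moreover have "(\<lambda>x. (cmod (x $ i))\<^sup>2 + Tht ((norm (prj i x))\<^sup>2) - 4) = (\<lambda>x. - depth i x)"
      by (rule ext) (simp add: depth_def)
    moreover have "(\<lambda>v. 2 * (x $ i \<bullet> v $ i) + 2 * (prj i x \<bullet> prj i v) * kap ((norm (prj i x))\<^sup>2) - 0)
        = blinfun_apply (blinfun_inner_right (G x))"
      by (rule ext) (simp add: G_def w inner_add_left orth' orth'' inner_scaleR_left)
    ultimately show ?thesis by metis
  qed
  have contQ: "isCont Q z" for z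
  proof (cases "z = 0")
    case True
    have "((\<lambda>z :: complex ^ 'n. 4 * ((norm z)\<^sup>2 * kap' ((norm z)\<^sup>2))) \<longlongrightarrow> 4 * 0) (at 0)"
    proof (intro tendsto_mult_left filterlim_compose[OF s_kap'_tendsto_0])
      have "((\<lambda>z :: complex ^ 'n. (norm z)\<^sup>2) \<longlongrightarrow> (norm (0 :: complex ^ 'n))\<^sup>2) (at 0)"
        by (intro tendsto_intros)
      then show "filterlim (\<lambda>z :: complex ^ 'n. (norm z)\<^sup>2) (at_right 0) (at 0)"
        by (auto simp: filterlim_at eventually_at_filter)
    qed
    then have lim: "((\<lambda>z :: complex ^ 'n. 4 * ((norm z)\<^sup>2 * kap' ((norm z)\<^sup>2))) \<longlongrightarrow> 0) (at 0)"
      by simp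
    have "(Q \<longlongrightarrow> 0) (at 0)"
    proof (rule Lim_null_comparison[OF _ lim])
      have "norm (Q z) \<le> 4 * ((norm z)\<^sup>2 * kap' ((norm z)\<^sup>2))" for z
      proof -
        have "norm (blinfun_scaleR_left z o\<^sub>L blinfun_inner_right z) \<le> (norm z)\<^sup>2"
        proof (rule norm_blinfun_bound)
          fix v
          have "\<bar>z \<bullet> v\<bar> * norm z \<le> (norm z * norm v) * norm z"
            by (intro mult_right_mono Cauchy_Schwarz_ineq2) auto
          then show "norm (blinfun_apply (blinfun_scaleR_left z o\<^sub>L blinfun_inner_right z) v) \<le> (norm z)\<^sup>2 * norm v"
            by (simp add: power2_eq_square mult_ac)
        qed simp
        then have "4 * kap' ((norm z)\<^sup>2) * norm (blinfun_scaleR_left z o\<^sub>L blinfun_inner_right z) \<le> 4 * kap' ((norm z)\<^sup>2) * (norm z)\<^sup>2"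
          using kap'_nonneg by (intro mult_left_mono) auto
        then show ?thesis using kap'_nonneg[of "(norm z)\<^sup>2"] by (simp add: Q_def abs_mult mult_ac)
      qed
      then show "eventually (\<lambda>z. norm (Q z) \<le> 4 * ((norm z)\<^sup>2 * kap' ((norm z)\<^sup>2))) (at 0)"
        by simp
    qed
    then show ?thesis using True by (simp add: isCont_def Q_def)
  next
    case False
    then have "isCont kap' ((norm z)\<^sup>2)"
      using continuous_kap' by (simp add: continuous_on_eq_continuous_at)
    then have k: "isCont (\<lambda>z :: complex ^ 'n. kap' ((norm z)\<^sup>2)) z"
      by (rule isCont_o2[rotated]) (intro continuous_intros)
    have "isCont (\<lambda>z :: complex ^ 'n. blinfun_scaleR_left z o\<^sub>L blinfun_inner_right z) z"
      by (rule bounded_bilinear.continuous[OF bounded_bilinear_blinfun_compose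
            linear_continuous_at[OF bounded_linear_blinfun_scaleR_left]
            linear_continuous_at[OF bounded_linear_blinfun_inner_right]])
    from continuous_scaleR[OF continuous_mult[OF continuous_const k] this]
    show ?thesis unfolding Q_def .
  qed
  have isp: "isCont (prj i :: complex ^ 'n \<Rightarrow> _) x" for x
    by (rule linear_continuous_at[OF bounded_linear_prj])
  have contD: "isCont D x" for x
  proof -
    have "isCont (\<lambda>x :: complex ^ 'n. (norm (prj i x))\<^sup>2) x"
      by (rule continuous_power[OF continuous_norm[OF isp]])
    then have "isCont (\<lambda>x :: complex ^ 'n. kap ((norm (prj i x))\<^sup>2)) x"
      by (rule isCont_o2) (rule isCont_kap)
    then have "isCont (\<lambda>x. (2 * kap ((norm (prj i x))\<^sup>2)) *\<^sub>R p) x"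
      by (rule continuous_scaleR[OF continuous_mult[OF continuous_const] continuous_const])
    from continuous_add[OF continuous_add[OF continuous_const this] isCont_o2[OF isp contQ]]
    show ?thesis unfolding D_def .
  qed
  show ?thesis
    unfolding C2_on_def
  proof (intro exI conjI ballI)
    show "((\<lambda>x. - depth i x) has_derivative blinfun_apply (blinfun_inner_right (G x))) (at x)" for x
      by (rule D\<rho>)
    show "((\<lambda>x. blinfun_inner_right (G x)) has_derivative blinfun_apply (I o\<^sub>L D x)) (at x)" for x
      using bounded_linear.has_derivative[OF bounded_linear_blinfun_inner_right DG[of x]]
      by (simp add: I o_def blinfun_compose.rep_eq)
    show "continuous_on UNIV (\<lambda>x. I o\<^sub>L D x)"
      using contD by (intro continuous_intros continuous_at_imp_continuous_on) auto
  qed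
qed


lemma norm_axis_complex: "norm (axis i c :: complex ^ 'n) = cmod c"
  using norm_axis_add[of "0 :: complex ^ 'n" i c] by simp

lemma frechet_derivative_neg_depth_ne_0:
  fixes x :: "complex ^ 'n"
  assumes "depth i x = 0"
  shows "frechet_derivative (\<lambda>x. - depth i x) (at x) \<noteq> (\<lambda>_. 0)"
proof
  assume *: "frechet_derivative (\<lambda>x. - depth i x) (at x) = (\<lambda>_. 0)"
  have "(\<lambda>x :: complex ^ 'n. - depth i x) differentiable at x"
    using C2_on_neg_depth unfolding C2_on_def differentiable_def by blast
  then have D: "((\<lambda>x. - depth i x) has_derivative (\<lambda>_. 0)) (at x)"
    using * by (simp add: frechet_derivative_works)
  \<comment> \<open>By concavity the depth increases at a rate of at least \<open>depth i 0\<close> from a boundary point towards the origin.\<close>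
  have "((\<lambda>u. x - u *\<^sub>R x) has_derivative (\<lambda>u. - u *\<^sub>R x)) (at (0::real))"
    by (auto intro!: derivative_eq_intros)
  moreover have "((\<lambda>x. - depth i x) has_derivative (\<lambda>_. 0)) (at (x - (0::real) *\<^sub>R x))"
    using D by simp
  ultimately have "((\<lambda>u. - depth i (x - u *\<^sub>R x)) has_derivative (\<lambda>_. 0)) (at (0::real))"
    by (rule has_derivative_compose)
  then have "((\<lambda>u::real. - depth i (x - u *\<^sub>R x)) has_real_derivative 0) (at 0)"
    by (simp add: has_field_derivative_def lambda_zero)
  then have "((\<lambda>h. (- depth i (x - (0 + h) *\<^sub>R x) - - depth i (x - (0::real) *\<^sub>R x)) / h) \<longlongrightarrow> 0) (at 0)"
    unfolding DERIV_def .
  then have "eventually (\<lambda>h. dist ((- depth i (x - (0 + h) *\<^sub>R x) - - depth i (x - (0::real) *\<^sub>R x)) / h) 0 < 1) (at 0)"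
    by (rule tendstoD) simp
  then obtain d where d: "d > 0" "\<And>h. h \<noteq> 0 \<Longrightarrow> \<bar>h\<bar> < d \<Longrightarrow> \<bar>depth i (x - h *\<^sub>R x) / h\<bar> < 1"
    using assms by (auto simp: eventually_at dist_real_def)
  define h where "h = min (d / 2) (1/2)"
  have h: "h > 0" "h < d" "h \<le> 1/2" using d(1) unfolding h_def by auto
  have "h * depth i 0 + (1 - h) * depth i x \<le> depth i (h *\<^sub>R 0 + (1 - h) *\<^sub>R x)"
    using h by (intro depth_concave) auto
  then have "h * depth i (0 :: complex ^ 'n) \<le> depth i (x - h *\<^sub>R x)"
    using assms by (simp add: algebra_simps)
  moreover have "h * 3 \<le> h * depth i (0 :: complex ^ 'n)"
    using depth_zero[of i] h by (intro mult_left_mono) auto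
  ultimately have "3 * h \<le> depth i (x - h *\<^sub>R x)" by linarith
  then have "3 \<le> depth i (x - h *\<^sub>R x) / h"
    using h by (simp add: pos_le_divide_eq)
  moreover have "\<bar>depth i (x - h *\<^sub>R x) / h\<bar> < 1"
    by (rule d(2)) (use h in auto)
  ultimately show False by linarith
qed

lemma C2_boundary_flat_dom: "C2_boundary (flat_dom i :: (complex ^ 'n) set)"
  unfolding C2_boundary_def
proof
  fix p :: "complex ^ 'n"
  have "C2_defining_function (flat_dom i) UNIV (\<lambda>x :: complex ^ 'n. - depth i x)"
    unfolding C2_defining_function_def frontier_flat_dom
    using C2_on_neg_depth frechet_derivative_neg_depth_ne_0 by (auto simp: flat_dom_iff)
  then show "\<exists>U \<rho>. p \<in> U \<and> C2_defining_function (flat_dom i) U \<rho>" by blast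
qed


section \<open>Failure of strong pseudoconvexity\<close>

text \<open>\<open>g'\<close> is known to be differentiable only at 0, so a Peano-type argument is
  used: |g' s - q s| \<le> e t on [0, t] integrates to |g t - q t^2 / 2| \<le> e t^2, and g t =
  o(t^2) then forces q = 0.\<close>

lemma second_derivative_zero:
  fixes g g' :: "real \<Rightarrow> real"
  assumes d: "d > 0" and g: "\<And>t. \<bar>t\<bar> < d \<Longrightarrow> (g has_real_derivative g' t) (at t)"
    and g': "(g' has_real_derivative q) (at 0)" and g0: "g 0 = 0"
    and small: "((\<lambda>t. g t / t\<^sup>2) \<longlongrightarrow> 0) (at 0)"
  shows "g' 0 = 0" "q = 0"
proof -
  have "((\<lambda>t. g t / t\<^sup>2 * t) \<longlongrightarrow> 0 * 0) (at 0)"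
    by (intro tendsto_mult small tendsto_ident_at)
  then have "((\<lambda>t. g t / t) \<longlongrightarrow> 0) (at 0)"
    using Lim_transform_eventually[of "\<lambda>t. g t / t\<^sup>2 * t" 0 "at 0" "\<lambda>t. g t / t"]
    by (simp add: eventually_at_filter power2_eq_square)
  moreover have "((\<lambda>t. g t / t) \<longlongrightarrow> g' 0) (at 0)"
    using g[of 0] d g0 by (simp add: DERIV_def)
  ultimately show g'0: "g' 0 = 0" using LIM_unique by blast
  show "q = 0"
  proof (rule ccontr)
    assume "q \<noteq> 0"
    define e where "e = \<bar>q\<bar> / 8"
    have e: "e > 0" using \<open>q \<noteq> 0\<close> by (simp add: e_def)
    have "((\<lambda>t. g' t / t) \<longlongrightarrow> q) (at 0)"
      using g' g'0 by (simp add: DERIV_def)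
    then have "eventually (\<lambda>t. dist (g' t / t) q < e) (at 0)"
      using e by (rule tendstoD)
    moreover have "eventually (\<lambda>t. dist (g t / t\<^sup>2) 0 < e) (at 0)"
      using small e by (rule tendstoD)
    ultimately have "eventually (\<lambda>t. dist (g' t / t) q < e \<and> dist (g t / t\<^sup>2) 0 < e) (at 0)"
      by (rule eventually_conj)
    then obtain r where r: "r > 0"
      "\<And>t. t \<noteq> 0 \<Longrightarrow> \<bar>t\<bar> < r \<Longrightarrow> \<bar>g' t / t - q\<bar> < e \<and> \<bar>g t / t\<^sup>2\<bar> < e"
      unfolding eventually_at by (auto simp: dist_real_def)
    define t where "t = min r d / 2"
    have t: "t > 0" "t < r" "t < d" using r(1) d by (auto simp: t_def)
    have E: "\<bar>g' s - q * s\<bar> \<le> e * t" if "s \<in> {0..t}" for s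
    proof (cases "s = 0")
      case True then show ?thesis using g'0 e t by simp
    next
      case False
      then have s: "s > 0" "s \<le> t" using that by auto
      have "\<bar>g' s / s - q\<bar> < e" using r(2)[of s] s t by auto
      then have "\<bar>g' s / s - q\<bar> * s \<le> e * t" using s e by (intro mult_mono) auto
      moreover have "\<bar>g' s / s - q\<bar> * s = \<bar>(g' s / s - q) * s\<bar>" using s by (simp add: abs_mult)
      moreover have "(g' s / s - q) * s = g' s - q * s" using s by (simp add: algebra_simps)
      ultimately show ?thesis by simp
    qed
    define F where "F s = g s - q * s\<^sup>2 / 2" for s
    have "norm (F t - F 0) \<le> e * t * norm (t - 0)"
    proof (rule field_differentiable_bound[where S="{0..t}"])
      show "(F has_field_derivative g' s - q * s) (at s within {0..t})" if "s \<in> {0..t}" for s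
      proof (rule has_field_derivative_at_within)
        have "\<bar>s\<bar> < d" using that t by auto
        from g[OF this] show "(F has_field_derivative g' s - q * s) (at s)"
          unfolding F_def by (auto intro!: derivative_eq_intros)
      qed
      show "norm (g' s - q * s) \<le> e * t" if "s \<in> {0..t}" for s using E[OF that] by simp
    qed (use t in auto)
    then have "\<bar>g t - q * t\<^sup>2 / 2\<bar> \<le> e * t\<^sup>2"
      using t g0 by (simp add: F_def power2_eq_square)
    moreover have "\<bar>g t\<bar> \<le> e * t\<^sup>2"
    proof -
      have "\<bar>g t / t\<^sup>2\<bar> < e" using r(2)[of t] t by auto
      then show ?thesis using t by (simp add: abs_divide divide_less_eq)
    qed
    moreover have "\<bar>q * t\<^sup>2 / 2\<bar> = \<bar>q\<bar> / 2 * t\<^sup>2" by (simp add: abs_mult)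
    ultimately have "\<bar>q\<bar> / 2 * t\<^sup>2 \<le> 2 * e * t\<^sup>2" by linarith
    then have "\<bar>q\<bar> / 2 \<le> 2 * e" using t by simp
    then show False using e by (simp add: e_def)
  qed
qed

text \<open>Since the boundary has contact of order higher than two with its tangent plane
  in every direction \<open>e\<close> of the complex tangent space, the second derivative of any defining
  function vanishes there.\<close>
lemma defining_function_flat:
  fixes e :: "complex ^ 'n"
  assumes U: "open U" "axis i (of_real (sqrt (4 - Tht 0))) \<in> U"
    and \<rho>: "\<And>x. x \<in> U \<Longrightarrow> (\<rho> has_derivative blinfun_apply (\<rho>' x)) (at x)"
    and \<rho>': "\<And>x. x \<in> U \<Longrightarrow> (\<rho>' has_derivative blinfun_apply (\<rho>'' x)) (at x)"
    and fr: "frontier (flat_dom i) \<inter> U = {z\<in>U. \<rho> z = (0::real)}"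
    and e: "e $ i = 0" "norm e = 1"
  defines "p \<equiv> axis i (of_real (sqrt (4 - Tht 0))) :: complex ^ 'n"
  shows "blinfun_apply (\<rho>' p) e = 0" "blinfun_apply (blinfun_apply (\<rho>'' p) e) e = 0"
proof -
  define b where "b t = sqrt (4 - Tht (t\<^sup>2))" for t :: real
  \<comment> \<open>A boundary curve over the line t e. Because b 0 + b t \<ge> 1, it leaves the
    tangent line p + t e by at most kap(t^2) t^2 = o(t^2).\<close>
  define x where "x t = axis i (of_real (b t)) + t *\<^sub>R e" for t :: real
  have p: "p \<in> U" using U by (simp add: p_def)
  have x0: "x 0 = p" by (simp add: x_def b_def p_def)
  have Tle: "Tht (t\<^sup>2) \<le> 1" if "\<bar>t\<bar> \<le> 1" for t
    using Tht_mono[of "t\<^sup>2" 1] Tht_ge_1[of 1] sq_gt_m1[of t] that abs_square_le_1[of t] by simp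
  have b2: "(b t)\<^sup>2 = 4 - Tht (t\<^sup>2)" "b t \<ge> 1" if "\<bar>t\<bar> \<le> 1" for t
    using Tle[OF that] by (auto simp: b_def)
  have dx: "depth i (x t) = 0" if "\<bar>t\<bar> \<le> 1" for t
  proof -
    have te: "(t *\<^sub>R e) $ i = 0" using e by simp
    have "prj i (x t) = t *\<^sub>R e" unfolding x_def prj_add prj_axis prj_id[OF te] by simp
    moreover have "x t $ i = of_real (b t)" unfolding x_def using te by (simp add: axis_def)
    ultimately show ?thesis using b2[OF that] e by (simp add: depth_def)
  qed
  have bb: "0 \<le> b 0 - b t" "b 0 - b t \<le> kap (t\<^sup>2) * t\<^sup>2" if t: "\<bar>t\<bar> \<le> 1" for t
  proof -
    have "Tht 0 \<le> Tht (t\<^sup>2)" by (rule Tht_mono) auto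
    then show n: "0 \<le> b 0 - b t" by (simp add: b_def)
    have "(b 0 - b t) * 1 \<le> (b 0 - b t) * (b 0 + b t)"
      using n b2(2)[of 0] b2(2)[OF t] by (intro mult_left_mono) auto
    also have "\<dots> = (b 0)\<^sup>2 - (b t)\<^sup>2" by (simp add: power2_eq_square algebra_simps)
    also have "\<dots> = Tht (t\<^sup>2) - Tht 0" using b2(1)[of 0] b2(1)[OF t] by simp
    also have "\<dots> \<le> kap (t\<^sup>2) * t\<^sup>2"
      using gap_nonneg[of 0 "t\<^sup>2"] sq_gt_m1[of t] by (simp add: gap_def)
    finally show "b 0 - b t \<le> kap (t\<^sup>2) * t\<^sup>2" by simp
  qed
  have xp: "x t - (p + t *\<^sub>R e) = axis i (of_real (b t - b 0))" for t
    by (simp add: x_def p_def b_def vec_eq_iff axis_def)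
  have nxp: "norm (x t - (p + t *\<^sub>R e)) \<le> kap (t\<^sup>2) * t\<^sup>2" if "\<bar>t\<bar> \<le> 1" for t
    unfolding xp using bb[OF that] by (simp add: norm_axis_complex abs_minus_commute flip: of_real_diff)
  have "isCont \<rho>' p"
    using \<rho>'[OF p] has_derivative_continuous by blast
  then have "eventually (\<lambda>y. dist (\<rho>' y) (\<rho>' p) < 1) (at p)"
    unfolding isCont_def by (rule tendstoD) simp
  moreover have "eventually (\<lambda>y. y \<in> U) (at p)"
    using U(1) p by (rule eventually_at_in_open')
  ultimately have "eventually (\<lambda>y. dist (\<rho>' y) (\<rho>' p) < 1 \<and> y \<in> U) (at p)"
    by (rule eventually_conj)
  then obtain r where r: "r > 0" "\<And>y. y \<noteq> p \<Longrightarrow> dist y p < r \<Longrightarrow> dist (\<rho>' y) (\<rho>' p) < 1 \<and> y \<in> U"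
    unfolding eventually_at by auto
  have rU: "y \<in> U" and rB: "norm (\<rho>' y) \<le> norm (\<rho>' p) + 1" if "y \<in> ball p r" for y
  proof -
    have "dist (\<rho>' y) (\<rho>' p) < 1 \<and> y \<in> U"
      using r(2)[of y] that p by (cases "y = p") (auto simp: dist_commute)
    then show "y \<in> U" "norm (\<rho>' y) \<le> norm (\<rho>' p) + 1"
      using norm_triangle_ineq2[of "\<rho>' y" "\<rho>' p"] by (auto simp: dist_norm)
  qed
  \<comment> \<open>A local Lipschitz constant of \<rho>: it transfers the vanishing of \<rho> on
    the curve to \<rho>(p + t e) = o(t^2).\<close>
  define B where "B = norm (\<rho>' p) + 1"
  have lip: "norm (\<rho> y - \<rho> z) \<le> B * norm (y - z)" if "y \<in> ball p r" "z \<in> ball p r" for y z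
  proof (rule differentiable_bound[where S="ball p r" and f'="\<lambda>x. blinfun_apply (\<rho>' x)"])
    show "(\<rho> has_derivative blinfun_apply (\<rho>' u)) (at u within ball p r)" if "u \<in> ball p r" for u
      using \<rho>[OF rU[OF that]] by (rule has_derivative_at_withinI)
    show "onorm (blinfun_apply (\<rho>' u)) \<le> B" if "u \<in> ball p r" for u
      using rB[OF that] by (simp add: B_def norm_blinfun.rep_eq)
  qed (use that in auto)
  define d where "d = min 1 (r / 2)"
  have d: "d > 0" "d \<le> 1" "2 * d \<le> r" using r by (auto simp: d_def)
  have inb: "p + t *\<^sub>R e \<in> ball p r" if "\<bar>t\<bar> < d" for t
    using that d e by (simp add: dist_norm)
  have inb': "x t \<in> ball p r" if "\<bar>t\<bar> < d" for t
  proof -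
    have t1: "\<bar>t\<bar> \<le> 1" using that d by simp
    have "norm (x t - (p + t *\<^sub>R e)) \<le> 1 * (\<bar>t\<bar> * \<bar>t\<bar>)"
      using nxp[OF t1] mult_right_mono[OF kap_le_1[of "t\<^sup>2"], of "t\<^sup>2"] by (simp add: power2_eq_square)
    also have "\<dots> \<le> \<bar>t\<bar>" unfolding mult_1 by (rule mult_left_le[OF t1 abs_ge_zero])
    finally have "norm (x t - (p + t *\<^sub>R e)) \<le> \<bar>t\<bar>" .
    moreover have "norm (x t - p) \<le> norm (x t - (p + t *\<^sub>R e)) + norm (t *\<^sub>R e)"
      using norm_triangle_ineq[of "x t - (p + t *\<^sub>R e)" "t *\<^sub>R e"] by simp
    ultimately have "norm (x t - p) < r" using that d e by simp
    then show ?thesis by (simp add: dist_norm norm_minus_commute)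
  qed
  define g where "g t = \<rho> (p + t *\<^sub>R e)" for t
  have gb: "\<bar>g t\<bar> \<le> B * (kap (t\<^sup>2) * t\<^sup>2)" if t: "\<bar>t\<bar> < d" for t
  proof -
    have t1: "\<bar>t\<bar> \<le> 1" using t d by simp
    have "x t \<in> frontier (flat_dom i) \<inter> U"
      using dx[OF t1] rU[OF inb'[OF t]] by (simp add: frontier_flat_dom)
    then have "\<rho> (x t) = 0" using fr by blast
    then have "\<bar>g t\<bar> = norm (\<rho> (x t) - \<rho> (p + t *\<^sub>R e))" by (simp add: g_def)
    also have "\<dots> \<le> B * norm (x t - (p + t *\<^sub>R e))" by (rule lip[OF inb'[OF t] inb[OF t]])
    also have "\<dots> \<le> B * (kap (t\<^sup>2) * t\<^sup>2)" using nxp[OF t1] by (intro mult_left_mono) (auto simp: B_def)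
    finally show ?thesis .
  qed
  have line: "((\<lambda>t. p + t *\<^sub>R e) has_derivative (\<lambda>s. s *\<^sub>R e)) (at t)" for t :: real
    by (auto intro!: derivative_eq_intros)
  have D1: "(g has_real_derivative blinfun_apply (\<rho>' (p + t *\<^sub>R e)) e) (at t)" if "\<bar>t\<bar> < d" for t
    using has_derivative_compose[OF line \<rho>[OF rU[OF inb[OF that]]]]
    by (simp add: g_def[abs_def] has_field_derivative_def blinfun.scaleR_right mult_commute_abs mult.commute)
  have D2: "((\<lambda>t. blinfun_apply (\<rho>' (p + t *\<^sub>R e)) e) has_real_derivative blinfun_apply (blinfun_apply (\<rho>'' p) e) e) (at 0)"
  proof -
    have "(\<rho>' has_derivative blinfun_apply (\<rho>'' p)) (at (p + 0 *\<^sub>R e))" using \<rho>'[OF p] by simp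
    from has_derivative_compose[OF line this]
    have "((\<lambda>t. \<rho>' (p + t *\<^sub>R e)) has_derivative (\<lambda>s. blinfun_apply (\<rho>'' p) (s *\<^sub>R e))) (at 0)" .
    from bounded_linear.has_derivative[OF blinfun.bounded_linear_left this, of e]
    show ?thesis
      by (simp add: has_field_derivative_def blinfun.scaleR_right blinfun.scaleR_left mult_commute_abs mult.commute)
  qed
  have small: "((\<lambda>t. g t / t\<^sup>2) \<longlongrightarrow> 0) (at 0)"
  proof (rule Lim_null_comparison)
    have "((\<lambda>t::real. B * kap (t\<^sup>2)) \<longlongrightarrow> B * kap (0\<^sup>2)) (at 0)"
      by (intro tendsto_mult tendsto_const isCont_tendsto_compose[OF isCont_kap] tendsto_power tendsto_ident_at)
    then show "((\<lambda>t::real. B * kap (t\<^sup>2)) \<longlongrightarrow> 0) (at 0)" by simp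
    have "eventually (\<lambda>t::real. \<bar>t\<bar> < d \<and> t \<noteq> 0) (at 0)"
      unfolding eventually_at using d(1) by (auto simp: dist_real_def)
    then show "eventually (\<lambda>t. norm (g t / t\<^sup>2) \<le> B * kap (t\<^sup>2)) (at 0)"
    proof eventually_elim
      case (elim t)
      then show ?case using gb[of t] by (simp add: abs_divide divide_le_eq mult.assoc)
    qed
  qed
  have "g 0 = 0" using gb[of 0] d by simp
  from second_derivative_zero[OF d(1) D1 D2 this small]
  show "blinfun_apply (\<rho>' p) e = 0" "blinfun_apply (blinfun_apply (\<rho>'' p) e) e = 0" by simp_all
qed

text \<open>Dimension at least 2 provides an index j different from i, hence a complex tangent
  direction at p. Strong pseudoconvexity hands over an unknown defining function, so flatness is
  applied to that function instead of \<open>- depth i\<close>.\<close>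

lemma not_strongly_pseudoconvex_flat_dom:
  assumes "CARD('n::finite) \<ge> 2"
  shows "\<not> strongly_pseudoconvex (flat_dom i :: (complex ^ 'n) set)"
proof
  assume spc: "strongly_pseudoconvex (flat_dom i :: (complex ^ 'n) set)"
  define p :: "complex ^ 'n" where "p = axis i (of_real (sqrt (4 - Tht 0)))"
  have "depth i p = 0" using Tht_0_le by (simp add: depth_def p_def)
  then have "p \<in> frontier (flat_dom i)" by (simp add: frontier_flat_dom)
  with spc obtain U \<rho> where p: "p \<in> U" and df: "C2_defining_function (flat_dom i) U \<rho>"
    and pos: "\<And>v. v \<in> complex_tangent_space \<rho> p \<Longrightarrow> v \<noteq> 0 \<Longrightarrow> levi_form \<rho> p v > 0"
    unfolding strongly_pseudoconvex_def by metis
  from df have U: "open U" and fr: "frontier (flat_dom i) \<inter> U = {z\<in>U. \<rho> z = 0}" and C2: "C2_on U \<rho>"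
    unfolding C2_defining_function_def by auto
  from C2 obtain \<rho>' \<rho>'' where \<rho>: "\<And>x. x \<in> U \<Longrightarrow> (\<rho> has_derivative blinfun_apply (\<rho>' x)) (at x)"
    and \<rho>': "\<And>x. x \<in> U \<Longrightarrow> (\<rho>' has_derivative blinfun_apply (\<rho>'' x)) (at x)"
    unfolding C2_on_def by blast
  obtain j :: 'n where j: "j \<noteq> i"
    using assms by (metis UNIV_I card_2_iff' card_le_Suc0_iff_eq finite_code not_less_eq_eq numeral_2_eq_2)
  define e1 e2 :: "complex ^ 'n" where "e1 = axis j 1" and "e2 = axis j \<i>"
  have e: "e1 $ i = 0" "norm e1 = 1" "e2 $ i = 0" "norm e2 = 1"
    unfolding e1_def e2_def norm_axis_complex using j by (simp_all add: axis_def)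
  note flat = defining_function_flat[OF U p[unfolded p_def] \<rho> \<rho>' fr, folded p_def]
  have f1: "blinfun_apply (\<rho>' p) e1 = 0" "blinfun_apply (blinfun_apply (\<rho>'' p) e1) e1 = 0"
    by (rule flat; use e in simp)+
  have f2: "blinfun_apply (\<rho>' p) e2 = 0" "blinfun_apply (blinfun_apply (\<rho>'' p) e2) e2 = 0"
    by (rule flat; use e in simp)+
  define R where "R z = complex_of_real (\<rho> z)" for z
  have fd: "frechet_derivative R (at z) = (\<lambda>v. of_real (blinfun_apply (\<rho>' z) v))" if "z \<in> U" for z
    unfolding R_def[abs_def]
    by (rule frechet_derivative_at[symmetric]) (rule bounded_linear.has_derivative[OF bounded_linear_of_real \<rho>[OF that]])
  have wb: "wirtinger_bar j R z = (of_real (blinfun_apply (\<rho>' z) e1) + \<i> * of_real (blinfun_apply (\<rho>' z) e2)) / 2"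
    if "z \<in> U" for z
    unfolding wirtinger_bar_def fd[OF that] e1_def e2_def ..
  have "wirtinger j R p = 0"
    unfolding wirtinger_def fd[OF p] e1_def[symmetric] e2_def[symmetric] f1 f2 by simp
  have single: "(\<Sum>k\<in>UNIV. F k * cnj (e1 $ k)) = F j" "(\<Sum>k\<in>UNIV. F k * (e1 $ k)) = F j" for F
  proof -
    have "(\<Sum>k\<in>UNIV. F k * cnj (e1 $ k)) = (\<Sum>k\<in>UNIV. if k = j then F j else 0)"
      "(\<Sum>k\<in>UNIV. F k * (e1 $ k)) = (\<Sum>k\<in>UNIV. if k = j then F j else 0)"
      by (rule sum.cong; simp add: e1_def axis_def)+
    then show "(\<Sum>k\<in>UNIV. F k * cnj (e1 $ k)) = F j" "(\<Sum>k\<in>UNIV. F k * (e1 $ k)) = F j" by simp_all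
  qed
  have "e1 \<in> complex_tangent_space \<rho> p"
    unfolding complex_tangent_space_def mem_Collect_eq single using \<open>wirtinger j R p = 0\<close>
    by (simp add: R_def[abs_def])
  moreover have "e1 \<noteq> 0" using e by auto
  ultimately have "levi_form \<rho> p e1 > 0" by (rule pos)
  moreover have "levi_form \<rho> p e1 = Re (wirtinger j (wirtinger_bar j R) p)"
    unfolding levi_form_def single by (simp add: R_def[abs_def])
  moreover have "Re (wirtinger j (wirtinger_bar j R) p) = 0"
  \<comment> \<open>The (j, j) coefficient is a quarter of the sum of the second derivatives along
    \<open>e1\<close> and \<open>e2\<close>, plus an imaginary contribution of the mixed ones that
    \<open>Re\<close> discards; both pure derivatives vanish by flatness.\<close>
  proof -
    have D: "((\<lambda>z. complex_of_real (blinfun_apply (\<rho>' z) v)) has_derivative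
        (\<lambda>u. of_real (blinfun_apply (blinfun_apply (\<rho>'' p) u) v))) (at p)" for v
      by (rule bounded_linear.has_derivative[OF bounded_linear_of_real
            bounded_linear.has_derivative[OF blinfun.bounded_linear_left \<rho>'[OF p]]])
    have "((\<lambda>z. (of_real (blinfun_apply (\<rho>' z) e1) + \<i> * of_real (blinfun_apply (\<rho>' z) e2)) / 2) has_derivative
        (\<lambda>u. (of_real (blinfun_apply (blinfun_apply (\<rho>'' p) u) e1)
           + \<i> * of_real (blinfun_apply (blinfun_apply (\<rho>'' p) u) e2)) / 2)) (at p)"
      by (intro bounded_linear.has_derivative[OF bounded_linear_divide] has_derivative_add
          has_derivative_mult_right D)
    then have "(wirtinger_bar j R has_derivative
        (\<lambda>u. (of_real (blinfun_apply (blinfun_apply (\<rho>'' p) u) e1)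
           + \<i> * of_real (blinfun_apply (blinfun_apply (\<rho>'' p) u) e2)) / 2)) (at p)"
      by (rule has_derivative_transform_within_open[OF _ U p]) (simp add: wb)
    then have "frechet_derivative (wirtinger_bar j R) (at p) =
        (\<lambda>u. (of_real (blinfun_apply (blinfun_apply (\<rho>'' p) u) e1)
           + \<i> * of_real (blinfun_apply (blinfun_apply (\<rho>'' p) u) e2)) / 2)"
      by (rule frechet_derivative_at[symmetric])
    then show ?thesis
      unfolding wirtinger_def e1_def[symmetric] e2_def[symmetric] using f1 f2 by simp
  qed
  ultimately show False by simp
qed

theorem theorem1p1:
  assumes "CARD('n::finite) \<ge> 2"
  shows "\<exists>\<Omega> :: (complex ^ 'n) set.
           bounded_domain \<Omega> \<and> convex \<Omega> \<and> C2_boundary \<Omega> \<and>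
           \<not> strongly_pseudoconvex \<Omega> \<and>
           (\<forall>\<epsilon>>0. \<exists>\<delta>>0. \<forall>z\<in>\<Omega>. infdist z (frontier \<Omega>) < \<delta> \<longrightarrow>
              \<bar>squeezing_function \<Omega> z - 1\<bar> < \<epsilon>)"
proof -
  obtain i :: 'n where True by simp
  define \<Omega> :: "(complex ^ 'n) set" where "\<Omega> = flat_dom i"
  have "\<exists>\<delta>>0. \<forall>z\<in>\<Omega>. infdist z (frontier \<Omega>) < \<delta> \<longrightarrow> \<bar>squeezing_function \<Omega> z - 1\<bar> < \<epsilon>"
    if "\<epsilon> > 0" for \<epsilon> :: real
  proof -
    define \<epsilon>' where "\<epsilon>' = min (\<epsilon> / 2) (1 / 2)"
    have \<epsilon>': "0 < \<epsilon>'" "\<epsilon>' < 1" "\<epsilon>' < \<epsilon>" using that by (auto simp: \<epsilon>'_def)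
    obtain t where t: "t > 0" "\<And>P. P \<in> \<Omega> \<Longrightarrow> depth i P < t \<Longrightarrow>
       \<exists>f. ball_embedding \<Omega> f \<and> f P = 0 \<and> ball 0 (1 - \<epsilon>') \<subseteq> f ` \<Omega>"
      unfolding \<Omega>_def using embedding_exists[OF \<epsilon>'(1,2)] by blast
    have "\<Omega> \<noteq> {}" "\<Omega> \<noteq> UNIV"
      using bounded_domain_flat_dom[of i] by (auto simp: \<Omega>_def bounded_domain_def)
    then have ne: "frontier \<Omega> \<noteq> {}" using frontier_eq_empty by blast
    show ?thesis
    proof (intro exI[of _ "t / 8"] conjI ballI impI)
      show "t / 8 > 0" using t by simp
      fix z assume z: "z \<in> \<Omega>" "infdist z (frontier \<Omega>) < t / 8"
      then have "depth i z < t"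
        using depth_le_infdist[of z i] ne by (simp add: \<Omega>_def)
      then obtain f where f: "ball_embedding \<Omega> f" "f z = 0" "ball 0 (1 - \<epsilon>') \<subseteq> f ` \<Omega>"
        using t(2) z(1) by blast
      have "1 - \<epsilon>' \<le> squeezing_function \<Omega> z" "squeezing_function \<Omega> z \<le> 1"
        using squeezing_function_bounds[OF _ z(1) f(1,2) _ f(3)] \<epsilon>' open_flat_dom by (auto simp: \<Omega>_def)
      then show "\<bar>squeezing_function \<Omega> z - 1\<bar> < \<epsilon>" using \<epsilon>' by linarith
    qed
  qed
  then show ?thesis
    using bounded_domain_flat_dom[of i] convex_flat_dom[of i] C2_boundary_flat_dom[of i]
      not_strongly_pseudoconvex_flat_dom[OF assms, of i] unfolding \<Omega>_def by blast
qed

end
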